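(* There exists a finitely presented group with undecidable conjugacy problem and quadratic Dehn function.
   Context: For a finite group presentation $G=\langle X\mid R\rangle$ and a word $w$ over $X^{\pm1}$ equal to $1$ in $G$, the area of $w$ is the minimal $m$ such that, in the free group $F(X)$, $w$ is a product $v_1\cdots v_m$ of factors $v_i=u_ir_i^{\pm1}u_i^{-1}$ with $r_i\in R$ and $u_i\in F(X)$. The Dehn function of $\langle X\mid R\rangle$ is the smallest function $f(n)$ such that every word $w$ of length at most $n$ over $X^{\pm1}$ which equals $1$ in $G$ has area at most $f(n)$. Two functions $f,g$ are called equivalent if for some constants $A,B,C,D\ge1$ and every $n\ge0$ one has $\frac1A f\left(\frac nB\right)-Cn-D<g(n)<Af(Bn)+Cn+D$; Dehn functions of different finite presentations of the same group are equivalent, and equivalent functions are not distinguished. The Dehn function is quadratic if it is equivalent to $n^2$. The conjugacy problem for $G=\langle X\mid R\rangle$ asks, given two words over $X^{\pm1}$, whether they represent conjugate elements of $G$; it is undecidable if no algorithm answers it for all pairs of words. *)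

theory Defs
  imports Complex_Main "HOL-Algebra.Generated_Groups" "HOL-Library.Nat_Bijection"
begin

section \<open>Words and free groups\<close>

text \<open>The letter \<open>(x, True)\<close> stands for the generator \<open>x\<close> and \<open>(x, False)\<close> for its formal inverse.
  Words need not be reduced.\<close>

type_synonym 'a letter = "'a \<times> bool"
type_synonym 'a word = "'a letter list"

definition words :: "'a set \<Rightarrow> 'a word set" where
  "words X = lists (X \<times> UNIV)"

definition inv_letter :: "'a letter \<Rightarrow> 'a letter" where
  "inv_letter a = (fst a, \<not> snd a)"

fun reduced :: "'a word \<Rightarrow> bool" where
  "reduced (a # b # w) \<longleftrightarrow> b \<noteq> inv_letter a \<and> reduced (b # w)"
| "reduced w \<longleftrightarrow> True"

fun cons_red :: "'a letter \<Rightarrow> 'a word \<Rightarrow> 'a word" where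
  "cons_red a [] = [a]"
| "cons_red a (b # w) = (if b = inv_letter a then w else a # b # w)"

definition reduce :: "'a word \<Rightarrow> 'a word" where
  "reduce w = foldr cons_red w []"

definition free_group :: "'a set \<Rightarrow> 'a word monoid" where
  "free_group X = \<lparr>carrier = {w \<in> words X. reduced w}, mult = (\<lambda>u v. reduce (u @ v)), one = []\<rparr>"

lemma inv_letter_inv_letter [simp]: "inv_letter (inv_letter a) = a"
  by (simp add: inv_letter_def)

lemma inv_letter_in_iff [simp]: "inv_letter a \<in> X \<times> UNIV \<longleftrightarrow> a \<in> X \<times> UNIV"
  by (cases a) (simp add: inv_letter_def)

lemma reduced_Cons: "reduced (a # w) \<Longrightarrow> reduced w"
  by (cases w) auto

lemma reduced_cons_red: "reduced w \<Longrightarrow> reduced (cons_red a w)"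
  by (cases w) (auto dest: reduced_Cons)

lemma cons_red_cancel: "reduced w \<Longrightarrow> cons_red a (cons_red (inv_letter a) w) = w"
proof (cases w)
  case (Cons b v)
  assume "reduced w"
  then show ?thesis using Cons by (cases v) auto
qed simp

lemma cons_red_words: "a \<in> X \<times> UNIV \<Longrightarrow> w \<in> words X \<Longrightarrow> cons_red a w \<in> words X"
  by (cases w) (auto simp: words_def)

lemma reduced_foldr: "reduced v \<Longrightarrow> reduced (foldr cons_red u v)"
  by (induction u) (auto intro: reduced_cons_red)

lemma reduced_reduce: "reduced (reduce w)"
  unfolding reduce_def by (rule reduced_foldr) simp

lemma reduce_words: "w \<in> words X \<Longrightarrow> reduce w \<in> words X"
proof (induction w)
  case (Cons a w)
  then have "a \<in> X \<times> UNIV" "w \<in> words X" by (auto simp: words_def)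
  with Cons.IH show ?case by (simp add: reduce_def cons_red_words)
qed (simp add: reduce_def)

lemma reduce_reduced: "reduced w \<Longrightarrow> reduce w = w"
proof (induction w)
  case (Cons a w)
  then have "reduce w = w" using reduced_Cons by blast
  then show ?case using Cons.prems by (cases w) (auto simp: reduce_def)
qed (simp add: reduce_def)

lemma reduce_append: "reduce (u @ v) = foldr cons_red u (reduce v)"
  by (simp add: reduce_def)

lemma foldr_cons_red_cons_red:
  assumes "reduced s"
  shows "foldr cons_red (cons_red a r) s = cons_red a (foldr cons_red r s)"
proof (cases r)
  case (Cons b q)
  have "reduced (foldr cons_red q s)" using assms by (rule reduced_foldr)
  then show ?thesis using Cons by (simp add: cons_red_cancel)
qed simp

lemma reduce_append_left: "reduce (reduce u @ v) = reduce (u @ v)"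
proof (induction u)
  case (Cons a u)
  have "reduce (reduce (a # u) @ v) = foldr cons_red (cons_red a (reduce u)) (reduce v)"
    by (simp add: reduce_append) (simp add: reduce_def)
  also have "\<dots> = cons_red a (reduce (reduce u @ v))"
    by (simp add: foldr_cons_red_cons_red reduced_reduce reduce_append)
  also have "\<dots> = reduce ((a # u) @ v)"
    by (simp add: Cons.IH) (simp add: reduce_def)
  finally show ?case .
qed (simp add: reduce_def)

lemma reduce_append_right: "reduce (u @ reduce v) = reduce (u @ v)"
  by (simp add: reduce_append reduce_reduced[OF reduced_reduce])

lemma reduce_inverse: "reduce (rev (map inv_letter w) @ w) = []"
proof (induction w)
  case (Cons a w)
  have "cons_red (inv_letter a) (cons_red (inv_letter (inv_letter a)) (reduce w)) = reduce w"
    by (rule cons_red_cancel[OF reduced_reduce])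
  then have "reduce (rev (map inv_letter (a # w)) @ a # w) = reduce (rev (map inv_letter w) @ w)"
    by (simp add: reduce_append) (simp add: reduce_def)
  then show ?case using Cons.IH by simp
qed (simp add: reduce_def)

lemma words_Nil [simp]: "[] \<in> words X"
  by (simp add: words_def)

lemma words_append [simp]: "u @ v \<in> words X \<longleftrightarrow> u \<in> words X \<and> v \<in> words X"
  by (auto simp: words_def)

lemma inverse_words: "w \<in> words X \<Longrightarrow> rev (map inv_letter w) \<in> words X"
  unfolding words_def lists_eq_set by auto (auto simp: inv_letter_def)

lemma group_free_group: "group (free_group X)"
proof (rule groupI)
  fix w assume w: "w \<in> carrier (free_group X)"
  let ?v = "reduce (rev (map inv_letter w))"
  have "?v \<in> carrier (free_group X)" "?v \<otimes>\<^bsub>free_group X\<^esub> w = \<one>\<^bsub>free_group X\<^esub>"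
    using w by (auto simp: free_group_def reduce_words inverse_words reduced_reduce
        reduce_append_left reduce_inverse)
  then show "\<exists>v\<in>carrier (free_group X). v \<otimes>\<^bsub>free_group X\<^esub> w = \<one>\<^bsub>free_group X\<^esub>"
    by blast
qed (auto simp: free_group_def reduced_reduce reduce_append_left reduce_append_right
    reduce_reduced reduce_words)

lemma reduce_in_free_group: "w \<in> words X \<Longrightarrow> reduce w \<in> carrier (free_group X)"
  by (simp add: free_group_def reduce_words reduced_reduce)


section \<open>Finite presentations\<close>

definition finite_presentation :: "'a set \<Rightarrow> 'a word set \<Rightarrow> bool" where
  "finite_presentation X R \<longleftrightarrow> finite X \<and> finite R \<and> R \<subseteq> words X"

definition normal_closure :: "('g, 'm) monoid_scheme \<Rightarrow> 'g set \<Rightarrow> 'g set" where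
  "normal_closure G S = generate G {u \<otimes>\<^bsub>G\<^esub> s \<otimes>\<^bsub>G\<^esub> inv\<^bsub>G\<^esub> u | u s. u \<in> carrier G \<and> s \<in> S}"

text \<open>Relators are arbitrary words; \<open>reduce\<close> turns them into elements of the free group.\<close>

definition relator_subgroup :: "'a set \<Rightarrow> 'a word set \<Rightarrow> 'a word set" where
  "relator_subgroup X R = normal_closure (free_group X) (reduce ` R)"

definition presented_group :: "'a set \<Rightarrow> 'a word set \<Rightarrow> 'a word set monoid" where
  "presented_group X R = free_group X Mod relator_subgroup X R"

definition word_value :: "'a set \<Rightarrow> 'a word set \<Rightarrow> 'a word \<Rightarrow> 'a word set" where
  "word_value X R w = relator_subgroup X R #>\<^bsub>free_group X\<^esub> reduce w"

lemma (in group) normal_closure_normal: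
  assumes S: "S \<subseteq> carrier G"
  shows "normal_closure G S \<lhd> G"
  unfolding normal_closure_def
proof (rule normal_generateI)
  show "{u \<otimes> s \<otimes> inv u |u s. u \<in> carrier G \<and> s \<in> S} \<subseteq> carrier G" using S by auto
next
  fix h g assume "h \<in> {u \<otimes> s \<otimes> inv u |u s. u \<in> carrier G \<and> s \<in> S}" and g: "g \<in> carrier G"
  then obtain u s where us: "u \<in> carrier G" "s \<in> S" "h = u \<otimes> s \<otimes> inv u" by blast
  then have "s \<in> carrier G" using S by blast
  then have "g \<otimes> h \<otimes> inv g = (g \<otimes> u) \<otimes> s \<otimes> inv (g \<otimes> u)"
    using us g by (simp add: m_assoc inv_mult_group)
  then show "g \<otimes> h \<otimes> inv g \<in> {u \<otimes> s \<otimes> inv u |u s. u \<in> carrier G \<and> s \<in> S}"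
    using us g by blast
qed

lemma group_presented_group:
  assumes "R \<subseteq> words X"
  shows "group (presented_group X R)"
proof -
  interpret F: group "free_group X" by (rule group_free_group)
  have "relator_subgroup X R \<lhd> free_group X"
    unfolding relator_subgroup_def
    by (rule F.normal_closure_normal) (use assms in \<open>auto intro: reduce_in_free_group\<close>)
  then show ?thesis unfolding presented_group_def by (rule normal.factorgroup_is_group)
qed


section \<open>Area and Dehn function\<close>

text \<open>\<open>area X R w\<close> is meaningful only for words representing \<open>1\<close>; exactly for these does a
  factorisation exist. If \<open>X\<close> is finite, the bound in \<open>dehn_function\<close> exists because there
  are only finitely many words of length at most \<open>n\<close>.\<close>

definition relator_conjugates :: "'a set \<Rightarrow> 'a word set \<Rightarrow> 'a word set" where
  "relator_conjugates X R =
     {u \<otimes>\<^bsub>free_group X\<^esub> s \<otimes>\<^bsub>free_group X\<^esub> inv\<^bsub>free_group X\<^esub> u | u r s.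
        u \<in> carrier (free_group X) \<and> r \<in> R \<and> s \<in> {reduce r, inv\<^bsub>free_group X\<^esub> (reduce r)}}"

definition area :: "'a set \<Rightarrow> 'a word set \<Rightarrow> 'a word \<Rightarrow> nat" where
  "area X R w = (LEAST m. \<exists>vs. length vs = m \<and> set vs \<subseteq> relator_conjugates X R \<and>
     reduce w = foldr (mult (free_group X)) vs \<one>\<^bsub>free_group X\<^esub>)"

definition dehn_function :: "'a set \<Rightarrow> 'a word set \<Rightarrow> nat \<Rightarrow> nat" where
  "dehn_function X R n = (LEAST k. \<forall>w\<in>words X.
     length w \<le> n \<and> word_value X R w = \<one>\<^bsub>presented_group X R\<^esub> \<longrightarrow> area X R w \<le> k)"

text \<open>Functions on the natural numbers are evaluated at a real argument \<open>t \<ge> 0\<close> by rounding \<open>t\<close> down;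
  for a Dehn function this is the value obtained by reading ``length at most \<open>t\<close>'' for real \<open>t\<close>.\<close>

definition equivalent_growth :: "(nat \<Rightarrow> real) \<Rightarrow> (nat \<Rightarrow> real) \<Rightarrow> bool" where
  "equivalent_growth f g \<longleftrightarrow> (\<exists>A B C D :: real. A \<ge> 1 \<and> B \<ge> 1 \<and> C \<ge> 1 \<and> D \<ge> 1 \<and>
     (\<forall>n. 1 / A * f (nat \<lfloor>real n / B\<rfloor>) - C * real n - D < g n \<and>
          g n < A * f (nat \<lfloor>B * real n\<rfloor>) + C * real n + D))"

definition quadratic_dehn_function :: "'a set \<Rightarrow> 'a word set \<Rightarrow> bool" where
  "quadratic_dehn_function X R \<longleftrightarrow>
     equivalent_growth (\<lambda>n. real (dehn_function X R n)) (\<lambda>n. (real n)\<^sup>2)"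


section \<open>Decidability\<close>

text \<open>Algorithms are partial recursive functions, given by codes; \<open>rec_eval f xs y\<close> says that
  the function coded by \<open>f\<close> is defined on the argument list \<open>xs\<close> with value \<open>y\<close>.\<close>

datatype recf = Zero | Succ | Proj nat | Comp recf "recf list" | PrimRec recf recf | Minim recf

inductive rec_eval :: "recf \<Rightarrow> nat list \<Rightarrow> nat \<Rightarrow> bool" where
  zero: "rec_eval Zero xs 0"
| succ: "rec_eval Succ [x] (Suc x)"
| proj: "i < length xs \<Longrightarrow> rec_eval (Proj i) xs (xs ! i)"
| comp: "length ys = length gs \<Longrightarrow> (\<forall>i<length gs. rec_eval (gs ! i) xs (ys ! i)) \<Longrightarrow>
    rec_eval f ys z \<Longrightarrow> rec_eval (Comp f gs) xs z"
| primrec_0: "rec_eval f xs y \<Longrightarrow> rec_eval (PrimRec f g) (0 # xs) y"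
| primrec_Suc: "rec_eval (PrimRec f g) (n # xs) y \<Longrightarrow> rec_eval g (n # y # xs) z \<Longrightarrow>
    rec_eval (PrimRec f g) (Suc n # xs) z"
| minim: "rec_eval f (n # xs) 0 \<Longrightarrow> (\<forall>i<n. \<exists>k. rec_eval f (i # xs) (Suc k)) \<Longrightarrow>
    rec_eval (Minim f) xs n"

inductive_cases rec_eval_ZeroE: "rec_eval Zero xs y"
inductive_cases rec_eval_SuccE: "rec_eval Succ xs y"
inductive_cases rec_eval_ProjE: "rec_eval (Proj i) xs y"
inductive_cases rec_eval_CompE: "rec_eval (Comp f gs) xs y"
inductive_cases rec_eval_PrimRec_0E: "rec_eval (PrimRec f g) (0 # xs) y"
inductive_cases rec_eval_PrimRec_SucE: "rec_eval (PrimRec f g) (Suc n # xs) y"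
inductive_cases rec_eval_MinimE: "rec_eval (Minim f) xs y"

lemma rec_eval_functional: "rec_eval f xs y \<Longrightarrow> rec_eval f xs z \<Longrightarrow> y = z"
proof (induction arbitrary: z rule: rec_eval.induct)
  case (comp ys gs xs f z')
  from comp.prems obtain ys' where ys': "length ys' = length gs"
    "\<forall>i<length gs. rec_eval (gs ! i) xs (ys' ! i)" "rec_eval f ys' z"
    by (rule rec_eval_CompE)
  have "ys = ys'" using comp.hyps(1) comp.IH(1) ys'(1,2) by (intro nth_equalityI) auto
  then show ?case using comp.IH(2) ys'(3) by blast
next
  case (minim f n xs)
  from minim.prems have z: "rec_eval f (z # xs) 0" "\<forall>i<z. \<exists>k. rec_eval f (i # xs) (Suc k)"
    by (auto elim: rec_eval_MinimE)
  have "\<not> z < n" using minim.IH(2) z(1) by blast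
  moreover have "\<not> n < z" using minim.IH(1) z(2) by blast
  ultimately show ?case by simp
qed (blast elim: rec_eval_ZeroE rec_eval_SuccE rec_eval_ProjE rec_eval_PrimRec_0E
    rec_eval_PrimRec_SucE)+

definition word_code :: "nat word \<Rightarrow> nat" where
  "word_code w = list_encode (map (\<lambda>(x, b). prod_encode (x, of_bool b)) w)"

lemma inj_word_code: "inj word_code"
proof -
  have "inj (\<lambda>(x, b). prod_encode (x, of_bool b))"
    by (auto simp: inj_on_def prod_encode_eq)
  then show ?thesis
    by (auto simp: word_code_def list_encode_eq intro!: injI dest: map_injective)
qed

definition decidable_on_words :: "nat set \<Rightarrow> (nat word \<Rightarrow> nat word \<Rightarrow> bool) \<Rightarrow> bool" where
  "decidable_on_words X P \<longleftrightarrow>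
     (\<exists>f. \<forall>u\<in>words X. \<forall>v\<in>words X. rec_eval f [word_code u, word_code v] (of_bool (P u v)))"

definition conjugate_in :: "('g, 'm) monoid_scheme \<Rightarrow> 'g \<Rightarrow> 'g \<Rightarrow> bool" where
  "conjugate_in G x y \<longleftrightarrow> (\<exists>g\<in>carrier G. y = g \<otimes>\<^bsub>G\<^esub> x \<otimes>\<^bsub>G\<^esub> inv\<^bsub>G\<^esub> g)"

definition decidable_conjugacy_problem :: "nat set \<Rightarrow> nat word set \<Rightarrow> bool" where
  "decidable_conjugacy_problem X R \<longleftrightarrow> decidable_on_words X
     (\<lambda>u v. conjugate_in (presented_group X R) (word_value X R u) (word_value X R v))"

end

theory Submission
  imports Defs "HOL-Computational_Algebra.Primes" "HOL-Computational_Algebra.Formal_Laurent_Series"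
    "HOL-Library.Product_Plus" "HOL-Library.Z2"
begin

text \<open>Let \<open>R = F\<^sub>2[x, 1/x, 1/(1+x)]\<close> and let \<open>M\<close> be the ring of \<open>2 \<times> 2\<close> matrices over \<open>R\<close>. The group is a
  split extension of the additive group \<open>M \<times> M\<close> by \<open>F \<times> \<int>\<^sup>3\<close>, where \<open>F\<close> is free and \<open>\<int>\<^sup>3\<close> acts by three
  scalar units of \<open>R\<close>, each of which contracts two of the completions of \<open>R\<close> at \<open>0\<close>, \<open>1\<close> and infinity.

  Dehn function: \<open>M \<times> M\<close> is a lattice in the product of its three completions, so fillings can be
  constructed over the product and rounded to the lattice. There every element is a sum of
  three elements, each contracted by one of the units, and hence each is represented by a word
  of length proportional to its degree. Merging such normal forms dyadically fills
  a word of length \<open>n\<close> with \<open>O(n\<^sup>2)\<close> relators; the commutators \<open>[a\<^sup>n, b\<^sup>n]\<close> in \<open>\<int>\<^sup>3\<close> show that this is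
  optimal.

  Conjugacy: let \<open>\<phi>\<close> be a faithful representation of a free group by matrices of
  determinant \<open>1\<close> over \<open>R\<close>, and \<open>N\<close> the normal closure of finitely many words. The free
  generators of \<open>F\<close> act so that a translation by \<open>(\<phi> w, 0)\<close> is conjugate to the translation by
  \<open>(1, 0)\<close> iff \<open>w \<in> N\<close>. The relators are chosen so that the words \<open>[k, x\<^sup>-\<^sup>n t x\<^sup>n]\<close> decide
  reachability in a generalised Collatz system, and such systems simulate register machines.\<close>

section \<open>Total recursive functions\<close>

text \<open>An undecidable orbit problem has to coexist with an easy word problem. The Dehn function
  only sees how translations are moved through letters, and this cost hardly depends on the action
  of \<open>F\<close>: the three units are scalars, so their powers commute with every letter, and a
  letter changes the size of a translation by a bounded amount. The orbits under \<open>F\<close>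
  may therefore be as complicated as desired; only conjugacy sees them.

  Three completions are needed because, by the product formula, no unit contracts all places.
  Translations from two different components commute cheaply only through a unit contracting both,
  so every pair of components must have such a unit; with only two completions none exists.

  The relators are not listed: all words of length at most 8 that represent 1 are taken. Fillings
  over the product of the completions use moves of bounded size, and rounding turns each move into
  one such word.

  The finite field leaves only finitely many lattice points of bounded size. Characteristic 2
  removes signs and makes 1 the only square root of 1 in the product of the completions, which the
  determinant argument needs.\<close>

definition rc :: "nat \<Rightarrow> (nat list \<Rightarrow> nat) \<Rightarrow> bool" where
  "rc k F \<longleftrightarrow> (\<exists>f. \<forall>xs. length xs = k \<longrightarrow> rec_eval f xs (F xs))"

lemma rc_cong: "rc k F \<Longrightarrow> (\<And>xs. length xs = k \<Longrightarrow> F xs = G xs) \<Longrightarrow> rc k G"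
  unfolding rc_def by metis

lemma rc_nth: "i < k \<Longrightarrow> rc k (\<lambda>xs. xs ! i)"
  unfolding rc_def by (metis rec_eval.proj)

lemma rc_comp:
  assumes F: "rc (length Gs) F" and G: "\<And>G. G \<in> set Gs \<Longrightarrow> rc k G"
  shows "rc k (\<lambda>xs. F (map (\<lambda>G. G xs) Gs))"
proof -
  obtain f where f: "\<And>xs. length xs = length Gs \<Longrightarrow> rec_eval f xs (F xs)"
    using F unfolding rc_def by blast
  have "\<exists>g. \<forall>xs. length xs = k \<longrightarrow> rec_eval g xs (G xs)" if "G \<in> set Gs" for G
    using G[OF that] unfolding rc_def .
  then obtain g where g: "\<And>G xs. G \<in> set Gs \<Longrightarrow> length xs = k \<Longrightarrow> rec_eval (g G) xs (G xs)"
    by metis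
  have "rec_eval (Comp f (map g Gs)) xs (F (map (\<lambda>G. G xs) Gs))" if "length xs = k" for xs
    by (rule rec_eval.comp[where ys = "map (\<lambda>G. G xs) Gs"]) (auto simp: g that f)
  then show ?thesis unfolding rc_def by blast
qed

lemma rc_comp1: "rc 1 F \<Longrightarrow> rc k G \<Longrightarrow> rc k (\<lambda>xs. F [G xs])"
  using rc_comp[of "[G]" F k] by simp

lemma rc_0: "rc k (\<lambda>xs. 0)"
  unfolding rc_def using rec_eval.zero by blast

lemma rc_Suc: "rc k G \<Longrightarrow> rc k (\<lambda>xs. Suc (G xs))"
proof -
  have "rec_eval Succ xs (Suc (hd xs))" if "length xs = 1" for xs
    using that by (cases xs) (auto intro: rec_eval.succ)
  then have "rc 1 (\<lambda>xs. Suc (hd xs))" unfolding rc_def by blast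
  then show "rc k G \<Longrightarrow> rc k (\<lambda>xs. Suc (G xs))" using rc_comp1 by fastforce
qed

lemma rc_const: "rc k (\<lambda>xs. c)"
  by (induction c) (auto intro: rc_0 rc_Suc)

lemma rc_primrec:
  assumes "rc k F" "rc (k + 2) G"
  shows "rc (Suc k) (\<lambda>xs. rec_nat (F (tl xs)) (\<lambda>n y. G (n # y # tl xs)) (hd xs))"
proof -
  obtain f g where f: "\<And>xs. length xs = k \<Longrightarrow> rec_eval f xs (F xs)"
    and g: "\<And>xs. length xs = k + 2 \<Longrightarrow> rec_eval g xs (G xs)"
    using assms unfolding rc_def by blast
  have "rec_eval (PrimRec f g) (n # xs) (rec_nat (F xs) (\<lambda>n y. G (n # y # xs)) n)"
    if "length xs = k" for xs n
    by (induction n) (auto simp: that intro!: rec_eval.intros f g)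
  then have "rec_eval (PrimRec f g) xs
      (rec_nat (F (tl xs)) (\<lambda>n y. G (n # y # tl xs)) (hd xs))" if "length xs = Suc k" for xs
    using that by (cases xs) auto
  then show ?thesis unfolding rc_def by blast
qed

lemma rc_args:
  assumes "rc k F" "length is = k" "\<And>i. i \<in> set is \<Longrightarrow> i < l"
  shows "rc l (\<lambda>xs. F (map (\<lambda>i. xs ! i) is))"
proof -
  have "rc l (\<lambda>xs. F (map (\<lambda>G. G xs) (map (\<lambda>i xs. xs ! i) is)))"
    using assms by (intro rc_comp) (auto intro: rc_nth)
  then show ?thesis by (simp add: comp_def)
qed

lemma rc_drop: "rc k F \<Longrightarrow> rc (j + k) (\<lambda>xs. F (drop j xs))"
proof -
  assume "rc k F"
  then have "rc (j + k) (\<lambda>xs. F (map (\<lambda>i. xs ! i) [j..<j + k]))"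
    by (intro rc_args) auto
  then show ?thesis
    by (rule rc_cong) (auto simp: list_eq_iff_nth_eq intro!: arg_cong[where f = F])
qed

lemma rc_rec:
  assumes N: "rc k N" and F: "rc k F" and G: "rc (k + 2) G"
  shows "rc k (\<lambda>xs. rec_nat (F xs) (\<lambda>n y. G (n # y # xs)) (N xs))"
proof -
  let ?P = "\<lambda>xs. rec_nat (F (tl xs)) (\<lambda>n y. G (n # y # tl xs)) (hd xs)"
  have "rc k (\<lambda>xs. ?P (map (\<lambda>G. G xs) (N # map (\<lambda>i xs. xs ! i) [0..<k])))"
    using rc_primrec[OF F G] N by (intro rc_comp) (auto intro: rc_nth)
  then show ?thesis
  proof (rule rc_cong)
    fix xs :: "nat list" assume xs: "length xs = k"
    then have *: "map (\<lambda>G. G xs) (map (\<lambda>i xs. xs ! i) [0..<k]) = xs"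
      by (auto simp: list_eq_iff_nth_eq)
    show "?P (map (\<lambda>G. G xs) (N # map (\<lambda>i xs. xs ! i) [0..<k])) =
      rec_nat (F xs) (\<lambda>n y. G (n # y # xs)) (N xs)"
      by (simp only: list.map list.sel *)
  qed
qed

text \<open>Primitive recursion in the form applied below: the step function receives the counter,
  the previous value and then the unchanged arguments, so \<open>xs ! 0\<close> and
  \<open>xs ! 1\<close> are the former two and \<open>drop 2\<close> recovers the latter.\<close>

lemma rc_rec':
  assumes N: "rc k N" and F: "rc k F" and G: "rc (2 + k) G"
    and eq: "\<And>xs. length xs = k \<Longrightarrow> H xs = rec_nat (F xs) (\<lambda>n y. G (n # y # xs)) (N xs)"
  shows "rc k H"
  using rc_cong[OF rc_rec[of k N F G]] N F G eq by (simp add: add.commute)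

lemma rc_up: "rc k F \<Longrightarrow> rc (2 + k) (\<lambda>xs. F (drop 2 xs))"
  by (rule rc_drop)

lemma rc_add:
  assumes "rc k F" "rc k G" shows "rc k (\<lambda>xs. F xs + G xs)"
proof (rule rc_rec'[OF assms(2,1)])
  show "rc (2 + k) (\<lambda>xs. Suc (xs ! 1))" by (intro rc_Suc rc_nth) simp
  fix xs
  have "F xs + n = rec_nat (F xs) (\<lambda>n y. Suc ((n # y # xs) ! 1)) n" for n
    by (induction n) auto
  then show "F xs + G xs = rec_nat (F xs) (\<lambda>n y. Suc ((n # y # xs) ! 1)) (G xs)" .
qed

lemma rc_mult:
  assumes "rc k F" "rc k G" shows "rc k (\<lambda>xs. F xs * G xs)"
proof (rule rc_rec'[OF assms(2) rc_0])
  show "rc (2 + k) (\<lambda>xs. xs ! 1 + F (drop 2 xs))" by (intro rc_add rc_nth rc_up assms) simp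
  fix xs
  have "F xs * n = rec_nat 0 (\<lambda>n y. (n # y # xs) ! 1 + F (drop 2 (n # y # xs))) n" for n
    by (induction n) auto
  then show "F xs * G xs = rec_nat 0 (\<lambda>n y. (n # y # xs) ! 1 + F (drop 2 (n # y # xs))) (G xs)" .
qed

lemma rc_pow:
  assumes "rc k F" "rc k G" shows "rc k (\<lambda>xs. F xs ^ G xs)"
proof (rule rc_rec'[OF assms(2) rc_const])
  show "rc (2 + k) (\<lambda>xs. xs ! 1 * F (drop 2 xs))" by (intro rc_mult rc_nth rc_up assms) simp
  fix xs
  have "F xs ^ n = rec_nat 1 (\<lambda>n y. (n # y # xs) ! 1 * F (drop 2 (n # y # xs))) n" for n
    by (induction n) auto
  then show "F xs ^ G xs = rec_nat 1 (\<lambda>n y. (n # y # xs) ! 1 * F (drop 2 (n # y # xs))) (G xs)" .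
qed

lemma rc_pred:
  assumes "rc k F" shows "rc k (\<lambda>xs. F xs - 1)"
proof (rule rc_rec'[OF assms rc_0])
  show "rc (2 + k) (\<lambda>xs. xs ! 0)" by (intro rc_nth) simp
  fix xs
  have "n - 1 = rec_nat 0 (\<lambda>n y. (n # y # xs) ! 0) n" for n
    by (induction n) auto
  then show "F xs - 1 = rec_nat 0 (\<lambda>n y. (n # y # xs) ! 0) (F xs)" .
qed

lemma rc_diff:
  assumes "rc k F" "rc k G" shows "rc k (\<lambda>xs. F xs - G xs)"
proof (rule rc_rec'[OF assms(2,1)])
  show "rc (2 + k) (\<lambda>xs. xs ! 1 - 1)" by (intro rc_pred rc_nth) simp
  fix xs
  have "F xs - n = rec_nat (F xs) (\<lambda>n y. (n # y # xs) ! 1 - 1) n" for n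
    by (induction n) auto
  then show "F xs - G xs = rec_nat (F xs) (\<lambda>n y. (n # y # xs) ! 1 - 1) (G xs)" .
qed

lemma rc_if0:
  assumes "rc k C" "rc k F" "rc k G" shows "rc k (\<lambda>xs. if C xs = 0 then F xs else G xs)"
proof (rule rc_rec'[OF assms(1,2)])
  show "rc (2 + k) (\<lambda>xs. G (drop 2 xs))" by (intro rc_up assms)
  fix xs
  have "(if n = 0 then F xs else G xs) = rec_nat (F xs) (\<lambda>n y. G (drop 2 (n # y # xs))) n" for n
    by (cases n) auto
  then show "(if C xs = 0 then F xs else G xs) =
      rec_nat (F xs) (\<lambda>n y. G (drop 2 (n # y # xs))) (C xs)" .
qed

lemma rc_ifeq:
  assumes "rc k C" "rc k D" "rc k F" "rc k G"
  shows "rc k (\<lambda>xs. if C xs = D xs then F xs else G xs)"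
proof (rule rc_cong)
  show "rc k (\<lambda>xs. if (C xs - D xs) + (D xs - C xs) = 0 then F xs else G xs)"
    by (intro rc_if0 rc_add rc_diff assms)
qed auto

lemma rc_mod:
  assumes "rc k F" "rc k G" shows "rc k (\<lambda>xs. F xs mod G xs)"
proof (rule rc_rec'[OF assms(1) rc_0])
  \<comment> \<open>A remainder counter that is reset at the divisor. For divisor 0 it is never
    reset, in agreement with \<open>n mod 0 = n\<close>.\<close>
  show "rc (2 + k) (\<lambda>xs. if Suc (xs ! 1) = G (drop 2 xs) then 0 else Suc (xs ! 1))"
    by (intro rc_ifeq rc_Suc rc_nth rc_up rc_0 assms) simp_all
  fix xs
  have "n mod G xs = rec_nat 0 (\<lambda>n y. if Suc ((n # y # xs) ! 1) = G (drop 2 (n # y # xs)) then 0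
      else Suc ((n # y # xs) ! 1)) n" for n
    by (induction n) (auto simp: mod_Suc)
  then show "F xs mod G xs = rec_nat 0 (\<lambda>n y. if Suc ((n # y # xs) ! 1) = G (drop 2 (n # y # xs))
      then 0 else Suc ((n # y # xs) ! 1)) (F xs)" .
qed

lemma rc_div:
  assumes "rc k F" "rc k G" shows "rc k (\<lambda>xs. F xs div G xs)"
proof (rule rc_rec'[OF assms(1) rc_0])
  show "rc (2 + k) (\<lambda>xs. if Suc (xs ! 0) mod G (drop 2 xs) = 0 then Suc (xs ! 1) else xs ! 1)"
    by (intro rc_if0 rc_mod rc_Suc rc_nth rc_up assms) simp_all
  fix xs
  have "n div G xs = rec_nat 0 (\<lambda>n y. if Suc ((n # y # xs) ! 0) mod G (drop 2 (n # y # xs)) = 0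
      then Suc ((n # y # xs) ! 1) else (n # y # xs) ! 1) n" for n
    by (induction n) (auto simp: div_Suc)
  then show "F xs div G xs = rec_nat 0 (\<lambda>n y. if Suc ((n # y # xs) ! 0) mod G (drop 2 (n # y # xs)) = 0
      then Suc ((n # y # xs) ! 1) else (n # y # xs) ! 1) (F xs)" .
qed

lemmas rc_intros = rc_nth rc_const rc_Suc rc_add rc_mult rc_pow rc_diff rc_mod rc_div rc_if0

lemma rc_triangle: "rc k F \<Longrightarrow> rc k (\<lambda>xs. triangle (F xs))"
  unfolding triangle_def by (intro rc_intros)

lemma rc_prod_encode: "rc k F \<Longrightarrow> rc k G \<Longrightarrow> rc k (\<lambda>xs. prod_encode (F xs, G xs))"
  unfolding prod_encode_def by (auto intro!: rc_add rc_triangle)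

lemma rc_funpow:
  assumes "rc k N" "rc k F" "rc (Suc k) G"
  shows "rc k (\<lambda>xs. ((\<lambda>y. G (y # xs)) ^^ N xs) (F xs))"
proof (rule rc_rec'[OF assms(1,2)])
  show "rc (2 + k) (\<lambda>xs. G (drop 1 xs))" using rc_drop[OF assms(3), of 1] by simp
  fix xs
  have "((\<lambda>y. G (y # xs)) ^^ n) (F xs) = rec_nat (F xs) (\<lambda>n y. G (drop 1 (n # y # xs))) n" for n
    by (induction n) auto
  then show "((\<lambda>y. G (y # xs)) ^^ N xs) (F xs)
    = rec_nat (F xs) (\<lambda>n y. G (drop 1 (n # y # xs))) (N xs)" .
qed

section \<open>Register machines and affine systems\<close>

text \<open>The instructions are chosen so that on Godel numbers each becomes a multiplication or
  division by a prime or a divisibility test.\<close>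

datatype com = Skip | Inc nat | Dec nat | Seq com com | Loop nat com

type_synonym store = "nat \<Rightarrow> nat"

inductive exec :: "com \<Rightarrow> store \<Rightarrow> store \<Rightarrow> bool" where
  skip: "exec Skip s s"
| inc: "exec (Inc r) s (s(r := Suc (s r)))"
| dec: "exec (Dec r) s (s(r := s r - 1))"
| seq: "exec c s t \<Longrightarrow> exec d t u \<Longrightarrow> exec (Seq c d) s u"
| loop_end: "s r = 0 \<Longrightarrow> exec (Loop r c) s s"
| loop_step: "s r > 0 \<Longrightarrow> exec c s t \<Longrightarrow> exec (Loop r c) t u \<Longrightarrow> exec (Loop r c) s u"

inductive_cases exec_SkipE: "exec Skip s t"
inductive_cases exec_IncE: "exec (Inc r) s t"
inductive_cases exec_DecE: "exec (Dec r) s t"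
inductive_cases exec_SeqE: "exec (Seq c d) s t"
inductive_cases exec_LoopE: "exec (Loop r c) s t"

lemma exec_Skip [simp]: "exec Skip s t \<longleftrightarrow> t = s"
  by (auto elim: exec_SkipE intro: exec.intros)

lemma exec_Inc [simp]: "exec (Inc r) s t \<longleftrightarrow> t = s(r := Suc (s r))"
  by (auto elim: exec_IncE intro: exec.intros)

lemma exec_Dec [simp]: "exec (Dec r) s t \<longleftrightarrow> t = s(r := s r - 1)"
  using exec.dec[of r s] by (auto elim: exec_DecE)

lemma exec_Seq [simp]: "exec (Seq c d) s u \<longleftrightarrow> (\<exists>t. exec c s t \<and> exec d t u)"
  by (auto elim: exec_SeqE intro: exec.intros)

lemma exec_Loop: "exec (Loop r c) s u \<longleftrightarrow>
    (if s r = 0 then u = s else \<exists>t. exec c s t \<and> exec (Loop r c) t u)"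
  by (auto elim: exec_LoopE intro: exec.intros)

lemma exec_Loop_0 [simp]: "s r = 0 \<Longrightarrow> exec (Loop r c) s u \<longleftrightarrow> u = s"
  by (subst exec_Loop) simp

definition clear :: "nat \<Rightarrow> com" where "clear r = Loop r (Dec r)"

text \<open>For argument lists of the wrong length \<open>rec_eval\<close> has no value, and the
  compiled program must then fail to terminate.\<close>

definition diverge :: "nat \<Rightarrow> com" where "diverge r = Seq (Inc r) (Loop r (Inc r))"

definition move :: "nat \<Rightarrow> nat \<Rightarrow> com" where "move a d = Loop a (Seq (Dec a) (Inc d))"

definition copy :: "nat \<Rightarrow> nat \<Rightarrow> nat \<Rightarrow> com" where
  "copy a d b = Seq (Loop a (Seq (Dec a) (Seq (Inc d) (Inc b)))) (move b a)"

lemma exec_clear [simp]: "exec (clear r) s t \<longleftrightarrow> t = s(r := 0)"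
proof (induction "s r" arbitrary: s)
  case 0
  then have "s(r := 0) = s" by auto
  then show ?case using 0 by (simp add: clear_def)
next
  case (Suc n)
  have "exec (clear r) s t \<longleftrightarrow> exec (clear r) (s(r := n)) t"
    using Suc.hyps(2)[symmetric] unfolding clear_def by (subst exec_Loop) auto
  then show ?case using Suc.hyps(1)[of "s(r := n)"] by simp
qed

lemma exec_diverge [simp]: "\<not> exec (diverge r) s t"
proof
  assume "exec (diverge r) s t"
  then have "exec (Loop r (Inc r)) (s(r := Suc (s r))) t" unfolding diverge_def by simp
  moreover have "exec c s' t \<Longrightarrow> c = Loop r (Inc r) \<Longrightarrow> s' r > 0 \<Longrightarrow> False" for c s'
    by (induction rule: exec.induct) auto
  ultimately show False by fastforce
qed

lemma exec_move [simp]: "a \<noteq> d \<Longrightarrow> exec (move a d) s t \<longleftrightarrow> t = s(d := s d + s a, a := 0)"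
proof (induction "s a" arbitrary: s)
  case 0
  then have "s(d := s d + s a, a := 0) = s" by auto
  then show ?case using 0 by (simp add: move_def)
next
  case (Suc n)
  let ?s = "s(a := n, d := Suc (s d))"
  have "exec (move a d) s t \<longleftrightarrow> exec (move a d) ?s t"
    using Suc.hyps(2)[symmetric] Suc.prems unfolding move_def by (subst exec_Loop) auto
  also have "\<dots> \<longleftrightarrow> t = ?s(d := ?s d + ?s a, a := 0)"
    using Suc.prems by (intro Suc.hyps(1)) auto
  also have "?s(d := ?s d + ?s a, a := 0) = s(d := s d + s a, a := 0)"
    using Suc.hyps(2)[symmetric] Suc.prems by auto
  finally show ?case .
qed

lemma exec_copy_loop: "a \<noteq> d \<Longrightarrow> a \<noteq> b \<Longrightarrow> d \<noteq> b \<Longrightarrow>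
  exec (Loop a (Seq (Dec a) (Seq (Inc d) (Inc b)))) s t \<longleftrightarrow>
    t = s(d := s d + s a, b := s b + s a, a := 0)"
proof (induction "s a" arbitrary: s)
  case 0
  then have "s(d := s d + s a, b := s b + s a, a := 0) = s" by auto
  then show ?case using 0 by simp
next
  case (Suc n)
  let ?c = "Loop a (Seq (Dec a) (Seq (Inc d) (Inc b)))"
  let ?s = "s(a := n, d := Suc (s d), b := Suc (s b))"
  have "exec ?c s t \<longleftrightarrow> exec ?c ?s t"
    using Suc.hyps(2)[symmetric] Suc.prems by (subst exec_Loop) auto
  also have "\<dots> \<longleftrightarrow> t = ?s(d := ?s d + ?s a, b := ?s b + ?s a, a := 0)"
    using Suc.prems by (intro Suc.hyps(1)) auto
  also have "?s(d := ?s d + ?s a, b := ?s b + ?s a, a := 0)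
      = s(d := s d + s a, b := s b + s a, a := 0)"
    using Suc.hyps(2)[symmetric] Suc.prems by auto
  finally show ?case .
qed

lemma exec_copy [simp]:
  assumes "a \<noteq> d" "a \<noteq> b" "d \<noteq> b" "s b = 0"
  shows "exec (copy a d b) s t \<longleftrightarrow> t = s(d := s d + s a)"
proof -
  have "exec (copy a d b) s t \<longleftrightarrow> t = s(d := s d + s a, b := 0, a := s a)"
    unfolding copy_def exec_Seq exec_copy_loop[OF assms(1-3)] using assms
    by (auto simp: fun_upd_twist)
  also have "s(d := s d + s a, b := 0, a := s a) = s(d := s d + s a)" using assms by auto
  finally show ?thesis .
qed

text \<open>Frame specification: the arguments are read from the registers \<open>args\<close>, the result goes to
  register \<open>d\<close>, and the registers from \<open>b\<close> on serve as scratch space, zero before and after.\<close>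

definition implements :: "com \<Rightarrow> recf \<Rightarrow> nat list \<Rightarrow> nat \<Rightarrow> nat \<Rightarrow> bool" where
  "implements c f args d b \<longleftrightarrow> (\<forall>s t. s d = 0 \<longrightarrow> (\<forall>i\<ge>b. s i = 0) \<longrightarrow>
     (exec c s t \<longleftrightarrow> (\<exists>y. rec_eval f (map s args) y \<and> t = s(d := y))))"

text \<open>Quantifying over all register layouts makes the compilation compositional, since
  different contexts place the same subprogram at different registers.\<close>

definition implementable :: "recf \<Rightarrow> bool" where
  "implementable f \<longleftrightarrow>
     (\<forall>args d b. (\<forall>a\<in>set args. a < b) \<longrightarrow> d < b \<longrightarrow> d \<notin> set args \<longrightarrow> (\<exists>c. implements c f args d b))"

lemma implementableD:
  "implementable f \<Longrightarrow> \<forall>a\<in>set args. a < b \<Longrightarrow> d < b \<Longrightarrow> d \<notin> set args \<Longrightarrow> \<exists>c. implements c f args d b"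
  unfolding implementable_def by blast

lemma implementsD:
  "implements c f args d b \<Longrightarrow> s d = 0 \<Longrightarrow> (\<And>i. i \<ge> b \<Longrightarrow> s i = 0) \<Longrightarrow>
     exec c s t \<longleftrightarrow> (\<exists>y. rec_eval f (map s args) y \<and> t = s(d := y))"
  unfolding implements_def by blast

lemma implementable_Zero: "implementable Zero"
  unfolding implementable_def
proof (intro allI impI)
  fix args :: "nat list" and d b :: nat
  have "rec_eval Zero xs y \<longleftrightarrow> y = 0" for xs y
    by (auto elim: rec_eval_ZeroE intro: rec_eval.zero)
  then have "implements Skip Zero args d b" by (auto simp: implements_def fun_upd_idem)
  then show "\<exists>c. implements c Zero args d b" ..
qed

lemma implementable_Succ: "implementable Succ"
  unfolding implementable_def
proof (intro allI impI)
  fix args :: "nat list" and d b :: nat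
  assume args: "\<forall>a\<in>set args. a < b" and d: "d < b" "d \<notin> set args"
  have S: "rec_eval Succ xs y \<longleftrightarrow> (\<exists>x. xs = [x] \<and> y = Suc x)" for xs y
    by (auto elim: rec_eval_SuccE intro: rec_eval.succ)
  show "\<exists>c. implements c Succ args d b"
  proof (cases "\<exists>a. args = [a]")
    case True
    then obtain a where a: "args = [a]" by blast
    then have "a \<noteq> d" "a \<noteq> b" "d \<noteq> b" using args d by auto
    then have "implements (Seq (copy a d b) (Inc d)) Succ args d b"
      by (auto simp: implements_def S a)
    then show ?thesis ..
  next
    case False
    then have "implements (diverge b) Succ args d b" by (auto simp: implements_def S)
    then show ?thesis ..
  qed
qed

lemma implementable_Proj: "implementable (Proj i)"
  unfolding implementable_def
proof (intro allI impI)
  fix args :: "nat list" and d b :: nat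
  assume args: "\<forall>a\<in>set args. a < b" and d: "d < b" "d \<notin> set args"
  have S: "rec_eval (Proj i) xs y \<longleftrightarrow> i < length xs \<and> y = xs ! i" for xs y
    by (auto elim: rec_eval_ProjE intro: rec_eval.proj)
  show "\<exists>c. implements c (Proj i) args d b"
  proof (cases "i < length args")
    case True
    then have "args ! i \<noteq> d" "args ! i \<noteq> b" "d \<noteq> b" using args d nth_mem[OF True] by auto
    then have "implements (copy (args ! i) d b) (Proj i) args d b"
      by (auto simp: implements_def S True)
    then show ?thesis ..
  next
    case False
    then have "implements (diverge b) (Proj i) args d b" by (auto simp: implements_def S)
    then show ?thesis ..
  qed
qed

definition store_at :: "store \<Rightarrow> nat \<Rightarrow> nat list \<Rightarrow> store" where
  "store_at s b ys = (\<lambda>i. if b \<le> i \<and> i < b + length ys then ys ! (i - b) else s i)"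

lemma store_at_Nil [simp]: "store_at s b [] = s"
  by (auto simp: store_at_def)

lemma store_at_Cons: "store_at s b (y # ys) = store_at (s(b := y)) (Suc b) ys"
proof
  fix i
  consider "i < b" | "i = b" | k where "i = Suc b + k"
    by (metis less_imp_Suc_add linorder_neqE_nat add_Suc)
  then show "store_at s b (y # ys) i = store_at (s(b := y)) (Suc b) ys i"
    by cases (auto simp: store_at_def)
qed

text \<open>The scratch space of each program starts just above the register that it fills, so the
  values computed earlier survive.\<close>

lemma implement_list:
  assumes "\<And>g. g \<in> set gs \<Longrightarrow> implementable g" "\<And>a. a \<in> set args \<Longrightarrow> a < b" "b + length gs \<le> B"
  shows "\<exists>c. \<forall>s t. (\<forall>i\<ge>b. s i = 0) \<longrightarrow>
    (exec c s t \<longleftrightarrow> (\<exists>ys. list_all2 (\<lambda>g. rec_eval g (map s args)) gs ys \<and> t = store_at s b ys))"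
  using assms
proof (induction gs arbitrary: b)
  case Nil
  show ?case by (rule exI[of _ Skip]) auto
next
  case (Cons g gs)
  have ar: "a < Suc b" if "a \<in> set args" for a using Cons.prems(2)[OF that] by simp
  obtain c where c: "\<And>s t. (\<forall>i\<ge>Suc b. s i = 0) \<Longrightarrow>
     exec c s t \<longleftrightarrow> (\<exists>ys. list_all2 (\<lambda>g. rec_eval g (map s args)) gs ys \<and> t = store_at s (Suc b) ys)"
  proof -
    have "\<exists>c. \<forall>s t. (\<forall>i\<ge>Suc b. s i = 0) \<longrightarrow> (exec c s t \<longleftrightarrow>
        (\<exists>ys. list_all2 (\<lambda>g. rec_eval g (map s args)) gs ys \<and> t = store_at s (Suc b) ys))"
      by (rule Cons.IH) (use Cons.prems ar in auto)
    then show thesis using that by blast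
  qed
  obtain e where e: "implements e g args b (Suc b)"
  proof -
    have "b \<notin> set args" using Cons.prems(2) by blast
    then show thesis using implementableD[of g args "Suc b" b] Cons.prems(1) ar that by auto
  qed
  show ?case
  proof (intro exI[of _ "Seq e c"] allI impI)
    fix s t :: store assume s: "\<forall>i\<ge>b. s i = 0"
    have m: "map (s(b := y)) args = map s args" for y using Cons.prems(2) by auto
    have "exec c (s(b := y)) t \<longleftrightarrow>
        (\<exists>ys. list_all2 (\<lambda>g. rec_eval g (map s args)) gs ys \<and> t = store_at s b (y # ys))" for y
      using c[of "s(b := y)" t] s unfolding m store_at_Cons by auto
    moreover have "exec e s u \<longleftrightarrow> (\<exists>y. rec_eval g (map s args) y \<and> u = s(b := y))" for u
      using implementsD[OF e, of s u] s by auto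
    ultimately have "exec (Seq e c) s t \<longleftrightarrow> (\<exists>y ys. rec_eval g (map s args) y \<and>
        list_all2 (\<lambda>g. rec_eval g (map s args)) gs ys \<and> t = store_at s b (y # ys))"
      by auto
    then show "exec (Seq e c) s t \<longleftrightarrow>
        (\<exists>ys. list_all2 (\<lambda>g. rec_eval g (map s args)) (g # gs) ys \<and> t = store_at s b ys)"
      by (metis list_all2_Cons1)
  qed
qed

lemma exec_clear_range:
  "exec (foldr (\<lambda>r. Seq (clear r)) rs Skip) s t \<longleftrightarrow> t = (\<lambda>i. if i \<in> set rs then 0 else s i)"
proof (induction rs arbitrary: s)
  case (Cons r rs)
  have "(\<lambda>i. if i \<in> set rs then 0 else (s(r := 0)) i) = (\<lambda>i. if i \<in> set (r # rs) then 0 else s i)"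
    by auto
  moreover have "exec (foldr (\<lambda>r. Seq (clear r)) (r # rs) Skip) s t \<longleftrightarrow>
      exec (foldr (\<lambda>r. Seq (clear r)) rs Skip) (s(r := 0)) t"
    by simp
  ultimately show ?case unfolding Cons.IH by simp
qed auto

lemma rec_eval_Comp: "rec_eval (Comp f gs) xs z \<longleftrightarrow>
    (\<exists>ys. list_all2 (\<lambda>g. rec_eval g xs) gs ys \<and> rec_eval f ys z)"
  by (fastforce simp: list_all2_conv_all_nth elim: rec_eval_CompE intro: rec_eval.comp)

lemma implementable_Comp:
  assumes f: "implementable f" and gs: "\<And>g. g \<in> set gs \<Longrightarrow> implementable g"
  shows "implementable (Comp f gs)"
  unfolding implementable_def
proof (intro allI impI)
  fix args :: "nat list" and d b :: nat
  assume args: "\<forall>a\<in>set args. a < b" and d: "d < b" "d \<notin> set args"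
  let ?n = "length gs"
  obtain c where c: "\<And>s t. (\<forall>i\<ge>b. s i = 0) \<Longrightarrow>
     exec c s t \<longleftrightarrow> (\<exists>ys. list_all2 (\<lambda>g. rec_eval g (map s args)) gs ys \<and> t = store_at s b ys)"
  proof -
    have "\<exists>c. \<forall>s t. (\<forall>i\<ge>b. s i = 0) \<longrightarrow> (exec c s t \<longleftrightarrow>
        (\<exists>ys. list_all2 (\<lambda>g. rec_eval g (map s args)) gs ys \<and> t = store_at s b ys))"
      by (rule implement_list[OF gs]) (use args in auto)
    then show thesis using that by blast
  qed
  obtain e where e: "implements e f [b..<b + ?n] d (b + ?n)"
    using implementableD[OF f, of "[b..<b + ?n]" "b + ?n" d] d by auto
  let ?k = "foldr (\<lambda>r. Seq (clear r)) [b..<b + ?n] Skip"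
  have "implements (Seq c (Seq e ?k)) (Comp f gs) args d b"
    unfolding implements_def
  proof (intro allI impI)
    fix s t :: store assume sd: "s d = 0" and s: "\<forall>i\<ge>b. s i = 0"
    have E: "exec e (store_at s b ys) u \<longleftrightarrow> (\<exists>y. rec_eval f ys y \<and> u = (store_at s b ys)(d := y))"
      if "length ys = ?n" for ys u
    proof -
      have m: "map (store_at s b ys) [b..<b + ?n] = ys"
        using that by (intro nth_equalityI) (auto simp: store_at_def)
      show ?thesis
        by (rule implementsD[OF e, of "store_at s b ys" u, unfolded m])
          (use that s d in \<open>auto simp: store_at_def sd\<close>)
    qed
    have K: "(\<lambda>i. if i \<in> set [b..<b + ?n] then 0 else ((store_at s b ys)(d := y)) i) = s(d := y)"
      if "length ys = ?n" for ys y
      using that s d by (auto simp: store_at_def)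
    show "exec (Seq c (Seq e ?k)) s t \<longleftrightarrow> (\<exists>y. rec_eval (Comp f gs) (map s args) y \<and> t = s(d := y))"
    proof
      assume "exec (Seq c (Seq e ?k)) s t"
      then obtain ys u where ys: "list_all2 (\<lambda>g. rec_eval g (map s args)) gs ys"
        and u: "exec e (store_at s b ys) u" "exec ?k u t"
        using c[OF s] by auto
      then have l: "length ys = ?n" by (simp add: list_all2_lengthD)
      then obtain y where "rec_eval f ys y" "u = (store_at s b ys)(d := y)" using E u by blast
      then show "\<exists>y. rec_eval (Comp f gs) (map s args) y \<and> t = s(d := y)"
        using u(2) K[OF l] ys unfolding exec_clear_range rec_eval_Comp by auto
    next
      assume "\<exists>y. rec_eval (Comp f gs) (map s args) y \<and> t = s(d := y)"
      then obtain y ys where ys: "list_all2 (\<lambda>g. rec_eval g (map s args)) gs ys"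
        and y: "rec_eval f ys y" "t = s(d := y)"
        unfolding rec_eval_Comp by blast
      then have l: "length ys = ?n" by (simp add: list_all2_lengthD)
      show "exec (Seq c (Seq e ?k)) s t"
        unfolding exec_Seq exec_clear_range
        using c[OF s, of "store_at s b ys"] ys E[OF l] y K[OF l] by metis
    qed
  qed
  then show "\<exists>c. implements c (Comp f gs) args d b" ..
qed

lemma implementable_Minim:
  assumes f: "implementable f"
  shows "implementable (Minim f)"
  unfolding implementable_def
proof (intro allI impI)
  fix args :: "nat list" and d b :: nat
  assume args: "\<forall>a\<in>set args. a < b" and d: "d < b" "d \<notin> set args"
  obtain e where e: "implements e f (d # args) b (Suc b)"
  proof -
    have "\<forall>a\<in>set (d # args). a < Suc b" "b \<notin> set (d # args)" using d args by auto
    then show thesis using implementableD[OF f, of "d # args" "Suc b" b] that by blast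
  qed
  \<comment> \<open>Register \<open>d\<close> holds the candidate and register \<open>b\<close> the
    value of \<open>f\<close> there; the loop stops at the first candidate with value 0.\<close>
  define body where "body = Seq (clear b) (Seq (Inc d) e)"
  have "implements (Seq e (Loop b body)) (Minim f) args d b"
    unfolding implements_def
  proof (intro allI impI)
    fix s t :: store assume sd: "s d = 0" and s: "\<forall>i\<ge>b. s i = 0"
    let ?xs = "map s args"
    let ?S = "\<lambda>n v. s(d := n, b := v)"
    have E: "exec e (?S n 0) u \<longleftrightarrow> (\<exists>y. rec_eval f (n # ?xs) y \<and> u = ?S n y)" for n u
    proof -
      have m: "map (?S n 0) (d # args) = n # ?xs" using d args by auto
      have "exec e (?S n 0) u \<longleftrightarrow>
          (\<exists>y. rec_eval f (map (?S n 0) (d # args)) y \<and> u = (?S n 0)(b := y))"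
        by (rule implementsD[OF e]) (use s d in auto)
      then show ?thesis unfolding m by simp
    qed
    have B: "exec body (?S n v) u \<longleftrightarrow> (\<exists>y. rec_eval f (Suc n # ?xs) y \<and> u = ?S (Suc n) y)" for n v u
    proof -
      have "(?S n v)(b := 0, d := Suc (((?S n v)(b := 0)) d)) = ?S (Suc n) 0"
        using d by (auto simp: fun_eq_iff)
      then show ?thesis unfolding body_def using E[of "Suc n" u] by simp
    qed
    have up: "exec (Loop b body) (?S i v) (?S n 0)"
      if "i + k = n" "rec_eval f (n # ?xs) 0" "\<forall>j. i < j \<and> j < n \<longrightarrow> (\<exists>y. rec_eval f (j # ?xs) (Suc y))"
        "rec_eval f (i # ?xs) v" "i < n \<longrightarrow> v \<noteq> 0" for i n v k
      using that
    proof (induction k arbitrary: i v)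
      case 0
      then have "v = 0" using rec_eval_functional by auto
      then show ?case using 0 d by simp
    next
      case (Suc k)
      have "\<exists>w. rec_eval f (Suc i # ?xs) w \<and> (Suc i < n \<longrightarrow> w \<noteq> 0)"
      proof (cases "Suc i < n")
        case True then show ?thesis using Suc.prems(3) by blast
      next
        case False then show ?thesis using Suc.prems(1,2) by auto
      qed
      then obtain w where w: "rec_eval f (Suc i # ?xs) w" "Suc i < n \<longrightarrow> w \<noteq> 0" by blast
      have "exec (Loop b body) (?S (Suc i) w) (?S n 0)"
        by (rule Suc.IH) (use Suc.prems w in auto)
      moreover have "exec body (?S i v) (?S (Suc i) w)" using B w by blast
      moreover have "(?S i v) b > 0" using Suc.prems by auto
      ultimately show ?case using exec.loop_step by blast
    qed
    \<comment> \<open>Conversely, induction on a terminating run recovers the candidate at exit and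
      the positivity of all values before it.\<close>
    have down: "exec c u t \<Longrightarrow> c = Loop b body \<Longrightarrow> u = ?S i v \<Longrightarrow> rec_eval f (i # ?xs) v \<Longrightarrow>
        \<exists>n\<ge>i. t = ?S n 0 \<and> rec_eval f (n # ?xs) 0 \<and>
          (\<forall>j. i \<le> j \<and> j < n \<longrightarrow> (\<exists>y. rec_eval f (j # ?xs) (Suc y)))" for c u i v
    proof (induction arbitrary: i v rule: exec.induct)
      case (loop_end u r c)
      then have "v = 0" by auto
      then show ?case using loop_end.prems by (intro exI[of _ i]) auto
    next
      case (loop_step u r c w t)
      from loop_step.hyps loop_step.prems have v: "v \<noteq> 0" by auto
      from loop_step.hyps(2) loop_step.prems obtain y where y: "rec_eval f (Suc i # ?xs) y"
        "w = ?S (Suc i) y"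
        using B by blast
      then obtain n where n: "n \<ge> Suc i" "t = ?S n 0" "rec_eval f (n # ?xs) 0"
          "\<forall>j. Suc i \<le> j \<and> j < n \<longrightarrow> (\<exists>y. rec_eval f (j # ?xs) (Suc y))"
        using loop_step.IH(2)[of "Suc i" y] loop_step.prems by blast
      have "\<exists>y. rec_eval f (i # ?xs) (Suc y)" using loop_step.prems v by (cases v) auto
      then have "\<forall>j. i \<le> j \<and> j < n \<longrightarrow> (\<exists>y. rec_eval f (j # ?xs) (Suc y))"
        using n(4) by (metis Suc_leI le_neq_implies_less)
      then show ?case using n(1-3) by (intro exI[of _ n] conjI) (simp_all only: Suc_leD)
    qed auto
    have M: "rec_eval (Minim f) xs y \<longleftrightarrow>
       rec_eval f (y # xs) 0 \<and> (\<forall>i<y. \<exists>k. rec_eval f (i # xs) (Suc k))" for xs y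
      by (auto elim: rec_eval_MinimE intro: rec_eval.minim)
    have s0: "?S 0 0 = s" "?S n 0 = s(d := n)" for n using s sd d by (auto simp: fun_eq_iff)
    have E0: "exec e s u \<longleftrightarrow> (\<exists>y. rec_eval f (0 # ?xs) y \<and> u = ?S 0 y)" for u
      using E[of 0 u] unfolding s0(1) .
    show "exec (Seq e (Loop b body)) s t \<longleftrightarrow>
        (\<exists>y. rec_eval (Minim f) ?xs y \<and> t = s(d := y))"
    proof
      assume "exec (Seq e (Loop b body)) s t"
      then obtain v where v: "rec_eval f (0 # ?xs) v" "exec (Loop b body) (?S 0 v) t"
        unfolding exec_Seq E0 by blast
      obtain n where "t = ?S n 0" "rec_eval f (n # ?xs) 0"
          "\<forall>j. 0 \<le> j \<and> j < n \<longrightarrow> (\<exists>y. rec_eval f (j # ?xs) (Suc y))"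
        using down[OF v(2) refl refl v(1)] by blast
      then show "\<exists>y. rec_eval (Minim f) ?xs y \<and> t = s(d := y)"
        unfolding M s0 by blast
    next
      assume "\<exists>y. rec_eval (Minim f) ?xs y \<and> t = s(d := y)"
      then obtain y where y: "rec_eval f (y # ?xs) 0" "\<forall>i<y. \<exists>k. rec_eval f (i # ?xs) (Suc k)"
        "t = s(d := y)" unfolding M by blast
      obtain v where v: "rec_eval f (0 # ?xs) v" "0 < y \<longrightarrow> v \<noteq> 0"
        using y by (cases y) blast+
      have "exec (Loop b body) (?S 0 v) (?S y 0)"
        by (rule up[of 0 y]) (use y v in auto)
      then show "exec (Seq e (Loop b body)) s t"
        unfolding exec_Seq E0 using v(1) y(3) s0(2) by metis
    qed
  qed
  then show "\<exists>c. implements c (Minim f) args d b" ..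
qed

lemma rec_eval_PrimRec_Suc: "rec_eval (PrimRec f g) (Suc n # xs) z \<longleftrightarrow>
    (\<exists>y. rec_eval (PrimRec f g) (n # xs) y \<and> rec_eval g (n # y # xs) z)"
  by (auto elim: rec_eval_PrimRec_SucE intro: rec_eval.intros)

lemma rec_eval_PrimRec_0: "rec_eval (PrimRec f g) (0 # xs) z \<longleftrightarrow> rec_eval f xs z"
  by (auto elim: rec_eval_PrimRec_0E intro: rec_eval.intros)

text \<open>A value at the last stage already forces values at all earlier stages; the correctness
  proof for \<open>PrimRec\<close> uses this to drop intermediate existentials.\<close>

lemma rec_eval_PrimRec_le:
  "rec_eval (PrimRec f g) ((n + k) # xs) z \<Longrightarrow> \<exists>y. rec_eval (PrimRec f g) (n # xs) y"
  by (induction k arbitrary: z) (auto simp: rec_eval_PrimRec_Suc)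

lemma implementable_PrimRec:
  assumes f: "implementable f" and g: "implementable g"
  shows "implementable (PrimRec f g)"
  unfolding implementable_def
proof (intro allI impI)
  fix args :: "nat list" and d b :: nat
  assume args: "\<forall>a\<in>set args. a < b" and d: "d < b" "d \<notin> set args"
  show "\<exists>c. implements c (PrimRec f g) args d b"
  proof (cases args)
    case Nil
    have "\<not> rec_eval (PrimRec f g) [] y" for y by (auto elim: rec_eval.cases)
    then have "implements (diverge b) (PrimRec f g) args d b" by (auto simp: implements_def Nil)
    then show ?thesis ..
  next
    case (Cons a bs)
    have ab: "a < b" "a \<noteq> d" "\<And>x. x \<in> set bs \<Longrightarrow> x < b" "d \<notin> set bs" using args d Cons by auto
    \<comment> \<open>\<open>?i\<close> counts the stages done and \<open>?m\<close> those left;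
      \<open>?new\<close> is kept apart because \<open>g\<close> reads the accumulator while its
      result is formed.\<close>
    let ?i = b and ?acc = "b + 1" and ?new = "b + 2" and ?m = "b + 3"
    obtain cf where cf: "implements cf f bs ?acc (b + 4)"
    proof -
      have "\<forall>a\<in>set bs. a < b + 4" "?acc \<notin> set bs" using ab(3) by force+
      then show thesis using implementableD[OF f, of bs "b + 4" ?acc] that by auto
    qed
    obtain cg where cg: "implements cg g (?i # ?acc # bs) ?new (b + 4)"
    proof -
      have "\<forall>a\<in>set (?i # ?acc # bs). a < b + 4" "?new \<notin> set (?i # ?acc # bs)" using ab(3) by force+
      then show thesis using implementableD[OF g, of "?i # ?acc # bs" "b + 4" ?new] that by auto
    qed
    define rest where "rest = Seq (clear ?acc) (Seq (move ?new ?acc) (Inc ?i))"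
    define body where "body = Seq (Dec ?m) (Seq cg rest)"
    define fin where "fin = Seq (move ?acc d) (clear ?i)"
    let ?c = "Seq cf (Seq (copy a ?m (b + 4)) (Seq (Loop ?m body) fin))"
    have "implements ?c (PrimRec f g) args d b"
      unfolding implements_def
    proof (intro allI impI)
      fix s t :: store assume sd: "s d = 0" and s: "\<forall>i\<ge>b. s i = 0"
      let ?xs = "map s bs"
      let ?S = "\<lambda>i y m. s(?i := i, ?acc := y, ?m := m)"
      have E0: "exec cf s u \<longleftrightarrow> (\<exists>y. rec_eval f ?xs y \<and> u = ?S 0 y 0)" for u
      proof -
        have "s(?acc := y) = ?S 0 y 0" for y using s by (auto simp: fun_eq_iff)
        then show ?thesis using implementsD[OF cf, of s u] s by auto
      qed
      have C: "exec (copy a ?m (b + 4)) (?S 0 y 0) u \<longleftrightarrow> u = ?S 0 y (s a)" for y u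
      proof -
        have "exec (copy a ?m (b + 4)) (?S 0 y 0) u \<longleftrightarrow>
            u = (?S 0 y 0)(?m := ?S 0 y 0 ?m + ?S 0 y 0 a)"
          by (rule exec_copy) (use ab s in auto)
        also have "(?S 0 y 0)(?m := ?S 0 y 0 ?m + ?S 0 y 0 a) = ?S 0 y (s a)"
          using ab by (auto simp: fun_eq_iff)
        finally show ?thesis .
      qed
      have B: "exec body (?S i y (Suc m)) u \<longleftrightarrow>
          (\<exists>z. rec_eval g (i # y # ?xs) z \<and> u = ?S (Suc i) z m)" for i y m u
      proof -
        have 1: "(?S i y (Suc m))(?m := ?S i y (Suc m) ?m - 1) = ?S i y m" by auto
        have 2: "exec cg (?S i y m) v \<longleftrightarrow>
            (\<exists>z. rec_eval g (i # y # ?xs) z \<and> v = (?S i y m)(?new := z))" for v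
        proof -
          have m: "map (?S i y m) (?i # ?acc # bs) = i # y # ?xs" by (auto dest: ab(3))
          have "exec cg (?S i y m) v \<longleftrightarrow>
              (\<exists>z. rec_eval g (map (?S i y m) (?i # ?acc # bs)) z \<and> v = (?S i y m)(?new := z))"
            by (rule implementsD[OF cg]) (use s in auto)
          then show ?thesis unfolding m .
        qed
        have 3: "exec rest ((?S i y m)(?new := z)) u \<longleftrightarrow> u = ?S (Suc i) z m" for z
        proof -
          have "(let w = (?S i y m)(?new := z, ?acc := 0); w = w(?acc := w ?acc + w ?new, ?new := 0)
             in w(?i := Suc (w ?i))) = ?S (Suc i) z m"
            using s by (auto simp: fun_eq_iff)
          then show ?thesis unfolding rest_def by (auto simp: Let_def)
        qed
        have "exec body (?S i y (Suc m)) u \<longleftrightarrow> (\<exists>v. exec cg (?S i y m) v \<and> exec rest v u)"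
          unfolding body_def exec_Seq[of "Dec _"] exec_Seq[of cg] exec_Dec
          by (simp only: ex_simps simp_thms 1)
        then show ?thesis unfolding 2 using 3 by metis
      qed
      have L: "exec (Loop ?m body) (?S i y m) u \<longleftrightarrow>
          (\<exists>z. rec_eval (PrimRec f g) ((i + m) # ?xs) z \<and> u = ?S (i + m) z 0)"
        if "rec_eval (PrimRec f g) (i # ?xs) y" for i y m u
        using that
      proof (induction m arbitrary: i y)
        case 0
        have "exec (Loop ?m body) (?S i y 0) u \<longleftrightarrow> u = ?S i y 0" by simp
        then show ?case using rec_eval_functional[OF 0] 0 by (metis add_0_right)
      next
        case (Suc m)
        have "?S i y (Suc m) ?m \<noteq> 0" by simp
        then have "exec (Loop ?m body) (?S i y (Suc m)) u \<longleftrightarrow>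
          (\<exists>v. exec body (?S i y (Suc m)) v \<and> exec (Loop ?m body) v u)"
          using exec_Loop[of ?m body "?S i y (Suc m)" u] by presburger
        also have "\<dots> \<longleftrightarrow> (\<exists>z. rec_eval g (i # y # ?xs) z \<and> exec (Loop ?m body) (?S (Suc i) z m) u)"
          unfolding B by blast
        also have "\<dots> \<longleftrightarrow> (\<exists>z. rec_eval g (i # y # ?xs) z \<and>
            (\<exists>z. rec_eval (PrimRec f g) ((Suc i + m) # ?xs) z \<and> u = ?S (Suc i + m) z 0))"
        proof -
          have "rec_eval (PrimRec f g) (Suc i # ?xs) z" if "rec_eval g (i # y # ?xs) z" for z
            using that Suc.prems by (rule_tac rec_eval.primrec_Suc)
          then show ?thesis using Suc.IH by metis
        qed
        also have "\<dots> \<longleftrightarrow> (\<exists>z. rec_eval (PrimRec f g) ((Suc i + m) # ?xs) z \<and> u = ?S (Suc i + m) z 0)"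
        proof -
          have "\<exists>w. rec_eval g (i # y # ?xs) w" if "rec_eval (PrimRec f g) ((Suc i + m) # ?xs) z" for z
            using rec_eval_PrimRec_le[OF that] rec_eval_functional[OF Suc.prems]
            unfolding rec_eval_PrimRec_Suc by blast
          then show ?thesis by blast
        qed
        finally show ?case unfolding add_Suc_shift[symmetric] by (simp only: add_Suc_right add_Suc)
      qed
      have F: "exec fin (?S i y 0) u \<longleftrightarrow> u = s(d := y)" for i y u
      proof -
        have "(let w = (?S i y 0) in (w(d := w d + w ?acc, ?acc := 0))(?i := 0)) = s(d := y)"
          using s sd d by (auto simp: fun_eq_iff)
        moreover have "?acc \<noteq> d" using d by simp
        ultimately show ?thesis unfolding fin_def by (auto simp: Let_def)
      qed
      have "exec ?c s t \<longleftrightarrow> (\<exists>y. rec_eval f ?xs y \<and>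
          (\<exists>u. exec (Loop ?m body) (?S 0 y (s a)) u \<and> exec fin u t))"
        unfolding exec_Seq[of cf] exec_Seq[of "copy _ _ _"] exec_Seq[of "Loop _ _"] E0
        using C by metis
      also have "\<dots> \<longleftrightarrow> (\<exists>y. rec_eval f ?xs y \<and> (\<exists>z. rec_eval (PrimRec f g) (s a # ?xs) z \<and> t = s(d := z)))"
      proof -
        have "(\<exists>u. exec (Loop ?m body) (?S 0 y (s a)) u \<and> exec fin u t) \<longleftrightarrow>
            (\<exists>z. rec_eval (PrimRec f g) (s a # ?xs) z \<and> t = s(d := z))" if "rec_eval f ?xs y" for y
          using L[of 0 y "s a"] F that unfolding rec_eval_PrimRec_0 add_0 by metis
        then show ?thesis by metis
      qed
      also have "\<dots> \<longleftrightarrow> (\<exists>z. rec_eval (PrimRec f g) (s a # ?xs) z \<and> t = s(d := z))"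
        using rec_eval_PrimRec_le[of f g 0 "s a" ?xs] unfolding rec_eval_PrimRec_0 add_0 by blast
      finally show "exec ?c s t \<longleftrightarrow> (\<exists>y. rec_eval (PrimRec f g) (map s args) y \<and> t = s(d := y))"
        by (simp add: Cons)
    qed
    then show ?thesis ..
  qed
qed

theorem implementable: "implementable f"
  by (induction f) (auto intro: implementable_Zero implementable_Succ implementable_Proj
      implementable_Comp implementable_PrimRec implementable_Minim)

section \<open>While programs as affine systems on Godel numbers\<close>

text \<open>The continuation stacks that can arise while \<open>c\<close> runs in front of
  \<open>k\<close>, before \<open>k\<close> alone remains. Finiteness of this set allows the control
  state to be stored in a residue.\<close>

fun conts :: "com \<Rightarrow> com list \<Rightarrow> com list set" where
  "conts (Seq c d) k = insert (Seq c d # k) (conts c (d # k) \<union> conts d k)"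
| "conts (Loop r c) k = insert (Loop r c # k) (conts c (Loop r c # k))"
| "conts c k = {c # k}"

lemma finite_conts: "finite (conts c k)"
  by (induction c k rule: conts.induct) auto

lemma conts_self: "c # k \<in> conts c k"
  by (cases c) auto

fun cstep :: "com list \<Rightarrow> store \<Rightarrow> com list \<times> store" where
  "cstep [] s = ([], s)"
| "cstep (Skip # k) s = (k, s)"
| "cstep (Inc r # k) s = (k, s(r := Suc (s r)))"
| "cstep (Dec r # k) s = (k, s(r := s r - 1))"
| "cstep (Seq c d # k) s = (c # d # k, s)"
| "cstep (Loop r c # k) s = (if s r = 0 then k else c # Loop r c # k, s)"

lemma cstep_conts: "l \<in> conts c k \<Longrightarrow> fst (cstep l s) \<in> insert k (conts c k)"
proof (induction c k rule: conts.induct)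
  case (1 c d k)
  then show ?case using conts_self[of c "d # k"] conts_self[of d k] by auto
next
  case (2 r c k)
  from 2(2) consider "l = Loop r c # k" | "l \<in> conts c (Loop r c # k)" by auto
  then show ?case using conts_self[of c "Loop r c # k"] "2.IH" by cases auto
qed auto

fun regs :: "com \<Rightarrow> nat set" where
  "regs Skip = {}"
| "regs (Inc r) = {r}"
| "regs (Dec r) = {r}"
| "regs (Seq c d) = regs c \<union> regs d"
| "regs (Loop r c) = insert r (regs c)"

lemma finite_regs: "finite (regs c)"
  by (induction c) auto

lemma regs_conts: "l \<in> conts c k \<Longrightarrow> e \<in> set l \<Longrightarrow> regs e \<subseteq> regs c \<union> \<Union> (regs ` set k)"
proof (induction c k rule: conts.induct)
  case (1 c d k)
  from 1(3) consider "l = Seq c d # k" | "l \<in> conts c (d # k)" | "l \<in> conts d k" by auto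
  then show ?case
  proof cases
    case 1
    then show ?thesis using \<open>e \<in> set l\<close> by auto
  next
    case 2
    then show ?thesis using "1.IH"(1) \<open>e \<in> set l\<close> by fastforce
  next
    case 3
    then show ?thesis using "1.IH"(2) \<open>e \<in> set l\<close> by fastforce
  qed
next
  case (2 r c k)
  from 2(2) consider "l = Loop r c # k" | "l \<in> conts c (Loop r c # k)" by auto
  then show ?case
  proof cases
    case 1
    then show ?thesis using \<open>e \<in> set l\<close> by auto
  next
    case 2
    then show ?thesis using "2.IH" \<open>e \<in> set l\<close> by fastforce
  qed
qed auto

definition crel :: "com list \<times> store \<Rightarrow> com list \<times> store \<Rightarrow> bool" where
  "crel p q \<longleftrightarrow> fst p \<noteq> [] \<and> q = cstep (fst p) (snd p)"

lemma exec_crel: "exec c s t \<Longrightarrow> crel\<^sup>*\<^sup>* (c # k, s) (k, t)"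
proof (induction arbitrary: k rule: exec.induct)
  case (seq c s t d u)
  have "crel (Seq c d # k, s) (c # d # k, s)" by (simp add: crel_def)
  then show ?case
    by (rule converse_rtranclp_into_rtranclp[OF _ rtranclp_trans[OF seq.IH(1)[of "d # k"] seq.IH(2)[of k]]])
next
  case (loop_step s r c t u)
  have "crel (Loop r c # k, s) (c # Loop r c # k, s)" using loop_step.hyps by (simp add: crel_def)
  then show ?case
    by (rule converse_rtranclp_into_rtranclp[OF _ rtranclp_trans[OF loop_step.IH(1)[of "Loop r c # k"]
          loop_step.IH(2)[of k]]])
qed (auto intro!: r_into_rtranclp simp: crel_def)

text \<open>A terminating run in front of \<open>k\<close> passes through the stack \<open>k\<close>
  itself. Strong induction on the number of steps is needed because the run left over after the
  first command of a \<open>Seq\<close>, or after a loop body, is shorter by an unknown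
  amount.\<close>

lemma crel_exec_aux:
  "(crel ^^ n) (c # k, s) ([], u) \<Longrightarrow> \<exists>t m. exec c s t \<and> m < n \<and> (crel ^^ m) (k, t) ([], u)"
proof (induction n arbitrary: c k s rule: less_induct)
  case (less n)
  from less.prems have "n \<noteq> 0" by (cases n) auto
  then obtain n' where n: "n = Suc n'" by (cases n) auto
  obtain y where "crel (c # k, s) y" "(crel ^^ n') y ([], u)"
    using relpowp_Suc_D2[OF less.prems[unfolded n]] by blast
  then have n': "(crel ^^ n') (cstep (c # k) s) ([], u)" by (simp add: crel_def)
  have base: ?case if "exec c s t" "cstep (c # k) s = (k, t)" for t
    using n' that unfolding n by auto
  show ?case
  proof (cases c)
    case (Seq c1 c2)
    have "(crel ^^ n') (c1 # c2 # k, s) ([], u)" using n' Seq by simp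
    then obtain t m where t: "exec c1 s t" "m < n'" "(crel ^^ m) (c2 # k, t) ([], u)"
      using less.IH[of n' c1 "c2 # k" s] n by blast
    have "m < n" using t(2) n by simp
    then obtain t' m' where t': "exec c2 t t'" "m' < m" "(crel ^^ m') (k, t') ([], u)"
      using less.IH[OF _ t(3)] by blast
    have "exec c s t'" unfolding Seq using exec.seq[OF t(1) t'(1)] .
    moreover have "m' < n" using t(2) t'(2) n by simp
    ultimately show ?thesis using t'(3) by blast
  next
    case (Loop r c1)
    show ?thesis
    proof (cases "s r = 0")
      case True
      then show ?thesis using base[of s] Loop by simp
    next
      case False
      then have "(crel ^^ n') (c1 # Loop r c1 # k, s) ([], u)" using n' Loop by simp
      then obtain t m where t: "exec c1 s t" "m < n'" "(crel ^^ m) (Loop r c1 # k, t) ([], u)"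
        using less.IH[of n' c1 "Loop r c1 # k" s] n by blast
      have "m < n" using t(2) n by simp
      then obtain t' m' where t': "exec (Loop r c1) t t'" "m' < m" "(crel ^^ m') (k, t') ([], u)"
        using less.IH[OF _ t(3)] by blast
      have "exec c s t'" unfolding Loop using False t(1) t'(1) exec.loop_step by blast
      moreover have "m' < n" using t(2) t'(2) n by simp
      ultimately show ?thesis using t'(3) by blast
    qed
  next
    case Skip
    then show ?thesis using base[of s] by simp
  next
    case (Inc r)
    then show ?thesis using base[of "s(r := Suc (s r))"] by simp
  next
    case (Dec r)
    then show ?thesis using base[of "s(r := s r - 1)"] by simp
  qed
qed

lemma crel_exec:
  assumes "crel\<^sup>*\<^sup>* ([c], s) ([], u)"
  shows "exec c s u"
proof -
  obtain n where "(crel ^^ n) ([c], s) ([], u)" using assms rtranclp_imp_relpowp by metis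
  then obtain t m where t: "exec c s t" "(crel ^^ m) ([], t) ([], u)"
    using crel_exec_aux by blast
  have "t = u"
  proof (cases m)
    case 0
    then show ?thesis using t(2) by simp
  next
    case (Suc m')
    then obtain y where "crel ([], t) y" using relpowp_Suc_D2[of m' crel] t(2) by blast
    then show ?thesis by (simp add: crel_def)
  qed
  then show ?thesis using t(1) by simp
qed

text \<open>Generalised Collatz systems: a residue class \<open>a\<close> with \<open>c a = 0\<close> is halting.\<close>

definition affine_step :: "nat \<Rightarrow> (nat \<Rightarrow> nat) \<Rightarrow> (nat \<Rightarrow> nat) \<Rightarrow> nat \<Rightarrow> nat \<Rightarrow> bool" where
  "affine_step m c d x y \<longleftrightarrow> c (x mod m) \<noteq> 0 \<and> y = c (x mod m) * (x div m) + d (x mod m)"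

text \<open>By \<open>d a < c a\<close>, a branch carries the class of \<open>a\<close> modulo
  \<open>m\<close> to that of \<open>d a\<close> modulo \<open>c a\<close> and keeps the quotient,
  on negative integers as well. The encoding into a group relies on this.\<close>

definition affine_system :: "nat \<Rightarrow> (nat \<Rightarrow> nat) \<Rightarrow> (nat \<Rightarrow> nat) \<Rightarrow> bool" where
  "affine_system m c d \<longleftrightarrow> m > 0 \<and> (\<forall>a<m. c a = 0 \<or> d a < c a)"

text \<open>An unspecified sequence of distinct primes suffices: a program involves only finitely
  many of them, each as a constant.\<close>

definition pr :: "nat \<Rightarrow> nat" where
  "pr = (SOME f. inj f \<and> range f \<subseteq> {p. prime p})"

lemma pr: "inj pr" "prime (pr i)"
proof -
  have "\<exists>f::nat \<Rightarrow> nat. inj f \<and> range f \<subseteq> {p. prime p}"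
    using infinite_countable_subset primes_infinite by blast
  then have "inj pr \<and> range pr \<subseteq> {p. prime p}" unfolding pr_def by (rule someI_ex)
  then show "inj pr" "prime (pr i)" by auto
qed

definition godel :: "nat \<Rightarrow> store \<Rightarrow> nat" where
  "godel K s = (\<Prod>i<K. pr i ^ s i)"

lemma godel_Suc: "r < K \<Longrightarrow> godel K (s(r := Suc (s r))) = pr r * godel K s"
  unfolding godel_def by (subst (1 2) prod.remove[of _ r]) auto

lemma godel_dvd: "r < K \<Longrightarrow> pr r dvd godel K s \<longleftrightarrow> s r > 0"
proof
  assume r: "r < K" and "pr r dvd godel K s"
  then obtain i where "i < K" "pr r dvd pr i ^ s i"
    unfolding godel_def using pr(2) by (auto simp: prime_dvd_prod_iff)
  moreover from this have "pr r dvd pr i" using pr(2) prime_dvd_power by blast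
  then have "i = r" using pr by (metis injD primes_dvd_imp_eq)
  ultimately show "s r > 0" using pr(2)[of r] by (cases "s r") auto
next
  assume r: "r < K" and "s r > 0"
  then have "pr r dvd pr r ^ s r" by simp
  then show "pr r dvd godel K s" unfolding godel_def using r by (meson dvd_prodI dvd_trans finite_lessThan lessThan_iff)
qed

lemma godel_pred: "r < K \<Longrightarrow> s r > 0 \<Longrightarrow> godel K s = pr r * godel K (s(r := s r - 1))"
  using godel_Suc[of r K "s(r := s r - 1)"] by simp

lemma pr_gt: "pr i > 0"
  using pr(2)[of i] prime_gt_0_nat by blast

text \<open>For a Godel number \<open>N\<close> with \<open>N mod P = e\<close>, the entry
  \<open>(a, b, l')\<close> says that one step leads to the Godel number
  \<open>a * (N div P) + b\<close> and the stack \<open>l'\<close>. The empty stack gets coefficient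
  0 and thereby becomes halting.\<close>

fun ctab :: "nat \<Rightarrow> nat \<Rightarrow> com list \<Rightarrow> nat \<times> nat \<times> com list" where
  "ctab P e [] = (0, 0, [])"
| "ctab P e (Skip # k) = (P, e, k)"
| "ctab P e (Inc r # k) = (pr r * P, pr r * e, k)"
| "ctab P e (Dec r # k) = (if pr r dvd e then (P div pr r, e div pr r, k) else (P, e, k))"
| "ctab P e (Seq c d # k) = (P, e, c # d # k)"
| "ctab P e (Loop r c # k) = (P, e, if pr r dvd e then c # Loop r c # k else k)"

lemma ctab_lt:
  assumes "l \<noteq> []" "e < P" "\<And>c r. c \<in> set l \<Longrightarrow> r \<in> regs c \<Longrightarrow> pr r dvd P"
  shows "fst (snd (ctab P e l)) < fst (ctab P e l)"
proof (cases l)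
  case (Cons c k)
  show ?thesis
  proof (cases c)
    case (Dec r)
    have "pr r dvd P" using assms(3)[of c r] Cons Dec by simp
    then obtain q where "P = pr r * q" by blast
    then show ?thesis using assms(2) Cons Dec pr_gt[of r] by (auto elim!: dvdE)
  qed (use Cons assms pr_gt in auto)
qed (use assms in auto)

text \<open>\<open>P\<close> is the product of all register primes, so the residue decides which
  registers vanish, and a division by one of these primes can be carried out separately on
  \<open>P\<close> and on the residue.\<close>

lemma cstep_ctab:
  assumes "l \<noteq> []" "\<And>c r. c \<in> set l \<Longrightarrow> r \<in> regs c \<Longrightarrow> r < K"
    and P: "P = (\<Prod>i<K. pr i)"
    and T: "ctab P (godel K s mod P) l = (a, b, l')"
  shows "cstep l s = (l', snd (cstep l s))"
    "godel K (snd (cstep l s)) = a * (godel K s div P) + b"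
proof -
  have dv: "pr r dvd P" if "r < K" for r
    unfolding P using that by (intro dvd_prodI) auto
  have zero: "pr r dvd godel K s mod P \<longleftrightarrow> s r \<noteq> 0" if "r < K" for r
    using dvd_mod_iff[OF dv[OF that]] godel_dvd[OF that] by auto
  have N: "P * (godel K s div P) + godel K s mod P = godel K s" by simp
  have "cstep l s = (l', snd (cstep l s)) \<and> godel K (snd (cstep l s)) = a * (godel K s div P) + b"
  proof (cases l)
    case Nil then show ?thesis using assms by simp
  next
    case (Cons c k)
    show ?thesis
    proof (cases c)
      case (Inc r)
      then have "r < K" using assms(2)[of c r] Cons by simp
      moreover have "pr r * P * (godel K s div P) + pr r * (godel K s mod P) = pr r * godel K s"
        using arg_cong[OF N, of "\<lambda>x. pr r * x"] by (simp only: distrib_left mult.assoc mult.left_commute)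
      ultimately show ?thesis using T Cons Inc godel_Suc[of r K s] by auto
    next
      case (Dec r)
      then have r: "r < K" using assms(2)[of c r] Cons by simp
      show ?thesis
      proof (cases "s r = 0")
        case True
        then have "s(r := s r - 1) = s" by auto
        then show ?thesis using T Cons Dec zero[OF r] True N by auto
      next
        case False
        obtain q where q: "P = pr r * q" using dv[OF r] by blast
        obtain e where e: "godel K s mod P = pr r * e" using zero[OF r] False by blast
        have "pr r * (q * (godel K s div P) + e) = godel K s"
          using N unfolding e by (subst (asm) (1) q) (simp add: algebra_simps)
        also have "\<dots> = pr r * godel K (s(r := s r - 1))" using godel_pred r False by simp
        finally have "q * (godel K s div P) + e = godel K (s(r := s r - 1))" using pr_gt[of r] by simp
        moreover have "P div pr r = q" "godel K s mod P div pr r = e"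
          using pr_gt[of r] q e by simp_all
        ultimately show ?thesis using T Cons Dec zero[OF r] False by auto
      qed
    next
      case (Loop r d)
      then have r: "r < K" using assms(2)[of c r] Cons by simp
      then show ?thesis using T Cons Loop zero[OF r] N by auto
    qed (use T Cons N in auto)
  qed
  then show "cstep l s = (l', snd (cstep l s))"
    "godel K (snd (cstep l s)) = a * (godel K s div P) + b" by blast+
qed

text \<open>A state is encoded as \<open>L * godel K s + lab l\<close>; the label and the vanishing
  of the registers are then both visible modulo \<open>L * P\<close>.\<close>

lemma affine_of_com:
  obtains m c d L K h where "affine_system m c d" "c (h mod m) = 0" "regs c0 \<subseteq> {..<K}" "K \<ge> K0"
    "\<And>s. (\<exists>t. exec c0 s t \<and> (\<forall>i<K. t i = 0)) \<Longrightarrow> (affine_step m c d)\<^sup>*\<^sup>* (L * godel K s + 1) h"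
    "\<And>s y. (affine_step m c d)\<^sup>*\<^sup>* (L * godel K s + 1) y \<Longrightarrow> c (y mod m) = 0 \<Longrightarrow> \<exists>t. exec c0 s t"
proof -
  define \<Lambda> where "\<Lambda> = insert [] (conts c0 [])"
  have fin: "finite \<Lambda>" by (simp add: \<Lambda>_def finite_conts)
  then obtain lab0 :: "com list \<Rightarrow> nat" and n where lab0: "inj_on lab0 \<Lambda>" "lab0 ` \<Lambda> = {..<n}"
    by (metis finite_imp_inj_to_nat_seg lessThan_def)
  \<comment> \<open>The start stack gets the fixed label 1, so that the form of the input does not
    depend on the choice of labels; the shift by 2 keeps all other labels distinct from it.\<close>
  define lab where "lab = (\<lambda>l. if l = [c0] then 1 else Suc (Suc (lab0 l)))"
  define L where "L = n + 2"
  have lab_inj: "inj_on lab \<Lambda>" using lab0(1) by (auto simp: lab_def inj_on_def)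
  have lab_lt: "lab l < L" if "l \<in> \<Lambda>" for l using lab0(2) that by (auto simp: lab_def L_def)
  define K where "K = Suc (Max (insert K0 (regs c0)))"
  have K: "r < K" if "r \<in> regs c0" for r
    unfolding K_def using that finite_regs[of c0] by (simp add: le_imp_less_Suc)
  have K0: "K0 \<le> K" unfolding K_def using finite_regs[of c0] by (simp add: le_SucI)
  have regsK: "r < K" if "l \<in> \<Lambda>" "e \<in> set l" "r \<in> regs e" for l e r
    using that regs_conts[of l c0 "[]" e] K by (auto simp: \<Lambda>_def)
  define P where "P = (\<Prod>i<K. pr i)"
  have P0: "P > 0" unfolding P_def by (intro prod_pos) (auto simp: pr_gt)
  have dvP: "pr r dvd P" if "r < K" for r
    unfolding P_def using that by (intro dvd_prodI) auto
  define m where "m = L * P"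
  \<comment> \<open>Residues that are not labels are treated as the empty stack and hence
    halt.\<close>
  define lb where "lb = (\<lambda>a. if a mod L \<in> lab ` \<Lambda> then inv_into \<Lambda> lab (a mod L) else [])"
  define c where "c = (\<lambda>a. L * fst (ctab P (a div L) (lb a)))"
  define d where "d = (\<lambda>a. L * fst (snd (ctab P (a div L) (lb a))) + lab (snd (snd (ctab P (a div L) (lb a)))))"
  have L0: "L > 0" by (simp add: L_def)
  have lbL: "lb a \<in> \<Lambda>" for a
    unfolding lb_def using inv_into_into[of "a mod L" lab \<Lambda>] by (auto simp: \<Lambda>_def)
  have nextL: "snd (snd (ctab P e l)) \<in> \<Lambda>" if "l \<in> \<Lambda>" for l e
  proof (cases l)
    case (Cons x k)
    then have "l \<in> conts c0 []" using that by (auto simp: \<Lambda>_def)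
    then have *: "fst (cstep l s) \<in> \<Lambda>" for s using cstep_conts[of l c0 "[]" s] by (auto simp: \<Lambda>_def)
    show ?thesis using *[of "\<lambda>_. 0"] *[of "\<lambda>_. 1"] Cons by (cases x) auto
  qed (auto simp: \<Lambda>_def)
  have sys: "affine_system m c d"
    unfolding affine_system_def
  proof (intro conjI allI impI)
    show "m > 0" using L0 P0 by (simp add: m_def)
    fix a assume a: "a < m"
    then have e: "a div L < P" by (simp add: m_def less_mult_imp_div_less mult.commute)
    show "c a = 0 \<or> d a < c a"
    proof (cases "lb a = []")
      case True then show ?thesis by (simp add: c_def)
    next
      case False
      have "fst (snd (ctab P (a div L) (lb a))) < fst (ctab P (a div L) (lb a))"
        by (rule ctab_lt[OF False e]) (use regsK[OF lbL] dvP in blast)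
      moreover have "lab (snd (snd (ctab P (a div L) (lb a)))) < L" using lab_lt nextL lbL by blast
      ultimately have "d a < c a" unfolding c_def d_def
        by (smt (verit, best) Suc_leI add_less_cancel_left less_le_trans mult_Suc_right mult_le_mono2 add.commute)
      then show ?thesis ..
    qed
  qed
  define en where "en = (\<lambda>(l, s). L * godel K s + lab l)"
  have em: "(L * N + lab l) mod m = L * (N mod P) + lab l" "(L * N + lab l) div m = N div P"
    "lb (L * (N mod P) + lab l) = l" "(L * (N mod P) + lab l) div L = N mod P"
    if "l \<in> \<Lambda>" for N l
  proof -
    have ll: "lab l < L" using lab_lt[OF that] .
    show "(L * N + lab l) div m = N div P"
      unfolding m_def using ll by (simp add: div_mult2_eq)
    have "(L * N + lab l) mod (L * P) = L * ((L * N + lab l) div L mod P) + (L * N + lab l) mod L"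
      by (rule mod_mult2_eq)
    then show "(L * N + lab l) mod m = L * (N mod P) + lab l" unfolding m_def using ll by simp
    show "lb (L * (N mod P) + lab l) = l"
      unfolding lb_def using ll that lab_inj by simp
    show "(L * (N mod P) + lab l) div L = N mod P" using ll by simp
  qed
  have cz: "c (en (l, s) mod m) = 0 \<longleftrightarrow> l = []" if "l \<in> \<Lambda>" for l s
  proof
    assume "c (en (l, s) mod m) = 0"
    then have 0: "fst (ctab P (godel K s mod P) l) = 0"
      using em[OF that, of "godel K s"] L0 by (simp add: c_def en_def)
    show "l = []"
    proof (rule ccontr)
      assume "l \<noteq> []"
      then have "fst (snd (ctab P (godel K s mod P) l)) < fst (ctab P (godel K s mod P) l)"
        by (rule ctab_lt) (use regsK[OF that] dvP P0 in auto)
      then show False using 0 by simp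
    qed
  next
    assume "l = []"
    then show "c (en (l, s) mod m) = 0"
      using em[OF that, of "godel K s"] by (simp add: c_def en_def)
  qed
  have stepI: "affine_step m c d (en p) y \<longleftrightarrow> fst p \<noteq> [] \<and> y = en (cstep (fst p) (snd p))"
    if p: "fst p \<in> \<Lambda>" for p y
  proof -
    obtain l s where ls: "p = (l, s)" by fastforce
    have l: "l \<in> \<Lambda>" using p ls by simp
    show ?thesis
    proof (cases "l = []")
      case True
      then show ?thesis using cz[OF l] ls by (simp add: affine_step_def)
    next
      case False
      obtain a b l' where T: "ctab P (godel K s mod P) l = (a, b, l')" by (metis prod_cases3)
      note C = cstep_ctab[OF False _ P_def T]
      have C1: "cstep l s = (l', snd (cstep l s))" and C2: "godel K (snd (cstep l s)) = a * (godel K s div P) + b"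
        using C regsK[OF l] by blast+
      have "en (cstep l s) = L * (a * (godel K s div P) + b) + lab l'"
        by (subst C1) (simp add: en_def C2)
      moreover have "c (en p mod m) = L * a" "d (en p mod m) = L * b + lab l'" "en p div m = godel K s div P"
        using em[OF l, of "godel K s"] T by (simp_all add: c_def d_def en_def ls)
      moreover have "c (en p mod m) \<noteq> 0" using cz[OF l, of s] False ls by simp
      ultimately show ?thesis unfolding affine_step_def using False ls by (simp add: algebra_simps)
    qed
  qed
  have inL: "fst (cstep l s) \<in> \<Lambda>" if "l \<in> \<Lambda>" for l s
    using that cstep_conts[of l c0 "[]" s] by (cases "l = []") (auto simp: \<Lambda>_def)
  have fwd: "crel\<^sup>*\<^sup>* p q \<Longrightarrow> fst p \<in> \<Lambda> \<Longrightarrow> (affine_step m c d)\<^sup>*\<^sup>* (en p) (en q) \<and> fst q \<in> \<Lambda>" for p q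
  proof (induction rule: rtranclp_induct)
    case (step q r)
    then have "affine_step m c d (en q) (en r)" "fst r \<in> \<Lambda>"
      using stepI inL by (auto simp: crel_def)
    then show ?case using step by (meson rtranclp.rtrancl_into_rtrancl)
  qed auto
  have bwd: "(affine_step m c d)\<^sup>*\<^sup>* (en p) y \<Longrightarrow> fst p \<in> \<Lambda> \<Longrightarrow> \<exists>q. y = en q \<and> fst q \<in> \<Lambda> \<and> crel\<^sup>*\<^sup>* p q" for p y
  proof (induction rule: rtranclp_induct)
    case base then show ?case by blast
  next
    case (step y z)
    then obtain q where q: "y = en q" "fst q \<in> \<Lambda>" "crel\<^sup>*\<^sup>* p q" by blast
    then have "crel q (cstep (fst q) (snd q))" "z = en (cstep (fst q) (snd q))"
      using step.hyps(2) stepI by (auto simp: crel_def)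
    then show ?case using q inL by (intro exI[of _ "cstep (fst q) (snd q)"]) auto
  qed
  have c0L: "[c0] \<in> \<Lambda>" by (simp add: \<Lambda>_def conts_self)
  have NilL: "[] \<in> \<Lambda>" by (simp add: \<Lambda>_def)
  have start: "en ([c0], s) = L * godel K s + 1" for s by (simp add: en_def lab_def)
  define h where "h = en ([], \<lambda>_. 0)"
  show thesis
  proof (rule that[of m c d h K L])
    show "affine_system m c d" by fact
    show "c (h mod m) = 0" unfolding h_def using cz[OF NilL] by simp
    show "regs c0 \<subseteq> {..<K}" using K by auto
    show "K \<ge> K0" by fact
    fix s
    {
      assume "\<exists>t. exec c0 s t \<and> (\<forall>i<K. t i = 0)"
      then obtain t where t: "exec c0 s t" "\<forall>i<K. t i = 0" by blast
      have "godel K t = godel K (\<lambda>_. 0)" unfolding godel_def using t(2) by simp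
      then have "en ([], t) = h" by (simp add: en_def h_def)
      then show "(affine_step m c d)\<^sup>*\<^sup>* (L * godel K s + 1) h"
        using fwd[OF exec_crel[OF t(1)], of "[]"] c0L start by simp
    }
    fix y assume "(affine_step m c d)\<^sup>*\<^sup>* (L * godel K s + 1) y" and c: "c (y mod m) = 0"
    then obtain q where q: "y = en q" "fst q \<in> \<Lambda>" "crel\<^sup>*\<^sup>* ([c0], s) q"
      using bwd[of "([c0], s)" y] c0L start by auto
    obtain l t where lt: "q = (l, t)" by fastforce
    then have "l = []" using c q cz by simp
    then show "\<exists>t. exec c0 s t" using crel_exec q lt by blast
  qed
qed

definition affine_input :: "nat \<Rightarrow> nat list \<Rightarrow> nat" where
  "affine_input L xs = L * (\<Prod>i<length xs. pr i ^ (xs ! i)) + 1"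

lemma affine_of_recf:
  obtains m c d L h where "affine_system m c d" "c (h mod m) = 0"
    "\<And>xs y. length xs = k \<Longrightarrow> rec_eval f xs y \<Longrightarrow> (affine_step m c d)\<^sup>*\<^sup>* (affine_input L xs) h"
    "\<And>xs y. length xs = k \<Longrightarrow> (affine_step m c d)\<^sup>*\<^sup>* (affine_input L xs) y \<Longrightarrow> c (y mod m) = 0 \<Longrightarrow>
       \<exists>z. rec_eval f xs z"
proof -
  obtain c0 where c0: "implements c0 f [0..<k] k (Suc k)"
  proof -
    have "\<forall>a\<in>set [0..<k]. a < Suc k" "k \<notin> set [0..<k]" by auto
    then show thesis using implementableD[OF implementable[of f], of "[0..<k]" "Suc k" k] that by blast
  qed
  \<comment> \<open>Clearing every register that may be non-zero at the end makes all terminating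
    runs stop at the same number \<open>h\<close>, so halting becomes reachability of a single
    target.\<close>
  define c1 where "c1 = Seq c0 (foldr (\<lambda>r. Seq (clear r)) [0..<Suc k] Skip)"
  obtain m c d L K h where A: "affine_system m c d" "c (h mod m) = 0" "regs c1 \<subseteq> {..<K}" "K \<ge> k"
    "\<And>s. (\<exists>t. exec c1 s t \<and> (\<forall>i<K. t i = 0)) \<Longrightarrow> (affine_step m c d)\<^sup>*\<^sup>* (L * godel K s + 1) h"
    "\<And>s y. (affine_step m c d)\<^sup>*\<^sup>* (L * godel K s + 1) y \<Longrightarrow> c (y mod m) = 0 \<Longrightarrow> \<exists>t. exec c1 s t"
    by (rule affine_of_com[of c1 k]) (rule that; assumption)
  define st where "st = (\<lambda>(xs::nat list) i. if i < k then xs ! i else 0)"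
  have st: "exec c0 (st xs) t \<longleftrightarrow> (\<exists>y. rec_eval f xs y \<and> t = (st xs)(k := y))" if "length xs = k" for xs :: "nat list" and t
  proof -
    have m: "map (st xs) [0..<k] = xs" using that by (intro nth_equalityI) (auto simp: st_def)
    have "exec c0 (st xs) t \<longleftrightarrow> (\<exists>y. rec_eval f (map (st xs) [0..<k]) y \<and> t = (st xs)(k := y))"
      by (rule implementsD[OF c0]) (auto simp: st_def)
    then show ?thesis unfolding m .
  qed
  have inp: "L * godel K (st xs) + 1 = affine_input L xs" if "length xs = k" for xs :: "nat list"
  proof -
    have "godel K (st xs) = (\<Prod>i\<in>{..<k}. pr i ^ st xs i)"
      unfolding godel_def by (rule prod.mono_neutral_right) (use \<open>K \<ge> k\<close> in \<open>auto simp: st_def\<close>)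
    then show ?thesis unfolding affine_input_def that by (simp add: st_def)
  qed
  show thesis
  proof (rule that[of m c d h L])
    show "affine_system m c d" "c (h mod m) = 0" by fact+
    fix xs :: "nat list" and y assume xs: "length xs = k"
    {
      assume "rec_eval f xs y"
      then have "exec c0 (st xs) ((st xs)(k := y))" using st[OF xs] by blast
      then have "exec c1 (st xs) (\<lambda>i. if i \<in> set [0..<Suc k] then 0 else ((st xs)(k := y)) i)"
        unfolding c1_def exec_Seq exec_clear_range by blast
      moreover have "(\<lambda>i. if i \<in> set [0..<Suc k] then 0 else ((st xs)(k := y)) i) = (\<lambda>_. 0)"
        by (auto simp: st_def)
      ultimately have "exec c1 (st xs) (\<lambda>_. 0)" by (simp only:)
      then have "\<exists>t. exec c1 (st xs) t \<and> (\<forall>i<K. t i = 0)" by (intro exI[of _ "\<lambda>_. 0"]) simp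
      then show "(affine_step m c d)\<^sup>*\<^sup>* (affine_input L xs) h"
        using A(5)[of "st xs"] inp[OF xs] by simp
    }
    assume "(affine_step m c d)\<^sup>*\<^sup>* (affine_input L xs) y" "c (y mod m) = 0"
    then have "\<exists>t. exec c1 (st xs) t" using A(6)[of "st xs" y] inp[OF xs] by simp
    then show "\<exists>z. rec_eval f xs z" unfolding c1_def exec_Seq st[OF xs] by blast
  qed
qed

section \<open>A universal function and the diagonal argument\<close>

lemma digits_exist: "(\<And>a. a < m \<Longrightarrow> f a < B) \<Longrightarrow> \<exists>C. \<forall>a<m. (C::nat) div B ^ a mod B = f a"
proof (induction m arbitrary: f)
  case (Suc m)
  from Suc.IH[of "\<lambda>a. f (Suc a)"] Suc.prems
  obtain C where C: "\<forall>a<m. C div B ^ a mod B = f (Suc a)" by auto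
  have B: "f 0 < B" using Suc.prems by simp
  have "(f 0 + B * C) div B ^ a mod B = f a" if "a < Suc m" for a
    using that C B by (cases a) (simp_all add: div_mult2_eq)
  then show ?case by blast
qed simp

lemma rec_eval_Minim: "rec_eval (Minim f) xs y \<longleftrightarrow>
    rec_eval f (y # xs) 0 \<and> (\<forall>i<y. \<exists>k. rec_eval f (i # xs) (Suc k))"
  by (auto elim: rec_eval_MinimE intro: rec_eval.minim)

lemma rec_eval_Minim_total:
  assumes "\<And>n. rec_eval f (n # xs) (T n)"
  shows "(\<exists>y. rec_eval (Minim f) xs y) \<longleftrightarrow> (\<exists>n. T n = 0)"
proof
  assume "\<exists>y. rec_eval (Minim f) xs y"
  then show "\<exists>n. T n = 0" unfolding rec_eval_Minim using assms rec_eval_functional by metis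
next
  assume ex: "\<exists>n. T n = 0"
  define n where "n = (LEAST n. T n = 0)"
  have "T n = 0" unfolding n_def using ex by (rule LeastI_ex)
  moreover have "T i \<noteq> 0" if "i < n" for i using not_less_Least that unfolding n_def by blast
  ultimately have "rec_eval (Minim f) xs n" unfolding rec_eval_Minim
    using assms by (metis not0_implies_Suc)
  then show "\<exists>y. rec_eval (Minim f) xs y" ..
qed

lemma rc_affine_input:
  assumes "rc k Lf" "\<And>F. F \<in> set Fs \<Longrightarrow> rc k F"
  shows "rc k (\<lambda>xs. affine_input (Lf xs) (map (\<lambda>F. F xs) Fs))"
proof -
  have "rc k (\<lambda>xs. \<Prod>i<n. pr i ^ (map (\<lambda>F. F xs) Fs ! i))" if "n \<le> length Fs" for n
    using that
  proof (induction n)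
    case 0
    then show ?case using rc_const[of k 1] by simp
  next
    case (Suc n)
    have "rc k (\<lambda>xs. (\<Prod>i<n. pr i ^ (map (\<lambda>F. F xs) Fs ! i)) * pr n ^ ((Fs ! n) xs))"
      by (intro rc_mult rc_pow rc_const Suc.IH) (use Suc.prems assms(2) in auto)
    then show ?case by (rule rc_cong) (use Suc.prems in simp)
  qed
  from this[of "length Fs"] have "rc k (\<lambda>xs. Lf xs * (\<Prod>i<length Fs. pr i ^ (map (\<lambda>F. F xs) Fs ! i)) + 1)"
    by (intro rc_add rc_mult rc_const assms(1)) simp
  then show ?thesis unfolding affine_input_def length_map .
qed

text \<open>The arguments of the universal function are \<open>[m, L, B, C, D]\<close>, where the coefficients
  \<open>c a\<close> and \<open>d a\<close> are the base-\<open>B\<close> digits of \<open>C\<close> and \<open>D\<close>. The encoded system is run on its own code.\<close>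

definition digit :: "nat \<Rightarrow> nat \<Rightarrow> nat \<Rightarrow> nat" where
  "digit B C a = C div B ^ a mod B"

definition universal_step :: "nat list \<Rightarrow> nat \<Rightarrow> nat" where
  "universal_step xs y = digit (xs ! 2) (xs ! 3) (y mod xs ! 0) * (y div xs ! 0)
     + digit (xs ! 2) (xs ! 4) (y mod xs ! 0)"

definition universal_flag :: "nat list \<Rightarrow> nat \<Rightarrow> nat" where
  "universal_flag xs n =
     digit (xs ! 2) (xs ! 3) ((universal_step xs ^^ n) (affine_input (xs ! 1) xs) mod xs ! 0)"

lemma universal_recf:
  obtains U where "\<And>xs. length xs = 5 \<Longrightarrow>
    (\<exists>y. rec_eval U xs y) \<longleftrightarrow> (\<exists>n. universal_flag xs n = 0)"
proof -
  let ?x = "\<lambda>i xs::nat list. xs ! i"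
  have step: "rc (Suc 6) (\<lambda>ys. universal_step (drop 2 ys) (ys ! 0))"
  proof (rule rc_cong)
    show "rc (Suc 6) (\<lambda>ys. ys ! 5 div (ys ! 4) ^ (ys ! 0 mod ys ! 2) mod (ys ! 4) * (ys ! 0 div ys ! 2)
      + ys ! 6 div (ys ! 4) ^ (ys ! 0 mod ys ! 2) mod (ys ! 4))"
      by (intro rc_intros) simp_all
    fix ys :: "nat list" assume "length ys = Suc 6"
    then show "ys ! 5 div (ys ! 4) ^ (ys ! 0 mod ys ! 2) mod (ys ! 4) * (ys ! 0 div ys ! 2)
      + ys ! 6 div (ys ! 4) ^ (ys ! 0 mod ys ! 2) mod (ys ! 4) = universal_step (drop 2 ys) (ys ! 0)"
      by (simp add: universal_step_def digit_def)
  qed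
  have inp: "rc 6 (\<lambda>ys. affine_input (ys ! 2) (map (\<lambda>F. F ys) (map ?x [1..<6])))"
    by (intro rc_affine_input rc_nth) (auto intro: rc_nth)
  have "rc 6 (\<lambda>ys. ((\<lambda>y. universal_step (drop 2 (y # ys)) ((y # ys) ! 0)) ^^ (ys ! 0))
     (affine_input (ys ! 2) (map (\<lambda>F. F ys) (map ?x [1..<6]))))"
    by (intro rc_funpow[OF _ inp] rc_nth step) simp
  then have "rc 6 (\<lambda>ys. ys ! 4 div (ys ! 3) ^ (((\<lambda>y. universal_step (drop 2 (y # ys)) ((y # ys) ! 0)) ^^ (ys ! 0))
     (affine_input (ys ! 2) (map (\<lambda>F. F ys) (map ?x [1..<6]))) mod ys ! 1) mod (ys ! 3))"
    by (intro rc_intros) simp_all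
  then have "rc 6 (\<lambda>ys. universal_flag (tl ys) (hd ys))"
  proof (rule rc_cong)
    fix ys :: "nat list" assume "length ys = 6"
    then obtain n xs where ys: "ys = n # xs" "length xs = 5" by (cases ys) auto
    have m: "map (\<lambda>F. F ys) (map ?x [1..<6]) = xs"
      unfolding ys(1) using ys(2) by (intro nth_equalityI) (auto simp: nth_Cons' )
    show "ys ! 4 div (ys ! 3) ^ (((\<lambda>y. universal_step (drop 2 (y # ys)) ((y # ys) ! 0)) ^^ (ys ! 0))
     (affine_input (ys ! 2) (map (\<lambda>F. F ys) (map ?x [1..<6]))) mod ys ! 1) mod (ys ! 3)
      = universal_flag (tl ys) (hd ys)"
      unfolding m unfolding ys(1) universal_flag_def digit_def by (simp add: numeral_eq_Suc)
  qed
  then obtain t where t: "\<And>ys. length ys = 6 \<Longrightarrow> rec_eval t ys (universal_flag (tl ys) (hd ys))"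
    unfolding rc_def by blast
  show thesis
  proof (rule that[of "Minim t"])
    fix xs :: "nat list" assume "length xs = 5"
    then show "(\<exists>y. rec_eval (Minim t) xs y) \<longleftrightarrow> (\<exists>n. universal_flag xs n = 0)"
      by (intro rec_eval_Minim_total) (use t[of "_ # xs"] in simp)
  qed
qed

lemma universal_flag_iff:
  assumes c: "\<And>a. a < m \<Longrightarrow> digit B C a = c a" and d: "\<And>a. a < m \<Longrightarrow> digit B D a = d a" and m: "m > 0"
    and xs: "xs = [m, L, B, C, D]"
  shows "(\<exists>n. universal_flag xs n = 0) \<longleftrightarrow>
    (\<exists>y. (affine_step m c d)\<^sup>*\<^sup>* (affine_input L xs) y \<and> c (y mod m) = 0)"
proof -
  have step: "universal_step xs y = c (y mod m) * (y div m) + d (y mod m)" for y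
    using c d m by (simp add: universal_step_def xs)
  have flag: "universal_flag xs n = c ((universal_step xs ^^ n) (affine_input L xs) mod m)" for n
    using c m by (simp add: universal_flag_def xs)
  show ?thesis
  proof
    assume ex: "\<exists>n. universal_flag xs n = 0"
    \<comment> \<open>After the first halting time \<open>universal_step\<close> goes on computing
      although \<open>affine_step\<close> has no successor, so the first time with flag 0 is
      taken.\<close>
    define n where "n = (LEAST n. universal_flag xs n = 0)"
    have n: "universal_flag xs n = 0" unfolding n_def using ex by (rule LeastI_ex)
    have lt: "universal_flag xs i \<noteq> 0" if "i < n" for i
      using not_less_Least that unfolding n_def by blast
    have "(affine_step m c d)\<^sup>*\<^sup>* (affine_input L xs) ((universal_step xs ^^ i) (affine_input L xs))" if "i \<le> n" for i
      using that
    proof (induction i)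
      case (Suc i)
      have "affine_step m c d ((universal_step xs ^^ i) (affine_input L xs))
          ((universal_step xs ^^ Suc i) (affine_input L xs))"
        using lt[of i] Suc.prems flag[of i] step by (simp add: affine_step_def)
      then show ?case using Suc by (meson Suc_leD rtranclp.rtrancl_into_rtrancl)
    qed simp
    then show "\<exists>y. (affine_step m c d)\<^sup>*\<^sup>* (affine_input L xs) y \<and> c (y mod m) = 0"
      using n flag[of n] by (metis order_refl)
  next
    assume "\<exists>y. (affine_step m c d)\<^sup>*\<^sup>* (affine_input L xs) y \<and> c (y mod m) = 0"
    then obtain y where y: "(affine_step m c d)\<^sup>*\<^sup>* (affine_input L xs) y" "c (y mod m) = 0" by blast
    from y(1) have "\<exists>n. y = (universal_step xs ^^ n) (affine_input L xs)"
    proof (induction rule: rtranclp_induct)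
      case base
      show ?case by (rule exI[of _ 0]) simp
    next
      case (step y z)
      then obtain n where "y = (universal_step xs ^^ n) (affine_input L xs)" by blast
      then have "z = (universal_step xs ^^ Suc n) (affine_input L xs)"
        using step.hyps(2) \<open>\<And>y. universal_step xs y = _ y\<close> by (simp add: affine_step_def)
      then show ?case ..
    qed
    then show "\<exists>n. universal_flag xs n = 0" using flag y(2) by metis
  qed
qed

text \<open>A decision procedure for the system of \<open>U\<close> would yield
  \<open>Minim t\<close>, defined exactly where \<open>U\<close> is undefined. The affine system of
  \<open>Minim t\<close>, encoded in \<open>xs\<close> and run on \<open>xs\<close>, halts iff
  \<open>U\<close> is defined at \<open>xs\<close> by universality, and iff \<open>U\<close> is
  undefined there by construction.\<close>

theorem undecidable_affine_system:
  obtains m c d h where "affine_system m c d" "c (h mod m) = 0"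
    "\<not> (\<exists>g. \<forall>x. rec_eval g [x] (of_bool ((affine_step m c d)\<^sup>*\<^sup>* x h)))"
proof -
  obtain U where U: "\<And>xs. length xs = 5 \<Longrightarrow>
    (\<exists>y. rec_eval U xs y) \<longleftrightarrow> (\<exists>n. universal_flag xs n = 0)"
    using universal_recf by blast
  obtain m c d L h where A: "affine_system m c d" "c (h mod m) = 0"
    "\<And>xs y. length xs = 5 \<Longrightarrow> rec_eval U xs y \<Longrightarrow> (affine_step m c d)\<^sup>*\<^sup>* (affine_input L xs) h"
    "\<And>xs y. length xs = 5 \<Longrightarrow> (affine_step m c d)\<^sup>*\<^sup>* (affine_input L xs) y \<Longrightarrow> c (y mod m) = 0 \<Longrightarrow>
       \<exists>z. rec_eval U xs z"
    by (rule affine_of_recf[of 5 U]) (rule that; assumption)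
  have "\<not> (\<forall>x. rec_eval g [x] (of_bool ((affine_step m c d)\<^sup>*\<^sup>* x h)))" for g
  proof
    assume g: "\<forall>x. rec_eval g [x] (of_bool ((affine_step m c d)\<^sup>*\<^sup>* x h))"
    have "rc 1 (\<lambda>xs. of_bool ((affine_step m c d)\<^sup>*\<^sup>* (hd xs) h))"
      unfolding rc_def using g by (metis One_nat_def length_Suc_conv length_0_conv list.sel(1))
    moreover have inp: "rc 6 (\<lambda>ys. affine_input L (map (\<lambda>F. F ys) (map (\<lambda>i xs. xs ! i) [1..<6])))"
      by (intro rc_affine_input rc_const) (auto intro: rc_nth)
    ultimately have "rc 6 (\<lambda>ys. of_bool ((affine_step m c d)\<^sup>*\<^sup>*
        (affine_input L (map (\<lambda>F. F ys) (map (\<lambda>i xs. xs ! i) [1..<6]))) h))"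
      by (drule_tac rc_comp1) (assumption, simp)
    then obtain t where t: "\<And>ys. length ys = 6 \<Longrightarrow> rec_eval t ys (of_bool ((affine_step m c d)\<^sup>*\<^sup>*
        (affine_input L (map (\<lambda>F. F ys) (map (\<lambda>i xs. xs ! i) [1..<6]))) h))"
      unfolding rc_def by blast
    have t': "rec_eval t (n # xs) (of_bool ((affine_step m c d)\<^sup>*\<^sup>* (affine_input L xs) h))"
      if "length xs = 5" for n and xs :: "nat list"
    proof -
      have "map (\<lambda>F. F (n # xs)) (map (\<lambda>i xs. xs ! i) [1..<6]) = xs"
        using that by (intro nth_equalityI) (auto simp: nth_Cons')
      then show ?thesis using t[of "n # xs"] that by simp
    qed
    have G: "(\<exists>y. rec_eval (Minim t) xs y) \<longleftrightarrow> \<not> (affine_step m c d)\<^sup>*\<^sup>* (affine_input L xs) h"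
      if "length xs = 5" for xs :: "nat list"
      using rec_eval_Minim_total[of t xs "\<lambda>_. of_bool ((affine_step m c d)\<^sup>*\<^sup>* (affine_input L xs) h)"] t'[OF that]
      by simp
    obtain m' c' d' L' h' where A': "affine_system m' c' d'" "c' (h' mod m') = 0"
      "\<And>xs y. length xs = 5 \<Longrightarrow> rec_eval (Minim t) xs y \<Longrightarrow> (affine_step m' c' d')\<^sup>*\<^sup>* (affine_input L' xs) h'"
      "\<And>xs y. length xs = 5 \<Longrightarrow> (affine_step m' c' d')\<^sup>*\<^sup>* (affine_input L' xs) y \<Longrightarrow> c' (y mod m') = 0 \<Longrightarrow>
         \<exists>z. rec_eval (Minim t) xs z"
      by (rule affine_of_recf[of 5 "Minim t"]) (rule that; assumption)
    define B where "B = Suc (Max ((c' ` {..<m'}) \<union> (d' ` {..<m'})))"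
    have m': "m' > 0" using A'(1) by (simp add: affine_system_def)
    have "c' a < B" "d' a < B" if "a < m'" for a
      unfolding B_def using that by (auto intro!: le_imp_less_Suc Max_ge)
    then obtain C D where C: "\<forall>a<m'. C div B ^ a mod B = c' a" and D: "\<forall>a<m'. D div B ^ a mod B = d' a"
      using digits_exist[of m' c' B] digits_exist[of m' d' B] by blast
    define xs where "xs = [m', L', B, C, D]"
    have l: "length xs = 5" by (simp add: xs_def)
    have "(\<exists>y. rec_eval U xs y) \<longleftrightarrow>
        (\<exists>y. (affine_step m' c' d')\<^sup>*\<^sup>* (affine_input L' xs) y \<and> c' (y mod m') = 0)"
      unfolding U[OF l]
      by (rule universal_flag_iff) (use C D m' in \<open>auto simp: digit_def xs_def\<close>)
    also have "\<dots> \<longleftrightarrow> (\<exists>y. rec_eval (Minim t) xs y)" using A'(2-4) l by blast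
    also have "\<dots> \<longleftrightarrow> \<not> (\<exists>y. rec_eval U xs y)" unfolding G[OF l] using A(2-4) l by blast
    finally show False by blast
  qed
  then show thesis using that[OF A(1,2)] by blast
qed

section \<open>Null words of a group encoding an affine system\<close>

definition winv :: "'a word \<Rightarrow> 'a word" where
  "winv w = rev (map inv_letter w)"

lemma winv_Nil [simp]: "winv [] = []"
  and winv_Cons: "winv (a # w) = winv w @ [inv_letter a]"
  and winv_append [simp]: "winv (u @ v) = winv v @ winv u"
  by (simp_all add: winv_def)

lemma winv_winv [simp]: "winv (winv w) = w"
  by (simp add: winv_def rev_map comp_def)

lemma winv_words [simp]: "winv w \<in> words X \<longleftrightarrow> w \<in> words X"
  using inverse_words[of w X] inverse_words[of "winv w" X] winv_winv[of w] by (auto simp: winv_def)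

lemma words_Cons [simp]: "a # w \<in> words X \<longleftrightarrow> fst a \<in> X \<and> w \<in> words X"
  by (cases a) (auto simp: words_def)

lemma words_replicate [simp]: "replicate n a \<in> words X \<longleftrightarrow> n = 0 \<or> fst a \<in> X"
  by (induction n) auto

lemma fst_inv_letter [simp]: "fst (inv_letter a) = fst a"
  by (simp add: inv_letter_def)

lemma reduce_cancel: "reduce (u @ [a, inv_letter a] @ v) = reduce (u @ v)"
proof -
  have "reduce ([a, inv_letter a] @ v) = reduce v"
    using cons_red_cancel[OF reduced_reduce, of a v] by (simp add: reduce_def)
  then show ?thesis by (simp only: reduce_append)
qed

lemma reduce_cancel_words: "reduce (u @ w @ winv w @ v) = reduce (u @ v)"
proof (induction w arbitrary: u v)
  case (Cons a w)
  have "reduce (u @ (a # w) @ winv (a # w) @ v) = reduce ((u @ [a]) @ w @ winv w @ ([inv_letter a] @ v))"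
    by (simp add: winv_Cons)
  also have "\<dots> = reduce (u @ [a, inv_letter a] @ v)" unfolding Cons.IH by simp
  finally show ?case by (simp only: reduce_cancel)
qed simp

text \<open>Only the images of letters need inverses, so the target may be any monoid. The instances
  are permutations, Heisenberg triples and matrices.\<close>

locale word_hom =
  fixes mul :: "'b \<Rightarrow> 'b \<Rightarrow> 'b" (infixl "\<cdot>" 70) and e :: 'b and g :: "'a letter \<Rightarrow> 'b"
  assumes assoc: "(x \<cdot> y) \<cdot> z = x \<cdot> (y \<cdot> z)" and one_left: "e \<cdot> x = x" and one_right: "x \<cdot> e = x"
    and inverse: "g a \<cdot> g (inv_letter a) = e"
begin

definition ev :: "'a word \<Rightarrow> 'b" where
  "ev w = foldr (\<lambda>a. mul (g a)) w e"

lemma ev_Nil [simp]: "ev [] = e"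
  and ev_Cons: "ev (a # w) = g a \<cdot> ev w"
  by (simp_all add: ev_def)

lemma ev_append: "ev (u @ v) = ev u \<cdot> ev v"
  by (induction u) (simp_all add: ev_Cons assoc one_left)

lemma ev_cons_red: "ev (cons_red a w) = g a \<cdot> ev w"
  by (cases w) (auto simp: ev_Cons assoc[symmetric] inverse one_left)

lemma ev_reduce: "ev (reduce w) = ev w"
  by (induction w) (simp_all add: reduce_def ev_cons_red ev_Cons)

lemma ev_winv: "ev w \<cdot> ev (winv w) = e"
proof -
  have "ev (w @ winv w) = ev []"
    using reduce_cancel_words[of "[]" w "[]"] ev_reduce by (metis append.left_neutral append_Nil2)
  then show ?thesis by (simp add: ev_append)
qed

lemma ev_winv': "ev (winv w) \<cdot> ev w = e"
  using ev_winv[of "winv w"] by simp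

lemma ev_eqI:
  assumes "ev (u @ winv v) = e"
  shows "ev u = ev v"
  using assms ev_winv'[of v] by (metis assoc ev_append one_left one_right)

end

text \<open>The normal closure of the relators, generated by conjugations with single letters and
  right multiplications by relators, because these are the operations that single group letters will
  perform on the orbit of a translation.\<close>

inductive null_word :: "'a set \<Rightarrow> 'a word set \<Rightarrow> 'a word \<Rightarrow> bool" for S R where
  empty: "null_word S R []"
| conj: "null_word S R w \<Longrightarrow> fst a \<in> S \<Longrightarrow> null_word S R (a # w @ [inv_letter a])"
| rel: "null_word S R w \<Longrightarrow> r \<in> R \<Longrightarrow> null_word S R (w @ r)"
| rel_inv: "null_word S R w \<Longrightarrow> r \<in> R \<Longrightarrow> null_word S R (w @ winv r)"
| reduce: "null_word S R w \<Longrightarrow> reduce w = reduce v \<Longrightarrow> null_word S R v"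

lemma (in word_hom) ev_null_word:
  assumes "null_word S R w" "\<And>r. r \<in> R \<Longrightarrow> ev r = e"
  shows "ev w = e"
  using assms
proof induction
  case (conj w a)
  then show ?case by (simp add: ev_append ev_Cons one_left one_right inverse)
next
  case (rel_inv w r)
  then show ?case using ev_winv[of r] by (simp add: ev_append one_left)
next
  case (reduce w v)
  then show ?case by (metis ev_reduce)
qed (simp_all add: ev_append one_left)

lemma null_word_conj_word: "null_word S R w \<Longrightarrow> p \<in> words S \<Longrightarrow> null_word S R (p @ w @ winv p)"
proof (induction p)
  case (Cons a p)
  then have "null_word S R (a # (p @ w @ winv p) @ [inv_letter a])" by (intro null_word.conj) auto
  then show ?case by (simp add: winv_Cons)
qed simp

lemma null_word_rotate: "null_word S R (p @ q) \<Longrightarrow> q \<in> words S \<Longrightarrow> null_word S R (q @ p)"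
  using null_word_conj_word[of S R "p @ q" q] reduce_cancel_words[of "q @ p" q "[]"]
  by (metis append.assoc append_Nil2 null_word.reduce)

text \<open>Equality in the quotient group, stated as interchangeability inside null words; this
  makes it a congruence without forming the quotient.\<close>

definition word_eq :: "'a set \<Rightarrow> 'a word set \<Rightarrow> 'a word \<Rightarrow> 'a word \<Rightarrow> bool" where
  "word_eq S R u v \<longleftrightarrow>
     (\<forall>p\<in>words S. \<forall>q\<in>words S. null_word S R (p @ u @ q) \<longleftrightarrow> null_word S R (p @ v @ q))"

lemma word_eq_refl: "word_eq S R u u"
  by (simp add: word_eq_def)

lemma word_eq_sym: "word_eq S R u v \<Longrightarrow> word_eq S R v u"
  by (simp add: word_eq_def)

lemma word_eq_trans [trans]: "word_eq S R u v \<Longrightarrow> word_eq S R v w \<Longrightarrow> word_eq S R u w"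
  by (simp add: word_eq_def)

lemma word_eq_cong:
  "word_eq S R u v \<Longrightarrow> p \<in> words S \<Longrightarrow> q \<in> words S \<Longrightarrow> word_eq S R (p @ u @ q) (p @ v @ q)"
  unfolding word_eq_def by (metis append.assoc words_append)

lemma word_eq_reduce: "reduce u = reduce v \<Longrightarrow> word_eq S R u v"
  unfolding word_eq_def
  by (metis null_word.reduce reduce_append_left reduce_append_right)

lemma word_eq_rel:
  assumes "r \<in> R" "R \<subseteq> words S"
  shows "word_eq S R r []"
  unfolding word_eq_def
proof (intro ballI iffI)
  fix p q assume pq: "p \<in> words S" "q \<in> words S"
  {
    assume "null_word S R (p @ r @ q)"
    then have "null_word S R (q @ p @ r)" using null_word_rotate[of S R "p @ r" q] pq by simp
    then have "null_word S R ((q @ p @ r) @ winv r)" using assms null_word.rel_inv by blast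
    then have "null_word S R (q @ p)"
      by (rule null_word.reduce) (use reduce_cancel_words[of "q @ p" r "[]"] in simp)
    then show "null_word S R (p @ [] @ q)" using null_word_rotate[of S R q p] pq by simp
  next
    assume "null_word S R (p @ [] @ q)"
    then have "null_word S R (q @ p)" using null_word_rotate[of S R p q] pq by simp
    then have "null_word S R ((q @ p) @ r)" using assms null_word.rel by blast
    then show "null_word S R (p @ r @ q)" using null_word_rotate[of S R q "p @ r"] pq assms by auto
  }
qed

lemma word_eq_relD:
  assumes r: "u @ winv v \<in> R" "R \<subseteq> words S"
  shows "word_eq S R u v"
proof -
  have v: "v \<in> words S" using r by auto
  have "word_eq S R u (u @ winv v @ v)"
    by (rule word_eq_reduce) (use reduce_cancel_words[of u "winv v" "[]"] in simp)
  also have "word_eq S R (u @ winv v @ v) v"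
    using word_eq_cong[OF word_eq_rel[OF r], of "[]" v] v by simp
  finally show ?thesis .
qed

lemma null_word_eq:
  assumes "word_eq S R u v" "u \<in> words S" "v \<in> words S"
  shows "null_word S R (u @ winv v)"
proof -
  have "null_word S R (v @ winv v)"
    by (rule null_word.reduce[OF null_word.empty])
      (use reduce_cancel_words[of "[]" v "[]"] in simp)
  then show ?thesis using assms unfolding word_eq_def
    by (metis append_Nil winv_words words_Nil)
qed

lemma word_eq_left_cancel:
  assumes "word_eq S R (p @ u) (p @ v)" "p \<in> words S"
  shows "word_eq S R u v"
proof -
  have *: "reduce w = reduce (winv p @ p @ w)" for w
    using reduce_cancel_words[of "[]" "winv p" w] by simp
  have "word_eq S R u (winv p @ p @ u)" by (rule word_eq_reduce[OF *])
  also have "word_eq S R \<dots> (winv p @ p @ v)"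
    using word_eq_cong[OF assms(1), of "winv p" "[]"] assms(2) by simp
  also have "word_eq S R \<dots> v" by (rule word_eq_reduce[OF *[symmetric]])
  finally show ?thesis .
qed


section \<open>The group attached to an affine system\<close>

abbreviation xx where "xx b n \<equiv> replicate n (0::nat, b::bool)"

definition tw :: "nat \<Rightarrow> nat word" where
  "tw n = xx False n @ [(1, True)] @ xx True n"

abbreviation rr where "rr i \<equiv> [(3 + i::nat, True)]"
abbreviation kk where "kk \<equiv> [(2::nat, True)]"

text \<open>The generators \<open>0\<close>, \<open>1\<close>, \<open>2\<close>, \<open>3 + i\<close> are \<open>x\<close>, \<open>t\<close>, \<open>k\<close>, \<open>r\<^sub>i\<close>. Conjugation by \<open>r\<^sub>i\<close> maps \<open>x\<^sup>-\<^sup>n t x\<^sup>n\<close> to its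
  successor for \<open>n\<close> in the residue class \<open>i\<close> and fixes \<open>k\<close>, so that the set of all \<open>n\<close> for which \<open>k\<close>
  commutes with \<open>x\<^sup>-\<^sup>n t x\<^sup>n\<close> is closed under successors and predecessors.\<close>

definition affine_gens :: "nat \<Rightarrow> nat set" where
  "affine_gens m = {..<3 + m}"

definition affine_rels :: "nat \<Rightarrow> (nat \<Rightarrow> nat) \<Rightarrow> (nat \<Rightarrow> nat) \<Rightarrow> nat \<Rightarrow> nat word set" where
  "affine_rels m c d h = insert ((kk @ tw h) @ winv (tw h @ kk)) (\<Union>i\<in>{i. i < m \<and> c i \<noteq> 0}.
     {(rr i @ xx True m) @ winv (xx True (c i) @ rr i),
      (rr i @ tw i) @ winv (tw (d i) @ rr i),
      (kk @ rr i) @ winv (rr i @ kk)})"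

definition kw :: "nat \<Rightarrow> nat word" where
  "kw n = (kk @ tw n) @ winv (tw n @ kk)"

lemma finite_affine_rels: "finite (affine_rels m c d h)"
  by (simp add: affine_rels_def)

lemma tw_words [simp]: "tw n \<in> words (affine_gens m)"
  by (simp add: tw_def affine_gens_def)

lemma affine_gens_simps [simp]: "0 \<in> affine_gens m" "1 \<in> affine_gens m" "Suc 0 \<in> affine_gens m" "2 \<in> affine_gens m"
  "i < m \<Longrightarrow> 3 + i \<in> affine_gens m"
  by (auto simp: affine_gens_def)

lemma affine_rels_words: "affine_rels m c d h \<subseteq> words (affine_gens m)"
  by (auto simp: affine_rels_def)

lemma kw_words: "kw n \<in> words (affine_gens m)"
  by (simp add: kw_def)

context
  fixes m :: nat and c d :: "nat \<Rightarrow> nat" and h i :: nat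
  assumes i: "i < m" "c i \<noteq> 0"
begin

abbreviation eqw where "eqw \<equiv> word_eq (affine_gens m) (affine_rels m c d h)"

lemma eqw_pow: "eqw (rr i @ xx True (m * n)) (xx True (c i * n) @ rr i)"
proof (induction n)
  case 0
  then show ?case by (simp add: word_eq_refl)
next
  case (Suc n)
  have 1: "eqw (rr i @ xx True m) (xx True (c i) @ rr i)"
    by (rule word_eq_relD[OF _ affine_rels_words]) (use i in \<open>auto simp: affine_rels_def\<close>)
  have "eqw ([] @ (rr i @ xx True m) @ xx True (m * n)) ([] @ (xx True (c i) @ rr i) @ xx True (m * n))"
    by (rule word_eq_cong[OF 1]) simp_all
  also have "eqw \<dots> (xx True (c i) @ (xx True (c i * n) @ rr i) @ [])"
    using word_eq_cong[OF Suc.IH, of "xx True (c i)" "[]"] by simp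
  finally show ?case by (simp add: replicate_add)
qed

lemma reduce_xx: "reduce (p @ xx b n @ xx (\<not> b) n @ q) = reduce (p @ q)"
  using reduce_cancel_words[of p "xx b n" q] by (simp add: winv_def inv_letter_def)

lemma eqw_pow_inv: "eqw (rr i @ xx False (m * n)) (xx False (c i * n) @ rr i)"
proof -
  have "eqw (rr i @ xx False (m * n)) (xx False (c i * n) @ xx True (c i * n) @ rr i @ xx False (m * n))"
    by (rule word_eq_reduce) (use reduce_xx[of "[]" "c i * n" False "rr i @ xx False (m * n)"] in simp)
  also have "eqw \<dots> (xx False (c i * n) @ rr i @ xx True (m * n) @ xx False (m * n))"
    using word_eq_cong[OF word_eq_sym[OF eqw_pow], of "xx False (c i * n)" "xx False (m * n)"] by simp
  also have "eqw \<dots> (xx False (c i * n) @ rr i)"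
    by (rule word_eq_reduce) (use reduce_xx[of "xx False (c i * n) @ rr i" "m * n" True "[]"] in simp)
  finally show ?thesis .
qed

lemma eqw_tw: "eqw (rr i @ tw (m * n + i)) (tw (c i * n + d i) @ rr i)"
proof -
  have t: "tw (a + b) = xx False a @ tw b @ xx True a" for a b
    unfolding tw_def replicate_add[of a b] by (simp add: replicate_add[symmetric] add.commute)
  have 2: "eqw (rr i @ tw i) (tw (d i) @ rr i)"
    by (rule word_eq_relD[OF _ affine_rels_words]) (use i in \<open>auto simp: affine_rels_def\<close>)
  have "eqw (rr i @ tw (m * n + i)) (xx False (c i * n) @ rr i @ tw i @ xx True (m * n))"
    using word_eq_cong[OF eqw_pow_inv[of n], of "[]" "tw i @ xx True (m * n)"] unfolding t by simp
  also have "eqw \<dots> (xx False (c i * n) @ tw (d i) @ rr i @ xx True (m * n))"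
    using word_eq_cong[OF 2, of "xx False (c i * n)" "xx True (m * n)"] by simp
  also have "eqw \<dots> (xx False (c i * n) @ tw (d i) @ xx True (c i * n) @ rr i)"
    using word_eq_cong[OF eqw_pow[of n], of "xx False (c i * n) @ tw (d i)" "[]"] by simp
  finally show ?thesis unfolding t by simp
qed

text \<open>Conjugation by \<open>rr i\<close> fixes \<open>kk\<close> and carries
  \<open>tw (m * n + i)\<close> to \<open>tw (c i * n + d i)\<close>, so commutation with
  \<open>kk\<close> passes back from the latter to the former once \<open>rr i\<close> is
  cancelled.\<close>

lemma eqw_comm:
  assumes "eqw (kk @ tw (c i * n + d i)) (tw (c i * n + d i) @ kk)"
  shows "eqw (kk @ tw (m * n + i)) (tw (m * n + i) @ kk)"
proof -
  let ?a = "tw (m * n + i)" and ?b = "tw (c i * n + d i)"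
  have 3: "eqw (kk @ rr i) (rr i @ kk)"
    by (rule word_eq_relD[OF _ affine_rels_words]) (use i in \<open>auto simp: affine_rels_def\<close>)
  have "eqw (rr i @ kk @ ?a) (kk @ rr i @ ?a)"
    using word_eq_cong[OF word_eq_sym[OF 3], of "[]" ?a] by simp
  also have "eqw \<dots> (kk @ ?b @ rr i)"
    using word_eq_cong[OF eqw_tw[of n], of kk "[]"] by simp
  also have "eqw \<dots> (?b @ kk @ rr i)"
    using word_eq_cong[OF assms, of "[]" "rr i"] i by simp
  also have "eqw \<dots> (?b @ rr i @ kk)"
    using word_eq_cong[OF 3, of "?b" "[]"] by simp
  also have "eqw \<dots> (rr i @ ?a @ kk)"
    using word_eq_cong[OF word_eq_sym[OF eqw_tw[of n]], of "[]" kk] by simp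
  finally have "eqw (rr i @ (kk @ ?a)) (rr i @ (?a @ kk))" .
  then show ?thesis by (rule word_eq_left_cancel) (use i in simp)
qed

end

lemma null_word_kw:
  assumes sys: "affine_system m c d" and reach: "(affine_step m c d)\<^sup>*\<^sup>* x h"
  shows "null_word (affine_gens m) (affine_rels m c d h) (kw x)"
proof -
  have "word_eq (affine_gens m) (affine_rels m c d h) (kk @ tw x) (tw x @ kk)"
    using reach
  proof (induction rule: converse_rtranclp_induct)
    case base
    show ?case by (rule word_eq_relD[OF _ affine_rels_words]) (auto simp: affine_rels_def)
  next
    case (step x y)
    have "x mod m < m" using sys by (simp add: affine_system_def)
    then show ?case
      using eqw_comm[of "x mod m" m c d h "x div m"] step.IH step.hyps(1)
      by (simp add: affine_step_def mult.commute)
  qed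
  then show ?thesis unfolding kw_def by (rule null_word_eq) simp_all
qed

section \<open>A permutation action in which the remaining commutators survive\<close>

lemma word_hom_perm: "(\<And>s. bij (f s)) \<Longrightarrow>
    word_hom (\<circ>) id (\<lambda>(s, b). if b then f s else inv_into UNIV (f s))"
  by unfold_locales
    (auto simp: inv_letter_def bij_is_inj bij_is_surj surj_iff[symmetric] split: if_splits
      intro!: ext simp: surj_f_inv_f)

type_synonym line = "int set \<times> (int set \<times> int) list \<times> int"

text \<open>A point \<open>(T, j, n)\<close> is position \<open>n\<close> on the line indexed by \<open>(T, j)\<close>, marked iff \<open>n \<in> T\<close>.
  For modulus \<open>m\<close> the line splits into the \<open>m\<close> residue lines \<open>(T, j, b)\<close>, \<open>0 \<le> b < m\<close>. The index \<open>j\<close>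
  provides enough copies for all types of residue lines to occur equally often for every modulus.\<close>

definition res_lines :: "int \<Rightarrow> line set" where
  "res_lines m = {(T, j, b). 0 \<le> b \<and> b < m}"

definition res_type :: "int \<Rightarrow> line \<Rightarrow> int set" where
  "res_type m = (\<lambda>(T, j, b). {u. m * u + b \<in> T})"

lemma res_lines_inj:
  assumes "c > 0"
  obtains f where "inj_on f (res_lines m)" "f ` res_lines m \<subseteq> res_lines c"
    "\<And>l. res_type c (f l) = res_type m l"
proof (rule that)
  \<comment> \<open>A residue line of type \<open>U\<close> goes to residue 0 of a line marked
    exactly at the multiples \<open>c * u\<close> with \<open>u\<close> in \<open>U\<close>, which
    again has type \<open>U\<close>; the new index records \<open>T\<close> and \<open>b\<close> and
    so makes the map injective.\<close>
  let ?f = "\<lambda>l::line. case l of (T, j, b) \<Rightarrow> ((\<lambda>u. c * u) ` res_type m l, (T, b) # j, 0::int)"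
  show "inj_on ?f (res_lines m)" by (auto simp: inj_on_def)
  show "?f ` res_lines m \<subseteq> res_lines c" using assms by (auto simp: res_lines_def)
  show "res_type c (?f l) = res_type m l" for l using assms by (cases l) (auto simp: res_type_def)
qed

lemma bij_betw_adjust:
  assumes f: "bij_betw f A B" and "a \<in> A" "b \<in> B"
  obtains g where "bij_betw g A B" "g a = b"
proof (rule that)
  let ?s = "\<lambda>x. if x = f a then b else if x = b then f a else x"
  have fa: "f a \<in> B" using assms by (auto simp: bij_betw_def)
  have "bij_betw ?s B B" by (rule bij_betw_byWitness[where f' = ?s]) (use fa assms in auto)
  then show "bij_betw (?s \<circ> f) A B" using f by (rule bij_betw_trans[rotated])
  show "(?s \<circ> f) a = b" by simp
qed

text \<open>Within each type, injections in both directions give a bijection by Schroeder-Bernstein;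
  composition with a transposition prescribes its value at \<open>l\<close>.\<close>

lemma res_lines_bij:
  assumes m: "m > 0" and c: "c > 0" and l: "l \<in> res_lines m" "l' \<in> res_lines c" "res_type m l = res_type c l'"
  obtains f where "bij_betw f (res_lines m) (res_lines c)" "\<And>x. x \<in> res_lines m \<Longrightarrow> res_type c (f x) = res_type m x"
    "f l = l'"
proof -
  let ?A = "\<lambda>m U. {x \<in> res_lines m. res_type m x = U}"
  have "\<exists>h. bij_betw h (?A m U) (?A c U) \<and> (U = res_type m l \<longrightarrow> h l = l')" for U
  proof -
    obtain f where f: "inj_on f (res_lines m)" "f ` res_lines m \<subseteq> res_lines c"
      "\<And>l. res_type c (f l) = res_type m l" by (rule res_lines_inj[OF c]) (rule that; assumption)
    obtain g where g: "inj_on g (res_lines c)" "g ` res_lines c \<subseteq> res_lines m"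
      "\<And>l. res_type m (g l) = res_type c l" by (rule res_lines_inj[OF m]) (rule that; assumption)
    have "\<exists>h. bij_betw h (?A m U) (?A c U)"
      by (rule Schroeder_Bernstein[of f _ _ g]) (use f g in \<open>auto simp: inj_on_def\<close>)
    then obtain h where h: "bij_betw h (?A m U) (?A c U)" by blast
    show ?thesis
    proof (cases "U = res_type m l")
      case True
      then show ?thesis using bij_betw_adjust[OF h, of l l'] l by (metis (mono_tags, lifting) mem_Collect_eq)
    next
      case False
      then show ?thesis using h by blast
    qed
  qed
  then have ex: "\<forall>U. \<exists>h. bij_betw h (?A m U) (?A c U) \<and> (U = res_type m l \<longrightarrow> h l = l')" ..
  obtain h where h0: "\<forall>U. bij_betw (h U) (?A m U) (?A c U) \<and> (U = res_type m l \<longrightarrow> h U l = l')"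
    by (rule exE[OF choice[OF ex]])
  then have h: "\<And>U. bij_betw (h U) (?A m U) (?A c U)" "h (res_type m l) l = l'" by simp_all
  define f where "f = (\<lambda>x. h (res_type m x) x)"
  have f1: "f x \<in> res_lines c \<and> res_type c (f x) = res_type m x" if "x \<in> res_lines m" for x
    using h(1)[of "res_type m x"] that unfolding f_def bij_betw_def by blast
  show thesis
  proof (rule that[of f])
    show "bij_betw f (res_lines m) (res_lines c)"
      unfolding bij_betw_def
    proof (intro conjI subset_antisym subsetI)
      show "inj_on f (res_lines m)"
      proof (rule inj_onI)
        fix x y assume xy: "x \<in> res_lines m" "y \<in> res_lines m" "f x = f y"
        then have t: "res_type m x = res_type m y" using f1 by metis
        have "inj_on (h (res_type m x)) (?A m (res_type m x))" using h(1) by (simp add: bij_betw_def)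
        moreover have "x \<in> ?A m (res_type m x)" "y \<in> ?A m (res_type m x)" using xy t by simp_all
          moreover have "h (res_type m x) x = h (res_type m x) y" using xy(3) t by (simp add: f_def)
          ultimately show "x = y" by (blast dest: inj_onD)
      qed
      show "x \<in> res_lines c" if "x \<in> f ` res_lines m" for x using that f1 by blast
      show "y \<in> f ` res_lines m" if "y \<in> res_lines c" for y
      proof -
        have "y \<in> h (res_type c y) ` (?A m (res_type c y))"
          using h(1)[of "res_type c y"] that by (auto simp: bij_betw_def)
        then obtain x where "x \<in> res_lines m" "res_type m x = res_type c y" "y = h (res_type c y) x" by blast
        then show ?thesis unfolding f_def by (intro image_eqI[of _ _ x]) simp_all
      qed
    qed
    show "f l = l'" using h(2) by (simp add: f_def)
  qed (use f1 in blast)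
qed

definition marked :: "line \<Rightarrow> bool" where
  "marked = (\<lambda>(T, j, n). n \<in> T)"

definition shift :: "int \<Rightarrow> line \<Rightarrow> line" where
  "shift k = (\<lambda>(T, j, n). (T, j, n + k))"

lemma shift_shift [simp]: "shift a (shift b q) = shift (a + b) q"
  by (cases q) (simp add: shift_def)

lemma shift_0 [simp]: "shift 0 q = q"
  by (cases q) (simp add: shift_def)

lemma bij_shift: "bij (shift k)"
  by (rule bij_betw_byWitness[where f' = "shift (- k)"]) auto

text \<open>A type-preserving bijection of residue lines, extended along quotients, turns shift by
  \<open>m\<close> into shift by \<open>c\<close> and keeps the marks. The hypothesis on
  \<open>H\<close> says that the residue lines of \<open>a\<close> and \<open>b\<close> on the line
  of \<open>H\<close> have equal types, so the former can be sent to the latter.\<close>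

lemma rescaling_exists:
  fixes m c a b :: int
  assumes mc: "m > 0" "c > 0" and a: "0 \<le> a" "a < m" and b: "0 \<le> b" "b < c"
    and H: "\<And>u. m * u + a \<in> H \<longleftrightarrow> c * u + b \<in> H"
  obtains s where "bij s" "\<And>q. s (shift m q) = shift c (s q)"
    "\<And>q. marked (shift b (s q)) \<longleftrightarrow> marked (shift a q)" "s (H, [], 0) = (H, [], 0)"
proof -
  have "(H, [], a) \<in> res_lines m" "(H, [], b) \<in> res_lines c"
    "res_type m (H, [], a) = res_type c (H, [], b)"
    using a b H by (auto simp: res_lines_def res_type_def)
  then obtain f where f: "bij_betw f (res_lines m) (res_lines c)"
    "\<And>x. x \<in> res_lines m \<Longrightarrow> res_type c (f x) = res_type m x" "f (H, [], a) = (H, [], b)"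
    by (rule res_lines_bij[OF mc]) (rule that; assumption)
  define s where "s = (\<lambda>(T, j, n). shift (c * (n div m)) (f (T, j, n mod m)))"
  have rl: "(T, j, n mod m) \<in> res_lines m" for T j n using mc by (simp add: res_lines_def)
  have s1: "s (shift m q) = shift c (s q)" for q
    using mc by (cases q) (simp add: s_def shift_def[of m] algebra_simps)
  have s2: "marked (s q) \<longleftrightarrow> marked q" for q
  proof -
    obtain T j n where q: "q = (T, j, n)" by (cases q)
    obtain T' j' b' where f': "f (T, j, n mod m) = (T', j', b')" by (metis prod_cases3)
    have "n div m \<in> res_type c (T', j', b') \<longleftrightarrow> n div m \<in> res_type m (T, j, n mod m)"
      using f(2)[OF rl] f' by metis
    then show ?thesis by (simp add: q s_def f' marked_def shift_def res_type_def add.commute)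
  qed
  have "bij s"
  proof -
    define g where "g = inv_into (res_lines m) f"
    have g: "g y \<in> res_lines m" "f (g y) = y" if "y \<in> res_lines c" for y
      using f(1) that by (auto simp: g_def bij_betw_def inv_into_into f_inv_into_f)
    have gf: "g (f x) = x" if "x \<in> res_lines m" for x
      using f(1) that by (simp add: g_def bij_betw_def)
    define t where "t = (\<lambda>(T, j, n). shift (m * (n div c)) (g (T, j, n mod c)))"
    have "t (s q) = q" for q
    proof -
      obtain T j n where q: "q = (T, j, n)" by (cases q)
      obtain T' j' b' where f': "f (T, j, n mod m) = (T', j', b')" by (metis prod_cases3)
      have "f (T, j, n mod m) \<in> res_lines c" using f(1) rl by (auto simp: bij_betw_def)
      then have b': "0 \<le> b'" "b' < c" by (auto simp: f' res_lines_def)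
      have "(b' + c * (n div m)) div c = n div m" "(b' + c * (n div m)) mod c = b'" using b' by auto
      then have "t (s q) = shift (m * (n div m)) (g (f (T, j, n mod m)))"
        by (simp add: q s_def t_def f' shift_def[of "c * _"])
      also have "\<dots> = q" unfolding gf[OF rl] by (simp add: q shift_def)
      finally show ?thesis .
    qed
    moreover have "s (t q) = q" for q
    proof -
      obtain T j n where q: "q = (T, j, n)" by (cases q)
      have r: "(T, j, n mod c) \<in> res_lines c" using mc by (simp add: res_lines_def)
      obtain T' j' b' where g': "g (T, j, n mod c) = (T', j', b')" by (metis prod_cases3)
      then have b': "0 \<le> b'" "b' < m" using g(1)[OF r] by (auto simp: res_lines_def)
      have "(b' + m * (n div c)) div m = n div c" "(b' + m * (n div c)) mod m = b'" using b' by auto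
      then have "s (t q) = shift (c * (n div c)) (f (g (T, j, n mod c)))"
        by (simp add: q s_def t_def g' shift_def[of "m * _"])
      also have "\<dots> = q" unfolding g(2)[OF r] by (simp add: q shift_def)
      finally show ?thesis .
    qed
    ultimately show ?thesis by (intro o_bij[of t]) auto
  qed
  have s3: "s (H, [], a) = (H, [], b)" using f(3) a by (simp add: s_def)
  show thesis
  \<comment> \<open>The two shifts move the distinguished residues \<open>a\<close> and
    \<open>b\<close> to position 0, so that the base point becomes fixed.\<close>
  proof (rule that[of "\<lambda>q. shift (- b) (s (shift a q))"])
    have "bij (shift (- b) \<circ> s \<circ> shift a)" using \<open>bij s\<close> bij_shift by (intro bij_comp)
    then show "bij (\<lambda>q. shift (- b) (s (shift a q)))" by (simp add: comp_def)
    show "shift (- b) (s (shift a (shift m q))) = shift c (shift (- b) (s (shift a q)))" for q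
      using s1[of "shift a q"] by (simp add: add.commute)
    show "marked (shift b (shift (- b) (s (shift a q)))) \<longleftrightarrow> marked (shift a q)" for q
      by (simp add: s2)
    show "shift (- b) (s (shift a (H, [], 0))) = (H, [], 0)"
      by (simp add: shift_def[of a] s3) (simp add: shift_def)
  qed
qed

type_synonym point = "line \<times> bool \<times> bool"

text \<open>Conjugated by \<open>n\<close> shifts, \<open>t_act\<close> changes the first bit at the
  base point iff the position \<open>n\<close> steps further is unmarked, and \<open>k_act\<close>
  reads this bit there. The two therefore commute iff that position is marked.\<close>

definition t_act :: "point \<Rightarrow> point" where
  "t_act = (\<lambda>(q, e, e'). (q, if marked q then e else \<not> e, e'))"

definition k_act :: "line \<Rightarrow> point \<Rightarrow> point" where
  "k_act q0 = (\<lambda>(q, e, e'). (q, e, if q = q0 \<and> \<not> e then \<not> e' else e'))"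

definition lift :: "(line \<Rightarrow> line) \<Rightarrow> point \<Rightarrow> point" where
  "lift f = (\<lambda>(q, r). (f q, r))"

lemma bij_t_act: "bij t_act"
  by (rule involuntory_imp_bij) (auto simp: t_act_def split: if_splits)

lemma bij_k_act: "bij (k_act q)"
  by (rule involuntory_imp_bij) (auto simp: k_act_def split: if_splits)

lemma bij_lift: "bij f \<Longrightarrow> bij (lift f)"
  by (rule bij_betw_byWitness[where f' = "lift (inv_into UNIV f)"])
    (auto simp: lift_def bij_is_inj bij_is_surj surj_f_inv_f)

lemma lift_shift: "lift (shift a) \<circ> lift (shift b) = lift (shift (a + b))" "lift (shift 0) = id"
  by (auto simp: lift_def fun_eq_iff)

text \<open>\<open>H\<close> consists of the numbers that reach \<open>h\<close>. Since the branches
  preserve \<open>H\<close>, the letters \<open>rr i\<close> can act by rescalings and all relators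
  act trivially; a trivial action of \<open>kw x\<close> then forces \<open>int x\<close> into
  \<open>H\<close>.\<close>

lemma kw_null_imp:
  assumes sys: "affine_system m c d" and h: "c (h mod m) = 0"
    and null: "null_word (affine_gens m) (affine_rels m c d h) (kw x)"
  shows "(affine_step m c d)\<^sup>*\<^sup>* x h"
proof -
  define H where "H = {int y |y. (affine_step m c d)\<^sup>*\<^sup>* y h}"
  have inH: "int y \<in> H \<longleftrightarrow> (affine_step m c d)\<^sup>*\<^sup>* y h" for y by (auto simp: H_def)
  have m: "m > 0" using sys by (simp add: affine_system_def)
  have Hinv: "int m * u + int i \<in> H \<longleftrightarrow> int (c i) * u + int (d i) \<in> H" if i: "i < m" "c i \<noteq> 0" for i u
  proof (cases "u \<ge> 0")
    case True
    then obtain n where u: "u = int n" using nonneg_int_cases by blast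
    have "(affine_step m c d)\<^sup>*\<^sup>* (m * n + i) h \<longleftrightarrow> (affine_step m c d)\<^sup>*\<^sup>* (c i * n + d i) h"
    proof -
      have st: "affine_step m c d (m * n + i) z \<longleftrightarrow> z = c i * n + d i" for z
        using i by (simp add: affine_step_def)
      \<comment> \<open>As \<open>h\<close> is halting, a number in a non-halting class differs from
        \<open>h\<close> and can reach it only through its unique successor.\<close>
      have "m * n + i \<noteq> h" using h i by auto
      then show ?thesis by (metis st converse_rtranclp_into_rtranclp converse_rtranclpE)
    qed
    then show ?thesis using inH[of "m * n + i"] inH[of "c i * n + d i"] by (simp add: u)
  next
    case False
    \<comment> \<open>For a negative quotient both sides of the branch are negative, by
      \<open>i < m\<close> and \<open>d i < c i\<close>, whereas \<open>H\<close> has no negative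
      elements.\<close>
    have "int m * u + int i < 0"
    proof -
      have "int m * u \<le> int m * (- 1)" using False by (intro mult_left_mono) auto
      then show ?thesis using i by simp
    qed
    moreover have "int (c i) * u + int (d i) < 0"
    proof -
      have "d i < c i" using sys i by (auto simp: affine_system_def)
      moreover have "int (c i) * u \<le> int (c i) * (- 1)" using False by (intro mult_left_mono) auto
      ultimately show ?thesis by simp
    qed
    ultimately show ?thesis unfolding H_def by auto
  qed
  have "\<exists>s. bij s \<and> (i < m \<longrightarrow> c i \<noteq> 0 \<longrightarrow> (\<forall>q. s (shift (int m) q) = shift (int (c i)) (s q)) \<and>
      (\<forall>q. marked (shift (int (d i)) (s q)) \<longleftrightarrow> marked (shift (int i) q)) \<and> s (H, [], 0) = (H, [], 0))" for i
  proof (cases "i < m \<and> c i \<noteq> 0")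
    case True
    then have di: "d i < c i" using sys by (auto simp: affine_system_def)
    obtain s where "bij s" "\<And>q. s (shift (int m) q) = shift (int (c i)) (s q)"
      "\<And>q. marked (shift (int (d i)) (s q)) \<longleftrightarrow> marked (shift (int i) q)" "s (H, [], 0) = (H, [], 0)"
    proof (rule rescaling_exists[of "int m" "int (c i)" "int i" "int (d i)" H])
      show "int m * u + int i \<in> H \<longleftrightarrow> int (c i) * u + int (d i) \<in> H" for u
        using Hinv True by blast
    qed (use True di m in auto)
    then show ?thesis by blast
  next
    case False
    then show ?thesis using bij_id by blast
  qed
  then have ex: "\<forall>i. \<exists>s. bij s \<and> (i < m \<longrightarrow> c i \<noteq> 0 \<longrightarrow> (\<forall>q. s (shift (int m) q) = shift (int (c i)) (s q)) \<and>
      (\<forall>q. marked (shift (int (d i)) (s q)) \<longleftrightarrow> marked (shift (int i) q)) \<and> s (H, [], 0) = (H, [], 0))" ..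
  obtain s where s0: "\<forall>i. bij (s i) \<and> (i < m \<longrightarrow> c i \<noteq> 0 \<longrightarrow> (\<forall>q. s i (shift (int m) q) = shift (int (c i)) (s i q)) \<and>
      (\<forall>q. marked (shift (int (d i)) (s i q)) \<longleftrightarrow> marked (shift (int i) q)) \<and> s i (H, [], 0) = (H, [], 0))"
    by (rule exE[OF choice[OF ex]])
  have s: "\<And>i. bij (s i)"
    "\<And>i q. i < m \<Longrightarrow> c i \<noteq> 0 \<Longrightarrow> s i (shift (int m) q) = shift (int (c i)) (s i q)"
    "\<And>i q. i < m \<Longrightarrow> c i \<noteq> 0 \<Longrightarrow> marked (shift (int (d i)) (s i q)) \<longleftrightarrow> marked (shift (int i) q)"
    "\<And>i. i < m \<Longrightarrow> c i \<noteq> 0 \<Longrightarrow> s i (H, [], 0) = (H, [], 0)"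
    using s0 by blast+
  let ?q = "(H, [], 0) :: line"
  define f where "f = (\<lambda>i::nat. if i = 0 then lift (shift 1) else if i = 1 then t_act
    else if i = 2 then k_act ?q else lift (s (i - 3)))"
  have bf: "bij (f i)" for i by (simp add: f_def bij_lift bij_shift bij_t_act bij_k_act s(1))
  interpret word_hom "(\<circ>)" id "\<lambda>(s, b). if b then f s else inv_into UNIV (f s)"
    by (rule word_hom_perm) (rule bf)
  have invf0: "inv_into UNIV (f 0) = lift (shift (- 1))"
    by (rule inv_equality) (auto simp: f_def lift_def)
  have f0: "f 0 = lift (shift 1)" by (simp add: f_def)
  have xp: "ev (xx True n) = lift (shift (int n))" for n
  proof (induction n)
    case 0
    show ?case by (simp only: replicate_0 ev_Nil of_nat_0 lift_shift(2))
  next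
    case (Suc n)
    show ?case
      by (simp only: replicate_Suc ev_Cons Suc.IH prod.case if_True f0 lift_shift(1) of_nat_Suc)
  qed
  have xn: "ev (xx False n) = lift (shift (- int n))" for n
  proof (induction n)
    case 0
    show ?case by (simp only: replicate_0 ev_Nil of_nat_0 minus_zero lift_shift(2))
  next
    case (Suc n)
    show ?case
      by (simp only: replicate_Suc ev_Cons Suc.IH prod.case if_False invf0 lift_shift(1) of_nat_Suc
          minus_add_distrib HOL.simp_thms)
  qed
  have ev1: "ev [(i, True)] = f i" for i
    by (simp only: ev_Cons ev_Nil prod.case if_True comp_id)
  have tw: "ev (tw n) (q, e, e') = (q, if marked (shift (int n) q) then e else \<not> e, e')" for n q e e'
    unfolding tw_def ev_append xp xn ev1 by (simp add: f_def lift_def t_act_def)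
  have rr: "ev (rr i) (q, e, e') = (s i q, e, e')" for i q e e'
    unfolding ev1 by (simp add: f_def lift_def)
  have xp': "ev (xx True n) (q, e, e') = (shift (int n) q, e, e')" for n q e e'
    unfolding xp by (simp add: lift_def)
  have kk: "ev kk (q, e, e') = (q, e, if q = ?q \<and> \<not> e then \<not> e' else e')" for q e e'
    unfolding ev1 by (simp add: f_def k_act_def)
  have mk: "marked (shift (int n) ?q) \<longleftrightarrow> int n \<in> H" for n by (simp add: marked_def shift_def)
  have relI: "ev (u @ winv v) = id" if "\<And>p. ev u p = ev v p" for u v
  proof -
    have "ev u = ev v" using that by (rule ext)
    then show ?thesis by (simp only: ev_append ev_winv)
  qed
  have "ev r = id" if "r \<in> affine_rels m c d h" for r
  proof -
    have h': "int h \<in> H" unfolding inH by simp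
    consider "r = (kk @ tw h) @ winv (tw h @ kk)" |
      i where "i < m" "c i \<noteq> 0" "r = (rr i @ xx True m) @ winv (xx True (c i) @ rr i)" |
      i where "i < m" "c i \<noteq> 0" "r = (rr i @ tw i) @ winv (tw (d i) @ rr i)" |
      i where "i < m" "c i \<noteq> 0" "r = (kk @ rr i) @ winv (rr i @ kk)"
      using \<open>r \<in> affine_rels m c d h\<close> unfolding affine_rels_def by blast
    then show ?thesis
    proof cases
      case 1
      show ?thesis unfolding 1
      proof (rule relI)
        fix p :: point obtain q e e' where p: "p = (q, e, e')" by (metis prod_cases3)
        show "ev (kk @ tw h) p = ev (tw h @ kk) p"
          unfolding ev_append p comp_apply tw kk using mk[of h] h' by auto
      qed
    next
      case (2 i)
      show ?thesis unfolding 2(3)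
      proof (rule relI)
        fix p :: point obtain q e e' where p: "p = (q, e, e')" by (metis prod_cases3)
        show "ev (rr i @ xx True m) p = ev (xx True (c i) @ rr i) p"
          unfolding ev_append p comp_apply xp' rr s(2)[OF 2(1,2)] ..
      qed
    next
      case (3 i)
      show ?thesis unfolding 3(3)
      proof (rule relI)
        fix p :: point obtain q e e' where p: "p = (q, e, e')" by (metis prod_cases3)
        show "ev (rr i @ tw i) p = ev (tw (d i) @ rr i) p"
          unfolding ev_append p comp_apply rr tw using s(3)[OF 3(1,2)] by simp
      qed
    next
      case (4 i)
      have "s i q = ?q \<longleftrightarrow> q = ?q" for q
        using s(4)[OF 4(1,2)] s(1)[of i] by (metis bij_is_inj injD)
      show ?thesis unfolding 4(3)
      proof (rule relI)
        fix p :: point obtain q e e' where p: "p = (q, e, e')" by (metis prod_cases3)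
        show "ev (kk @ rr i) p = ev (rr i @ kk) p"
          unfolding ev_append p comp_apply rr kk using \<open>\<And>q. s i q = ?q \<longleftrightarrow> q = ?q\<close> by simp
      qed
    qed
  qed
  then have "ev (kw x) = id" using ev_null_word[OF null] by blast
  then have eq: "ev (kk @ tw x) = ev (tw x @ kk)" unfolding kw_def by (rule ev_eqI)
  have "int x \<in> H"
  proof (rule ccontr)
    assume "int x \<notin> H"
    then have "ev (kk @ tw x) (?q, False, False) \<noteq> ev (tw x @ kk) (?q, False, False)"
      unfolding ev_append comp_apply tw kk using mk[of x] by simp
    then show False using eq by simp
  qed
  then show ?thesis unfolding inH .
qed

theorem null_word_kw_iff:
  assumes "affine_system m c d" "c (h mod m) = 0"
  shows "null_word (affine_gens m) (affine_rels m c d h) (kw x) \<longleftrightarrow> (affine_step m c d)\<^sup>*\<^sup>* x h"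
  using null_word_kw kw_null_imp assms by blast

section \<open>Quadratic fillings in contracting extensions\<close>

text \<open>\<open>refl\<close> holds for every \<open>n\<close>, so the index is an upper bound for
  the number of replacements.\<close>

inductive der :: "('l list \<Rightarrow> 'l list \<Rightarrow> bool) \<Rightarrow> nat \<Rightarrow> 'l list \<Rightarrow> 'l list \<Rightarrow> bool" for R where
  refl: "der R n u u"
| step: "der R n u (p @ l @ q) \<Longrightarrow> R l r \<or> R r l \<Longrightarrow> der R (Suc n) u (p @ r @ q)"

lemma der_mono: "der R n u w \<Longrightarrow> n \<le> m \<Longrightarrow> der R m u w"
proof (induction arbitrary: m rule: der.induct)
  case (step n u p l q r)
  then obtain k where "m = Suc k" "n \<le> k" by (cases m) auto
  then show ?case using step der.step by blast
qed (rule der.refl)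

lemma der_trans: "der R m v w \<Longrightarrow> der R n u v \<Longrightarrow> der R (n + m) u w"
proof (induction rule: der.induct)
  case (refl m v)
  then show ?case by (rule der_mono) simp
next
  case (step m v p l q r)
  then have "der R (Suc (n + m)) u (p @ r @ q)" using der.step by blast
  then show ?case by simp
qed

lemma der_trans_le: "der R n u v \<Longrightarrow> der R m v w \<Longrightarrow> n + m \<le> k \<Longrightarrow> der R k u w"
  using der_trans der_mono by blast

lemma der_base: "R l r \<or> R r l \<Longrightarrow> der R 1 (p @ l @ q) (p @ r @ q)"
  using der.step[OF der.refl[of R 0]] by auto

lemma der_ctx: "der R n u w \<Longrightarrow> der R n (p @ u @ q) (p @ w @ q)"
proof (induction rule: der.induct)
  case (step n u p' l q' r)
  then have "der R n (p @ u @ q) ((p @ p') @ l @ (q' @ q))" by simp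
  then have "der R (Suc n) (p @ u @ q) ((p @ p') @ r @ (q' @ q))" using step.hyps(2) by (rule der.step)
  then show ?case by simp
qed (rule der.refl)

lemma der_sym: "der R n u w \<Longrightarrow> der R n w u"
proof (induction rule: der.induct)
  case (step n u p l q r)
  have "der R 1 (p @ r @ q) (p @ l @ q)" using step.hyps(2) by (intro der_base) blast
  then show ?case using step.IH der_trans_le[of R 1 _ _ n u "Suc n"] by simp
qed (rule der.refl)

lemma der_append: "der R n u u' \<Longrightarrow> der R m w w' \<Longrightarrow> n + m \<le> k \<Longrightarrow> der R k (u @ w) (u' @ w')"
  using der_trans_le[of R n "u @ w" "u' @ w" m "u' @ w'" k] der_ctx[of R n u u' "[]" w] der_ctx[of R m w w' u' "[]"]
  by simp

datatype ('q, 'a) slet = Q "'q letter" | T 'a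

fun qpart :: "('q, 'a) slet list \<Rightarrow> 'q letter list" where
  "qpart [] = []"
| "qpart (Q q # w) = q # qpart w"
| "qpart (T a # w) = qpart w"

lemma qpart_append [simp]: "qpart (u @ w) = qpart u @ qpart w"
  by (induction u rule: qpart.induct) auto

lemma length_qpart: "length (qpart w) \<le> length w"
  by (induction w rule: qpart.induct) auto

definition expo :: "'q \<Rightarrow> 'q letter list \<Rightarrow> int" where
  "expo v qs = (\<Sum>q\<leftarrow>qs. if fst q = v then (if snd q then 1 else -1) else 0)"

lemma expo_simps [simp]: "expo v [] = 0"
  "expo v (q # qs) = (if fst q = v then (if snd q then 1 else -1) else 0) + expo v qs"
  "expo v (us @ qs) = expo v us + expo v qs"
  by (simp_all add: expo_def)

lemma expo_bound: "\<bar>expo v qs\<bar> \<le> int (length qs)"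
  by (induction qs) auto

lemma expo_filter: "v \<noteq> v' \<Longrightarrow> expo v (filter (\<lambda>q. fst q \<noteq> v') qs) = expo v qs"
  by (induction qs) auto

text \<open>\<open>U c\<close> is the subgroup of elements of size at most \<open>c\<close>; the group splits into three
  components, and \<open>v j\<close> contracts the two components other than the \<open>j\<close>-th. In the words below
  \<open>T a\<close> is the translation by \<open>a\<close>, and \<open>Q q\<close> acts on translations by \<open>act q\<close>.\<close>

locale tame =
  fixes act :: "'q letter \<Rightarrow> 'a::ab_group_add \<Rightarrow> 'a" and U :: "nat \<Rightarrow> 'a set"
    and pi :: "nat \<Rightarrow> 'a \<Rightarrow> 'a" and Y :: "'q set" and v :: "nat \<Rightarrow> 'q" and \<kappa> :: nat
  assumes act_add: "act q (a + b) = act q a + act q b"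
    and act_inv: "act q (act (inv_letter q) a) = a"
    and U_add: "a \<in> U c \<Longrightarrow> b \<in> U c \<Longrightarrow> a + b \<in> U c"
    and U_0: "0 \<in> U c"
    and U_mono: "c \<le> c' \<Longrightarrow> U c \<subseteq> U c'"
    and act_U: "fst q \<in> Y \<Longrightarrow> a \<in> U c \<Longrightarrow> act q a \<in> U (c + \<kappa>)"
    and pi_add: "pi i (a + b) = pi i a + pi i b"
    and pi_U: "a \<in> U c \<Longrightarrow> pi i a \<in> U c"
    and pi_sum: "pi 0 a + pi 1 a + pi 2 a = a"
    and pi_pi: "i < 3 \<Longrightarrow> j < 3 \<Longrightarrow> i \<noteq> j \<Longrightarrow> pi i (pi j a) = 0"
    and pi_act: "pi i (act q a) = act q (pi i a)"
    and v_Y: "j < 3 \<Longrightarrow> v j \<in> Y"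
    and v_inj: "i < 3 \<Longrightarrow> j < 3 \<Longrightarrow> v i = v j \<Longrightarrow> i = j"
    and v_comm: "j < 3 \<Longrightarrow> act (v j, s) (act q a) = act q (act (v j, s) a)"
    and v_contract: "j < 3 \<Longrightarrow> pi j a = 0 \<Longrightarrow> a \<in> U c \<Longrightarrow> act (v j, True) a \<in> U (c - 1)"
begin

lemma act_0 [simp]: "act q 0 = 0"
  using act_add[of q 0 0] by simp

lemma pi_0 [simp]: "pi i 0 = 0"
  using pi_add[of i 0 0] by simp

text \<open>Translations range over all of \<open>U \<kappa>\<close> and not just over a lattice;
  their bounded size is what leaves finitely many relators after rounding.\<close>

inductive mv :: "('q, 'a) slet list \<Rightarrow> ('q, 'a) slet list \<Rightarrow> bool" where
  mT: "a \<in> U \<kappa> \<Longrightarrow> b \<in> U \<kappa> \<Longrightarrow> mv [T a, T b] [T (a + b)]"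
| m0: "mv [T 0] []"
| mC: "fst q \<in> Y \<Longrightarrow> a \<in> U \<kappa> \<Longrightarrow> act q a \<in> U \<kappa> \<Longrightarrow> mv [Q q, T a] [T (act q a), Q q]"
| mI: "fst q \<in> Y \<Longrightarrow> mv [Q q, Q (inv_letter q)] []"
| mV: "j < 3 \<Longrightarrow> fst q \<in> Y \<Longrightarrow> mv [Q (v j, b), Q q] [Q q, Q (v j, b)]"

abbreviation dm where "dm \<equiv> der mv"

lemma dm_refl: "dm n u u"
  by (rule der.refl)

lemma cancel: "fst q \<in> Y \<Longrightarrow> dm n (replicate n (Q q) @ replicate n (Q (inv_letter q))) []"
proof (induction n)
  case (Suc n)
  have "replicate (Suc n) (Q q) @ replicate (Suc n) (Q (inv_letter q)) =
      replicate n (Q q) @ [Q q, Q (inv_letter q)] @ replicate n (Q (inv_letter q))"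
    by (simp add: replicate_app_Cons_same)
  moreover have "dm 1 (replicate n (Q q) @ [Q q, Q (inv_letter q)] @ replicate n (Q (inv_letter q)))
      (replicate n (Q q) @ [] @ replicate n (Q (inv_letter q)))"
    by (rule der_base) (use Suc.prems mI in blast)
  ultimately show ?case
    by (metis Suc.IH Suc.prems append.left_neutral der_trans_le order_refl plus_1_eq_Suc)
qed (simp add: dm_refl)

lemma commute1:
  assumes "j < 3" "fst q \<in> Y"
  shows "dm n (Q q # replicate n (Q (v j, b))) (replicate n (Q (v j, b)) @ [Q q])"
proof (induction n)
  case (Suc n)
  have "dm 1 ([] @ [Q q, Q (v j, b)] @ replicate n (Q (v j, b))) ([] @ [Q (v j, b), Q q] @ replicate n (Q (v j, b)))"
    by (rule der_base) (use assms mV in blast)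
  moreover have "dm n ([Q (v j, b)] @ (Q q # replicate n (Q (v j, b))) @ [])
      ([Q (v j, b)] @ (replicate n (Q (v j, b)) @ [Q q]) @ [])"
    by (rule der_ctx[OF Suc.IH])
  ultimately show ?case using der_trans_le[of mv 1 _ _ n _ "Suc n"] by simp
qed (simp add: dm_refl)

lemma commute:
  assumes "j < 3" "fst q \<in> Y"
  shows "dm (n * k) (replicate k (Q q) @ replicate n (Q (v j, b))) (replicate n (Q (v j, b)) @ replicate k (Q q))"
proof (induction k)
  case (Suc k)
  have "dm n (replicate k (Q q) @ (Q q # replicate n (Q (v j, b))) @ [])
      (replicate k (Q q) @ (replicate n (Q (v j, b)) @ [Q q]) @ [])"
    by (rule der_ctx[OF commute1[OF assms]])
  moreover have "dm (n * k) ([] @ (replicate k (Q q) @ replicate n (Q (v j, b))) @ [Q q])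
     ([] @ (replicate n (Q (v j, b)) @ replicate k (Q q)) @ [Q q])"
    by (rule der_ctx[OF Suc.IH])
  ultimately show ?case using der_trans_le[of mv n _ _ "n * k" _ "n * Suc k"]
    by (simp add: replicate_append_same replicate_app_Cons_same)
qed (simp add: dm_refl)

abbreviation V where "V j n \<equiv> act (v j, True) ^^ n"

lemma V_add: "V j n (a + b) = V j n a + V j n b"
  by (induction n) (simp_all add: act_add)

lemma V_0 [simp]: "V j n 0 = 0"
  by (induction n) simp_all

lemma V_act: "j < 3 \<Longrightarrow> V j n (act q a) = act q (V j n a)"
  by (induction n) (simp_all add: v_comm)

lemma V_V: "j < 3 \<Longrightarrow> V j n (V k m a) = V k m (V j n a)"
  by (induction m) (simp_all add: V_act)

lemma V_pi: "pi i (V j n a) = V j n (pi i a)"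
  by (induction n) (simp_all add: pi_act)

lemma V_contract: "j < 3 \<Longrightarrow> pi j a = 0 \<Longrightarrow> a \<in> U c \<Longrightarrow> V j n a \<in> U (c - n)"
proof (induction n)
  case (Suc n)
  then show ?case using v_contract[of j "V j n a" "c - n"] by (simp add: V_pi)
qed simp

text \<open>The translation by \<open>a\<close>, written as a conjugate of its contracted image. If
  \<open>v j\<close> contracts \<open>a\<close> and the size of \<open>a\<close> is at most
  \<open>D\<close>, the middle letter is small, and the word has length
  \<open>2 * D + 1\<close>.\<close>

definition sig :: "nat \<Rightarrow> nat \<Rightarrow> 'a \<Rightarrow> ('q, 'a) slet list" where
  "sig j D a = replicate D (Q (v j, False)) @ [T (V j D a)] @ replicate D (Q (v j, True))"

lemma sig_0: "sig j 0 a = [T a]"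
  by (simp add: sig_def)

lemma grow: "j < 3 \<Longrightarrow> a \<in> U \<kappa> \<Longrightarrow> act (v j, True) a \<in> U \<kappa> \<Longrightarrow>
   dm 2 [T a] [Q (v j, False), T (act (v j, True) a), Q (v j, True)]"
proof -
  assume j: "j < 3" and a: "a \<in> U \<kappa>" "act (v j, True) a \<in> U \<kappa>"
  have "mv [Q (v j, False), Q (v j, True)] []"
    using mI[of "(v j, False)"] v_Y[OF j] by (simp add: inv_letter_def)
  then have "dm 1 ([] @ [] @ [T a]) ([] @ [Q (v j, False), Q (v j, True)] @ [T a])"
    by (intro der_base) blast
  moreover have "mv [Q (v j, True), T a] [T (act (v j, True) a), Q (v j, True)]"
    using v_Y[OF j] a by (intro mC) auto
  then have "dm 1 ([Q (v j, False)] @ [Q (v j, True), T a] @ [])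
      ([Q (v j, False)] @ [T (act (v j, True) a), Q (v j, True)] @ [])"
    by (intro der_base) blast
  ultimately show ?thesis using der_trans_le[of mv 1 "[T a]" _ 1 _ 2] by simp
qed

lemma sig_Suc:
  assumes "j < 3" "V j D a \<in> U \<kappa>" "V j (Suc D) a \<in> U \<kappa>"
  shows "dm 2 (sig j D a) (sig j (Suc D) a)"
proof -
  have A: "dm 2 (replicate D (Q (v j, False)) @ [T (V j D a)] @ replicate D (Q (v j, True)))
    (replicate D (Q (v j, False)) @ [Q (v j, False), T (act (v j, True) (V j D a)), Q (v j, True)]
      @ replicate D (Q (v j, True)))"
    by (rule der_ctx[OF grow]) (use assms in auto)
  have B: "replicate D (Q (v j, False)) @ [Q (v j, False), T (act (v j, True) (V j D a)), Q (v j, True)]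
      @ replicate D (Q (v j, True)) = sig j (Suc D) a"
    by (simp add: sig_def replicate_app_Cons_same)
  show ?thesis using A unfolding B unfolding sig_def[of j D] .
qed

lemma sig_up:
  assumes j: "j < 3" and a: "pi j a = 0" "a \<in> U (D + \<kappa>)"
  shows "dm (2 * k) (sig j D a) (sig j (D + k) a)"
proof (induction k)
  case 0
  then show ?case by (simp add: dm_refl)
next
  case (Suc k)
  have *: "V j n a \<in> U \<kappa>" if "n \<ge> D" for n
  proof -
    have "D + \<kappa> - n \<le> \<kappa>" using that by simp
    then show ?thesis using V_contract[OF j a, of n] U_mono by blast
  qed
  have "dm 2 (sig j (D + k) a) (sig j (Suc (D + k)) a)" by (intro sig_Suc[OF j] *) auto
  then show ?case using der_trans_le[OF Suc.IH] by simp
qed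

lemma sig_add:
  assumes j: "j < 3" and a: "V j D a \<in> U \<kappa>" "V j D b \<in> U \<kappa>"
  shows "dm (D + 1) (sig j D a @ sig j D b) (sig j D (a + b))"
proof -
  let ?p = "replicate D (Q (v j, False))" and ?q = "replicate D (Q (v j, True))"
  have "dm D (?q @ ?p) []" using cancel[of "(v j, True)" D] v_Y[OF j] by (simp add: inv_letter_def)
  then have 1: "dm D ((?p @ [T (V j D a)]) @ (?q @ ?p) @ ([T (V j D b)] @ ?q))
     ((?p @ [T (V j D a)]) @ [] @ ([T (V j D b)] @ ?q))"
    by (rule der_ctx)
  have 2: "dm 1 (?p @ [T (V j D a), T (V j D b)] @ ?q) (?p @ [T (V j D a + V j D b)] @ ?q)"
    by (rule der_base) (use mT[OF a] in blast)
  from der_trans_le[OF 1, of 1] 2 show ?thesis by (simp add: sig_def V_add)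
qed

lemma sig_act:
  assumes j: "j < 3" and q: "fst q \<in> Y" and a: "V j D a \<in> U \<kappa>" "V j D (act q a) \<in> U \<kappa>"
  shows "dm (2 * D + 1) (Q q # sig j D a) (sig j D (act q a) @ [Q q])"
proof -
  let ?p = "replicate D (Q (v j, False))" and ?q = "replicate D (Q (v j, True))"
  have 1: "dm D ([] @ (Q q # ?p) @ ([T (V j D a)] @ ?q)) ([] @ (?p @ [Q q]) @ ([T (V j D a)] @ ?q))"
    by (rule der_ctx[OF commute1[OF j q]])
  have 2: "dm 1 (?p @ [Q q, T (V j D a)] @ ?q) (?p @ [T (act q (V j D a)), Q q] @ ?q)"
    by (rule der_base) (use mC[OF q a(1)] a(2) V_act[OF j] in auto)
  have 3: "dm D ((?p @ [T (act q (V j D a))]) @ (Q q # ?q) @ []) ((?p @ [T (act q (V j D a))]) @ (?q @ [Q q]) @ [])"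
    by (rule der_ctx[OF commute1[OF j q]])
  have "dm (D + 1) (Q q # sig j D a) (?p @ [T (act q (V j D a)), Q q] @ ?q)"
    using der_trans_le[OF 1, of 1] 2 by (simp add: sig_def)
  from der_trans_le[OF this, of D] 3 show ?thesis by (simp add: sig_def V_act[OF j])
qed

text \<open>Since \<open>v j\<close> and \<open>v k\<close> both contract \<open>a\<close>, both
  words can be brought to the common middle letter \<open>V k D (V j D a)\<close>. Exchanging the
  powers of \<open>v j\<close> and \<open>v k\<close> on its two sides costs
  \<open>2 * D * D\<close>; introducing and removing the inner powers costs \<open>2 * D\<close>
  each.\<close>

lemma sig_switch:
  assumes j: "j < 3" "k < 3" and a: "pi j a = 0" "pi k a = 0" "a \<in> U D"
  shows "dm (4 * D + 2 * D * D) (sig j D a) (sig k D a)"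
proof -
  let ?p = "\<lambda>i. replicate D (Q (v i, False))" and ?q = "\<lambda>i. replicate D (Q (v i, True))"
  have aj: "V j D a \<in> U 0" "V k D a \<in> U 0"
    using V_contract[OF j(1) a(1,3), of D] V_contract[OF j(2) a(2,3), of D] by simp_all
  have U: "U 0 \<subseteq> U (0 + \<kappa>)" by (rule U_mono) simp
  have 1: "dm (2 * D) (sig k 0 (V j D a)) (sig k (0 + D) (V j D a))"
    by (rule sig_up[OF j(2)]) (use aj U a in \<open>auto simp: V_pi\<close>)
  have 2: "dm (2 * D) (sig j 0 (V k D a)) (sig j (0 + D) (V k D a))"
    by (rule sig_up[OF j(1)]) (use aj U a in \<open>auto simp: V_pi\<close>)
  let ?b = "V k D (V j D a)"
  have A: "dm (2 * D) (?p j @ [T (V j D a)] @ ?q j) (?p j @ (?p k @ [T ?b] @ ?q k) @ ?q j)"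
    using der_ctx[OF 1, of "?p j" "?q j"] by (simp add: sig_def)
  have B1: "dm (D * D) (?p j @ ?p k) (?p k @ ?p j)" "dm (D * D) (?q k @ ?q j) (?q j @ ?q k)"
    using commute[of k "(v j, False)"] commute[of j "(v k, True)"] v_Y j by auto
  have B: "dm (2 * D * D) ((?p j @ ?p k) @ [T ?b] @ (?q k @ ?q j)) ((?p k @ ?p j) @ [T ?b] @ (?q j @ ?q k))"
    by (rule der_append[OF B1(1) der_append[OF dm_refl[of 0] B1(2) order_refl]]) simp
  have C: "dm (2 * D) (?p k @ (?p j @ [T ?b] @ ?q j) @ ?q k) (?p k @ [T (V k D a)] @ ?q k)"
    using der_ctx[OF der_sym[OF 2], of "?p k" "?q k"] V_V[OF j(1), where n = D and m = D and k = k and a = a] by (simp add: sig_def)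
  have "dm (2 * D + 2 * D * D) (sig j D a) ((?p k @ ?p j) @ [T ?b] @ (?q j @ ?q k))"
    using der_trans_le[OF A, of "2 * D * D"] B by (simp add: sig_def)
  from der_trans_le[OF this, of "2 * D"] C show ?thesis by (simp add: sig_def)
qed

lemma sig_switch':
  assumes j: "j < 3" "k < 3" and a: "pi j a = 0" "pi k a = 0" "a \<in> U D"
  shows "dm (4 * D + 2 * D * D) (sig k D a) (sig j D a)"
  by (rule der_sym[OF sig_switch[OF assms]])

lemma V_ok:
  assumes "j < 3" "pi j a = 0" "a \<in> U D"
  shows "V j D a \<in> U \<kappa>"
  using V_contract[OF assms, of D] U_mono[of 0 \<kappa>] by auto

lemma sig_comm:
  assumes j: "j < 3" "pi j a = 0" "pi j b = 0" "a \<in> U D" "b \<in> U D"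
  shows "dm (2 * D + 2) (sig j D a @ sig j D b) (sig j D b @ sig j D a)"
proof -
  have "dm (D + 1) (sig j D a @ sig j D b) (sig j D (a + b))" "dm (D + 1) (sig j D b @ sig j D a) (sig j D (a + b))"
    using sig_add[OF j(1) V_ok[of j a D] V_ok[of j b D]] sig_add[OF j(1) V_ok[of j b D] V_ok[of j a D]] j
    by (auto simp: add.commute)
  then show ?thesis using der_trans_le[OF _ der_sym] by fastforce
qed

text \<open>Component \<open>i\<close> must be written with a unit other than \<open>v i\<close>,
  which does not contract it; a cyclic choice is fixed. The cost \<open>cm\<close> is that of four
  calls of \<open>sig_switch\<close> and one of \<open>sig_comm\<close>.\<close>

abbreviation nx :: "nat \<Rightarrow> nat" where "nx i \<equiv> (if i = 0 then 1 else if i = 1 then 2 else 0)"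

abbreviation cm :: "nat \<Rightarrow> nat" where "cm D \<equiv> 18 * D + 8 * D * D + 2"

text \<open>The unit of the third index \<open>?t\<close> contracts both components. Both words are
  rewritten with it, commute there because both orders equal the word of the sum, and are rewritten
  back.\<close>

lemma std_comm:
  assumes i: "i < 3" "k < 3" "i \<noteq> k" and a: "a \<in> U D" "b \<in> U D"
  shows "dm (cm D) (sig (nx i) D (pi i a) @ sig (nx k) D (pi k b)) (sig (nx k) D (pi k b) @ sig (nx i) D (pi i a))"
proof -
  let ?t = "3 - i - k" and ?c = "4 * D + 2 * D * D"
  have t: "?t < 3" "?t \<noteq> i" "?t \<noteq> k" using i by presburger+
  have A: "dm ?c (sig (nx i) D (pi i a)) (sig ?t D (pi i a))" "dm ?c (sig ?t D (pi i a)) (sig (nx i) D (pi i a))"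
    using sig_switch[of "nx i" ?t "pi i a" D] sig_switch'[of "nx i" ?t "pi i a" D] i t pi_pi pi_U[OF a(1)] by auto
  have B: "dm ?c (sig (nx k) D (pi k b)) (sig ?t D (pi k b))" "dm ?c (sig ?t D (pi k b)) (sig (nx k) D (pi k b))"
    using sig_switch[of "nx k" ?t "pi k b" D] sig_switch'[of "nx k" ?t "pi k b" D] i t pi_pi pi_U[OF a(2)] by auto
  have C: "dm (2 * D + 2) (sig ?t D (pi i a) @ sig ?t D (pi k b)) (sig ?t D (pi k b) @ sig ?t D (pi i a))"
    by (rule sig_comm) (use i t pi_pi pi_U a in auto)
  have "dm (2 * ?c + (2 * D + 2)) (sig (nx i) D (pi i a) @ sig (nx k) D (pi k b))
      (sig ?t D (pi k b) @ sig ?t D (pi i a))"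
    by (rule der_trans_le[OF der_append[OF A(1) B(1) order_refl] C]) simp
  from der_trans_le[OF this der_append[OF B(2) A(2) order_refl]] show ?thesis by simp
qed

definition sigma :: "nat \<Rightarrow> 'a \<Rightarrow> ('q, 'a) slet list" where
  "sigma D a = sig 1 D (pi 0 a) @ sig 2 D (pi 1 a) @ sig 0 D (pi 2 a)"

text \<open>Three exchanges bring the six factors into pairs belonging to the same component, and
  three additions merge the pairs; the cost is \<open>3 * cm D + 3 * (D + 1)\<close>.\<close>

lemma sigma_add:
  assumes a: "a \<in> U D" "b \<in> U D"
  shows "dm (57 * D + 24 * D * D + 9) (sigma D a @ sigma D b) (sigma D (a + b))"
proof -
  define s where "s = (\<lambda>i. sig (nx i) D (pi i a))"
  define t where "t = (\<lambda>i. sig (nx i) D (pi i b))"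
  have c: "dm (cm D) (s i @ t k) (t k @ s i)" if "i < 3" "k < 3" "i \<noteq> k" for i k
    unfolding s_def t_def by (rule std_comm[OF that a])
  have m: "dm (D + 1) (s i @ t i) (sig (nx i) D (pi i (a + b)))" if "i < 3" for i
    unfolding s_def t_def pi_add
    by (rule sig_add) (use that pi_pi pi_U a in \<open>auto intro!: V_ok\<close>)
  have e: "sigma D a @ sigma D b = (s 0 @ s 1) @ (s 2 @ t 0) @ (t 1 @ t 2)"
    by (simp add: sigma_def s_def t_def)
  have 1: "dm (cm D) (sigma D a @ sigma D b) ((s 0 @ s 1) @ (t 0 @ s 2) @ (t 1 @ t 2))"
    unfolding e by (rule der_ctx[OF c]) auto
  have 2: "dm (cm D) (s 0 @ (s 1 @ t 0) @ (s 2 @ t 1 @ t 2)) (s 0 @ (t 0 @ s 1) @ (s 2 @ t 1 @ t 2))"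
    by (rule der_ctx[OF c]) auto
  have 3: "dm (cm D) ((s 0 @ t 0 @ s 1) @ (s 2 @ t 1) @ t 2) ((s 0 @ t 0 @ s 1) @ (t 1 @ s 2) @ t 2)"
    by (rule der_ctx[OF c]) auto
  have 4: "dm (3 * (D + 1)) ((s 0 @ t 0) @ (s 1 @ t 1) @ (s 2 @ t 2)) (sigma D (a + b))"
    unfolding sigma_def
    using der_append[OF m[of 0] der_append[OF m[of 1] m[of 2] order_refl], of "3 * (D + 1)"] by simp
  have "dm (cm D + cm D) (sigma D a @ sigma D b) (s 0 @ (t 0 @ s 1) @ (s 2 @ t 1 @ t 2))"
    by (rule der_trans_le[OF 1 _ order_refl]) (use 2 in simp)
  then have "dm (cm D + cm D + cm D) (sigma D a @ sigma D b) ((s 0 @ t 0 @ s 1) @ (t 1 @ s 2) @ t 2)"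
    by (rule der_trans_le[OF _ _ order_refl]) (use 3 in simp)
  then have "dm (cm D + cm D + cm D + 3 * (D + 1)) (sigma D a @ sigma D b) (sigma D (a + b))"
    by (rule der_trans_le[OF _ _ order_refl]) (use 4 in simp)
  then show ?thesis by (rule der_mono) simp
qed

lemma sigma_up:
  assumes a: "a \<in> U (D + \<kappa>)"
  shows "dm (6 * k) (sigma D a) (sigma (D + k) a)"
proof -
  have u: "dm (2 * k) (sig (nx i) D (pi i a)) (sig (nx i) (D + k) (pi i a))" if "i < 3" for i
    by (rule sig_up) (use that pi_pi pi_U a in auto)
  show ?thesis unfolding sigma_def
    using der_append[OF u[of 0] der_append[OF u[of 1] u[of 2] order_refl], of "6 * k"] by simp
qed

text \<open>The letter commutes with the powers of the units and acts only on the small middle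
  letters, so the cost is linear in \<open>D\<close>.\<close>

lemma sigma_act:
  assumes q: "fst q \<in> Y" and a: "a \<in> U D" "act (inv_letter q) a \<in> U D"
  shows "dm (6 * D + 3) (sigma D a @ [Q q]) (Q q # sigma D (act (inv_letter q) a))"
proof -
  let ?b = "act (inv_letter q) a"
  have ab: "act q ?b = a" by (rule act_inv)
  have u: "dm (2 * D + 1) (sig (nx i) D (pi i a) @ [Q q]) (Q q # sig (nx i) D (pi i ?b))" if "i < 3" for i
  proof -
    have "dm (2 * D + 1) (Q q # sig (nx i) D (pi i ?b)) (sig (nx i) D (act q (pi i ?b)) @ [Q q])"
      by (rule sig_act[OF _ q]) (use that pi_pi pi_U a ab in \<open>auto simp: pi_act[symmetric] intro!: V_ok\<close>)
    then show ?thesis unfolding pi_act[symmetric] ab by (rule der_sym)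
  qed
  have 1: "dm (2 * D + 1) ((sig 1 D (pi 0 a) @ sig 2 D (pi 1 a)) @ (sig 0 D (pi 2 a) @ [Q q]) @ [])
      ((sig 1 D (pi 0 a) @ sig 2 D (pi 1 a)) @ (Q q # sig 0 D (pi 2 ?b)) @ [])"
    by (rule der_ctx) (use u[of 2] in simp)
  have 2: "dm (2 * D + 1) (sig 1 D (pi 0 a) @ (sig 2 D (pi 1 a) @ [Q q]) @ sig 0 D (pi 2 ?b))
      (sig 1 D (pi 0 a) @ (Q q # sig 2 D (pi 1 ?b)) @ sig 0 D (pi 2 ?b))"
    by (rule der_ctx) (use u[of 1] in simp)
  have 3: "dm (2 * D + 1) ([] @ (sig 1 D (pi 0 a) @ [Q q]) @ sig 2 D (pi 1 ?b) @ sig 0 D (pi 2 ?b))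
      ([] @ (Q q # sig 1 D (pi 0 ?b)) @ sig 2 D (pi 1 ?b) @ sig 0 D (pi 2 ?b))"
    by (rule der_ctx) (use u[of 0] in simp)
  have "dm (2 * (2 * D + 1)) (sigma D a @ [Q q]) (sig 1 D (pi 0 a) @ (Q q # sig 2 D (pi 1 ?b)) @ sig 0 D (pi 2 ?b))"
    using der_trans_le[OF 1, of "2 * D + 1"] 2 by (simp add: sigma_def)
  from der_trans_le[OF this, of "2 * D + 1"] 3 show ?thesis by (simp add: sigma_def)
qed

section \<open>Normal forms of arbitrary words\<close>

text \<open>A translation moved to the right through \<open>qs\<close> meets the letters in order
  and is acted on by their inverses.\<close>

definition qact :: "'q letter list \<Rightarrow> 'a \<Rightarrow> 'a" where
  "qact qs a = foldl (\<lambda>a q. act (inv_letter q) a) a qs"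

lemma qact_simps [simp]: "qact [] a = a" "qact (q # qs) a = qact qs (act (inv_letter q) a)"
  by (simp_all add: qact_def)

lemma qact_add: "qact qs (a + b) = qact qs a + qact qs b"
  by (induction qs arbitrary: a b) (simp_all add: act_add)

lemma qact_U: "fst ` set qs \<subseteq> Y \<Longrightarrow> a \<in> U c \<Longrightarrow> qact qs a \<in> U (c + \<kappa> * length qs)"
proof (induction qs arbitrary: a c)
  case (Cons q qs)
  have "act (inv_letter q) a \<in> U (c + \<kappa>)" using Cons.prems by (intro act_U) auto
  then show ?case using Cons.IH[of "act (inv_letter q) a" "c + \<kappa>"] Cons.prems by (simp add: add.assoc)
qed simp

lemma sigma_qact:
  assumes "fst ` set qs \<subseteq> Y" "a \<in> U c" "c + \<kappa> * length qs \<le> D"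
  shows "dm (length qs * (6 * D + 3)) (sigma D a @ map Q qs) (map Q qs @ sigma D (qact qs a))"
  using assms
proof (induction qs arbitrary: a c)
  case Nil
  then show ?case by (simp add: dm_refl)
next
  case (Cons q qs)
  let ?b = "act (inv_letter q) a"
  have b: "?b \<in> U (c + \<kappa>)" using Cons.prems by (intro act_U) auto
  have D: "a \<in> U D" "?b \<in> U D"
    using Cons.prems b U_mono[of c D] U_mono[of "c + \<kappa>" D] by auto
  have "dm (6 * D + 3) ([] @ (sigma D a @ [Q q]) @ map Q qs) ([] @ (Q q # sigma D ?b) @ map Q qs)"
    by (rule der_ctx[OF sigma_act[OF _ D]]) (use Cons.prems in auto)
  moreover have "dm (length qs * (6 * D + 3)) ([Q q] @ (sigma D ?b @ map Q qs) @ []) ([Q q] @ (map Q qs @ sigma D (qact qs ?b)) @ [])"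
    by (rule der_ctx[OF Cons.IH[OF _ b]]) (use Cons.prems in auto)
  ultimately show ?case
    using der_trans_le[of mv "6 * D + 3" "sigma D a @ map Q (q # qs)" _ "length qs * (6 * D + 3)"] by simp
qed

lemma sig_zero: "j < 3 \<Longrightarrow> dm (D + 1) (sig j D 0) []"
proof -
  assume j: "j < 3"
  let ?p = "replicate D (Q (v j, False))" and ?q = "replicate D (Q (v j, True))"
  have "dm 1 (?p @ [T 0] @ ?q) (?p @ [] @ ?q)" by (rule der_base) (use m0 in blast)
  moreover have "dm D (?p @ ?q) []" using cancel[of "(v j, False)" D] v_Y[OF j] by (simp add: inv_letter_def)
  ultimately show ?thesis using der_trans_le[of mv 1 "sig j D 0" _ D "[]" "D + 1"] by (simp add: sig_def)
qed

lemma sigma_zero: "dm (3 * D + 3) (sigma D 0) []"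
  using der_append[OF sig_zero[of 1 D] der_append[OF sig_zero[of 2 D] sig_zero[of 0 D] order_refl], of "3 * D + 3"]
  by (simp add: sigma_def)

text \<open>Words act on points from the right by affine maps; the image of 0 is the translation
  part of the word.\<close>

fun sstep :: "'a \<Rightarrow> ('q, 'a) slet \<Rightarrow> 'a" where
  "sstep a (Q q) = act (inv_letter q) a"
| "sstep a (T b) = a + b"

definition st :: "'a \<Rightarrow> ('q, 'a) slet list \<Rightarrow> 'a" where
  "st a w = foldl sstep a w"

lemma st_simps [simp]: "st a [] = a" "st a (x # w) = st (sstep a x) w" "st a (u @ w) = st (st a u) w"
  by (simp_all add: st_def)

lemma st_qact: "st a w = qact (qpart w) a + st 0 w"
proof (induction w arbitrary: a rule: qpart.induct)
  case 1
  show ?case by simp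
next
  case (2 q w)
  show ?case using "2.IH"[of "act (inv_letter q) a"] by simp
next
  case (3 b w)
  show ?case using "3.IH"[of "a + b"] "3.IH"[of b] by (simp add: qact_add add.assoc)
qed

fun vlet :: "('q, 'a) slet \<Rightarrow> bool" where
  "vlet (Q q) \<longleftrightarrow> fst q \<in> Y"
| "vlet (T a) \<longleftrightarrow> a \<in> U \<kappa>"

lemma qpart_Y: "list_all vlet w \<Longrightarrow> fst ` set (qpart w) \<subseteq> Y"
  by (induction w rule: qpart.induct) auto

lemma st_U: "list_all vlet w \<Longrightarrow> st 0 w \<in> U (\<kappa> * length w)"
proof (induction w rule: rev_induct)
  case Nil
  then show ?case by (simp add: U_0)
next
  case (snoc x w)
  then have w: "st 0 w \<in> U (\<kappa> * length w)" by simp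
  show ?case
  proof (cases x)
    case (Q q)
    then show ?thesis using act_U[OF _ w, of "inv_letter q"] snoc.prems by (simp add: add.commute)
  next
    case (T b)
    have "st 0 w \<in> U (\<kappa> * length (w @ [x]))" "b \<in> U (\<kappa> * length (w @ [x]))"
      using w U_mono[of "\<kappa> * length w" "\<kappa> * length (w @ [x])"] U_mono[of \<kappa> "\<kappa> * length (w @ [x])"] snoc.prems T
      by auto
    then show ?thesis using U_add T by simp
  qed
qed

lemma sigma_letter:
  assumes b: "b \<in> U \<kappa>"
  shows "dm (6 * \<kappa> + 2) [T b] (sigma \<kappa> b)"
proof -
  have p: "pi i b \<in> U \<kappa>" for i using pi_U b by blast
  have "dm 1 ([] @ [T (pi 0 b), T (pi 1 b)] @ [T (pi 2 b)]) ([] @ [T (pi 0 b + pi 1 b)] @ [T (pi 2 b)])"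
    by (rule der_base) (use mT p in blast)
  moreover have "dm 1 ([] @ [T (pi 0 b + pi 1 b), T (pi 2 b)] @ []) ([] @ [T (pi 0 b + pi 1 b + pi 2 b)] @ [])"
    by (rule der_base) (use mT p U_add in blast)
  ultimately have 1: "dm 2 [T (pi 0 b), T (pi 1 b), T (pi 2 b)] [T b]"
    using der_trans_le[of mv 1 "[T (pi 0 b), T (pi 1 b), T (pi 2 b)]" _ 1 _ 2] by (simp add: pi_sum[simplified])
  have "sigma 0 b = [T (pi 0 b), T (pi 1 b), T (pi 2 b)]" by (simp add: sigma_def sig_0)
  then have "dm (6 * \<kappa>) [T (pi 0 b), T (pi 1 b), T (pi 2 b)] (sigma \<kappa> b)"
    using sigma_up[of b 0 \<kappa>] b by simp
  from der_trans_le[OF der_sym[OF 1] this] show ?thesis by simp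
qed

text \<open>With \<open>n = 2 ^ k\<close>, \<open>D = \<kappa> * n\<close> and
  \<open>E = 2 * D\<close>, merging two halves costs
  \<open>12 * D + n * (6 * E + 3) + 57 * E + 24 * E * E + 9\<close> besides the two smaller
  fillings. Replacing \<open>n\<close> and 1 by \<open>n * n\<close> where necessary bounds this by
  \<open>fillc * n * n\<close>, and the recursion closes because
  \<open>2 + 1 \<le> 4\<close>.\<close>

definition fillc :: nat where "fillc = 96 * \<kappa> * \<kappa> + 138 * \<kappa> + 12"

text \<open>Splitting into halves instead of adding letters one by one is what keeps the cost quadratic:
  merging two normal forms of scale \<open>n\<close> costs about \<open>n\<^sup>2\<close>.\<close>

lemma normal_form:
  assumes "list_all vlet w" "length w \<le> 2 ^ k"
  shows "dm (fillc * 4 ^ k) w (map Q (qpart w) @ sigma (\<kappa> * 2 ^ k) (st 0 w))"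
  using assms
proof (induction k arbitrary: w)
  case 0
  have z: "dm (3 * \<kappa> + 3) (u @ []) (u @ sigma \<kappa> 0)" for u
    using der_ctx[OF der_sym[OF sigma_zero[of \<kappa>]], of u "[]"] by simp
  consider "w = []" | q where "w = [Q q]" | b where "w = [T b]"
    using 0 by (cases w; cases "hd w") auto
  then show ?case
  proof cases
    case 1
    then show ?thesis using der_mono[OF z[of "[]"], of fillc] by (simp add: fillc_def)
  next
    case (2 q)
    then show ?thesis using der_mono[OF z[of "[Q q]"], of fillc] by (simp add: fillc_def)
  next
    case (3 b)
    then have "b \<in> U \<kappa>" using 0 by simp
    then show ?thesis using der_mono[OF sigma_letter, of b fillc] 3 by (simp add: fillc_def)
  qed
next
  case (Suc k)
  define n where "n = (2::nat) ^ k"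
  define u where "u = take n w"
  define w' where "w' = drop n w"
  have w: "w = u @ w'" by (simp add: u_def w'_def)
  have len: "length u \<le> n" "length w' \<le> n" using Suc.prems(2) by (auto simp: u_def w'_def n_def)
  have val: "list_all vlet u" "list_all vlet w'" using Suc.prems(1) w by auto
  let ?D = "\<kappa> * n" and ?c = "fillc * 4 ^ k"
  let ?a = "st 0 u" and ?b = "st 0 w'"
  have IH: "dm ?c u (map Q (qpart u) @ sigma ?D ?a)" "dm ?c w' (map Q (qpart w') @ sigma ?D ?b)"
    using Suc.IH[OF val(1)] Suc.IH[OF val(2)] len by (simp_all add: n_def)
  have ab: "?a \<in> U ?D" "?b \<in> U ?D"
    using st_U[OF val(1)] st_U[OF val(2)] len U_mono[of "\<kappa> * length u" ?D] U_mono[of "\<kappa> * length w'" ?D]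
    by auto
  then have ab': "?a \<in> U (?D + \<kappa>)" "?b \<in> U (?D + \<kappa>)" using U_mono[of ?D "?D + \<kappa>"] by auto
  \<comment> \<open>The scale is doubled because passing up to \<open>n\<close> letters may enlarge
    the translation from size \<open>?D\<close> to size \<open>?D + \<kappa> * n\<close>.\<close>
  have u2: "dm (?c + 6 * ?D) u (map Q (qpart u) @ sigma (?D + ?D) ?a)"
    "dm (?c + 6 * ?D) w' (map Q (qpart w') @ sigma (?D + ?D) ?b)"
    using der_trans_le[OF IH(1) der_ctx[OF sigma_up[OF ab'(1), of ?D], of "map Q (qpart u)" "[]", simplified] order_refl]
      der_trans_le[OF IH(2) der_ctx[OF sigma_up[OF ab'(2), of ?D], of "map Q (qpart w')" "[]", simplified] order_refl]
    by simp_all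
  let ?E = "?D + ?D"
  have lq: "length (qpart w') \<le> n" using len length_qpart[of w'] by simp
  have qU: "qact (qpart w') ?a \<in> U ?E"
    using qact_U[OF qpart_Y[OF val(2)] ab(1)] U_mono[of "?D + \<kappa> * length (qpart w')" ?E] lq by auto
  have bE: "?b \<in> U ?E" using ab(2) U_mono[of ?D ?E] by auto
  have 1: "dm (2 * (?c + 6 * ?D)) w
      ((map Q (qpart u) @ sigma ?E ?a) @ (map Q (qpart w') @ sigma ?E ?b))"
    unfolding w by (rule der_append[OF u2]) simp
  have "dm (length (qpart w') * (6 * ?E + 3)) (sigma ?E ?a @ map Q (qpart w')) (map Q (qpart w') @ sigma ?E (qact (qpart w') ?a))"
    by (rule sigma_qact[OF qpart_Y[OF val(2)] ab(1)]) (use lq in simp)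
  then have "dm (n * (6 * ?E + 3)) (sigma ?E ?a @ map Q (qpart w')) (map Q (qpart w') @ sigma ?E (qact (qpart w') ?a))"
    by (rule der_mono) (use lq mult_le_mono1 in blast)
  then have 2: "dm (n * (6 * ?E + 3)) (map Q (qpart u) @ (sigma ?E ?a @ map Q (qpart w')) @ sigma ?E ?b)
     (map Q (qpart u) @ (map Q (qpart w') @ sigma ?E (qact (qpart w') ?a)) @ sigma ?E ?b)"
    by (rule der_ctx)
  have s: "qact (qpart w') ?a + ?b = st 0 w" unfolding w st_simps(3) using st_qact[of ?a w'] by simp
  have 3: "dm (57 * ?E + 24 * ?E * ?E + 9) ((map Q (qpart u) @ map Q (qpart w')) @ (sigma ?E (qact (qpart w') ?a) @ sigma ?E ?b) @ [])
      ((map Q (qpart u) @ map Q (qpart w')) @ sigma ?E (st 0 w) @ [])"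
    by (rule der_ctx) (use sigma_add[OF qU bE] s in simp)
  have 12: "dm (2 * (?c + 6 * ?D) + n * (6 * ?E + 3)) w
     (map Q (qpart u) @ (map Q (qpart w') @ sigma ?E (qact (qpart w') ?a)) @ sigma ?E ?b)"
    by (rule der_trans_le[OF 1 _ order_refl]) (use 2 in simp)
  have 123: "dm (2 * (?c + 6 * ?D) + n * (6 * ?E + 3) + (57 * ?E + 24 * ?E * ?E + 9)) w
     (map Q (qpart w) @ sigma ?E (st 0 w))"
    by (rule der_trans_le[OF 12 _ order_refl]) (use 3 in \<open>simp add: w\<close>)
  have n: "4 ^ k = n * n" "n \<ge> 1" by (simp_all add: n_def power_mult_distrib[symmetric])
  have le: "2 * (?c + 6 * ?D) + n * (6 * ?E + 3) + (57 * ?E + 24 * ?E * ?E + 9) \<le> fillc * 4 ^ Suc k"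
  proof -
    have nn: "n \<le> n * n" "1 \<le> n * n" using n(2) by simp_all
    have "126 * \<kappa> * n \<le> 126 * \<kappa> * (n * n)" "3 * n \<le> 3 * (n * n)" "9 \<le> 9 * (n * n)"
      using nn by (auto intro!: mult_le_mono2)
    then have "126 * \<kappa> * n + 3 * n + 9 + 12 * \<kappa> * (n * n) + 96 * \<kappa> * \<kappa> * (n * n) \<le>
        126 * \<kappa> * (n * n) + 3 * (n * n) + 9 * (n * n) + 12 * \<kappa> * (n * n) + 96 * \<kappa> * \<kappa> * (n * n)" by linarith
    also have "\<dots> = fillc * (n * n)" by (simp add: fillc_def algebra_simps)
    finally have "126 * \<kappa> * n + 3 * n + 9 + 12 * \<kappa> * (n * n) + 96 * \<kappa> * \<kappa> * (n * n) \<le> fillc * (n * n)" .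
    then show ?thesis unfolding n(1) power_Suc by (simp add: algebra_simps)
  qed
  have E: "?E = \<kappa> * 2 ^ Suc k" by (simp add: n_def)
  show ?case using der_mono[OF 123 le] unfolding E .
qed

section \<open>Words without translations\<close>

definition vpow :: "nat \<Rightarrow> int \<Rightarrow> ('q, 'a) slet list" where
  "vpow j n = replicate (nat \<bar>n\<bar>) (Q (v j, n \<ge> 0))"

lemma vpow_pos: "vpow j (int k) = replicate k (Q (v j, True))"
  and vpow_neg: "vpow j (- int k) = replicate k (Q (v j, False))"
  by (simp_all add: vpow_def)

lemma vpow_step:
  assumes j: "j < 3"
  shows "dm 1 (Q (v j, b) # vpow j n) (vpow j ((if b then 1 else -1) + n))"
proof -
  have c: "dm 1 (Q (v j, b) # replicate (Suc k) (Q (v j, \<not> b))) (replicate k (Q (v j, \<not> b)))" for b k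
  proof -
    have "dm 1 ([] @ [Q (v j, b), Q (inv_letter (v j, b))] @ replicate k (Q (v j, \<not> b)))
        ([] @ [] @ replicate k (Q (v j, \<not> b)))"
      by (rule der_base) (use mI[of "(v j, b)"] v_Y[OF j] in auto)
    then show ?thesis by (simp add: inv_letter_def)
  qed
  consider k where "b" "n = int k" | k where "b" "n = - int (Suc k)" | "\<not> b" "n = 0" |
    k where "\<not> b" "n = int (Suc k)" | k where "\<not> b" "n = - int (Suc k)"
  proof (cases n)
    case (nonneg k)
    show thesis
    proof (cases b)
      case True
      then show thesis using that(1)[of k] nonneg by simp
    next
      case False
      then show thesis using that(3) that(4)[of "k - 1"] nonneg by (cases k) simp_all
    qed
  next
    case (neg k)
    then show thesis using that(2)[of k] that(5)[of k] by (cases b) simp_all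
  qed
  then show ?thesis
  proof cases
    case (1 k)
    then have "(if b then 1 else -1) + n = int (Suc k)" by simp
    then show ?thesis using 1 unfolding 1(2) by (simp only: vpow_pos replicate_Suc) (simp add: dm_refl)
  next
    case (2 k)
    then have "(if b then 1 else -1) + n = - int k" by simp
    then show ?thesis unfolding 2(2) vpow_neg using c[of True k] 2 by (simp only: vpow_neg) simp
  next
    case 3
    then have "(if b then 1 else -1) + n = - int (Suc 0)" by simp
    then show ?thesis using 3 by (simp only: vpow_neg) (simp add: vpow_def dm_refl)
  next
    case (4 k)
    then have "(if b then 1 else -1) + n = int k" by simp
    then show ?thesis unfolding 4(2) vpow_pos using c[of False k] 4 by (simp only: vpow_pos) simp
  next
    case (5 k)
    then have "(if b then 1 else -1) + n = - int (Suc (Suc k))" by simp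
    then show ?thesis using 5 unfolding 5(2) by (simp only: vpow_neg replicate_Suc) (simp add: dm_refl)
  qed
qed

text \<open>Each letter either merges with the collected power of \<open>v j\<close> or is moved
  past it, and the length of this power is at most the number of letters already treated.\<close>

lemma extract_v:
  assumes j: "j < 3" and "fst ` set qs \<subseteq> Y"
  shows "dm (length qs * length qs) (map Q qs) (vpow j (expo (v j) qs) @ map Q (filter (\<lambda>q. fst q \<noteq> v j) qs))"
  using assms(2)
proof (induction qs)
  case Nil
  then show ?case by (simp add: vpow_def dm_refl)
next
  case (Cons q qs)
  let ?n = "length qs" and ?e = "expo (v j) qs" and ?f = "map Q (filter (\<lambda>q. fst q \<noteq> v j) qs)"
  have IH: "dm (?n * ?n) (Q q # map Q qs) (Q q # vpow j ?e @ ?f)"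
    using der_ctx[OF Cons.IH, of "[Q q]" "[]"] Cons.prems by simp
  have "dm ?n (Q q # vpow j ?e @ ?f) (vpow j (expo (v j) (q # qs)) @ map Q (filter (\<lambda>q. fst q \<noteq> v j) (q # qs))) \<or>
    dm 1 (Q q # vpow j ?e @ ?f) (vpow j (expo (v j) (q # qs)) @ map Q (filter (\<lambda>q. fst q \<noteq> v j) (q # qs)))"
  proof (cases "fst q = v j")
    case True
    then have q: "q = (v j, snd q)" by (cases q) simp
    have "dm 1 ([] @ (Q (v j, snd q) # vpow j ?e) @ ?f) ([] @ vpow j ((if snd q then 1 else -1) + ?e) @ ?f)"
      by (rule der_ctx[OF vpow_step[OF j]])
    then show ?thesis using True by (subst (1 2) q) auto
  next
    case False
    let ?k = "nat \<bar>?e\<bar>"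
    have k: "?k \<le> ?n" using expo_bound[of "v j" qs] by simp
    have "dm ?k (Q q # vpow j ?e) (vpow j ?e @ [Q q])"
      unfolding vpow_def by (rule commute1[OF j]) (use Cons.prems in simp)
    then have "dm ?n ([] @ (Q q # vpow j ?e) @ ?f) ([] @ (vpow j ?e @ [Q q]) @ ?f)"
      using k der_ctx der_mono by blast
    then show ?thesis using False by simp
  qed
  then have "dm (?n + 1) (Q q # vpow j ?e @ ?f) (vpow j (expo (v j) (q # qs)) @ map Q (filter (\<lambda>q. fst q \<noteq> v j) (q # qs)))"
    using der_mono[of mv ?n _ _ "?n + 1"] der_mono[of mv 1 _ _ "?n + 1"] by auto
  from der_trans_le[OF IH this] show ?case by simp
qed

lemma reduce_fill: "fst ` set qs \<subseteq> Y \<Longrightarrow> dm (length qs) (map Q qs) (map Q (reduce qs))"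
proof (induction qs)
  case Nil
  then show ?case by (simp add: dm_refl reduce_def)
next
  case (Cons q qs)
  have 1: "dm (length qs) (map Q (q # qs)) (map Q (q # reduce qs))"
    using der_ctx[OF Cons.IH, of "[Q q]" "[]"] Cons.prems by simp
  have "dm 1 (map Q (q # reduce qs)) (map Q (cons_red q (reduce qs)))"
  proof (cases "\<exists>r. reduce qs = inv_letter q # r")
    case True
    then obtain r where r: "reduce qs = inv_letter q # r" by blast
    have "dm 1 ([] @ [Q q, Q (inv_letter q)] @ map Q r) ([] @ [] @ map Q r)"
      by (rule der_base) (use mI[of q] Cons.prems in auto)
    then show ?thesis by (simp add: r)
  next
    case False
    then have "cons_red q (reduce qs) = q # reduce qs" by (cases "reduce qs") auto
    then show ?thesis by (simp add: dm_refl)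
  qed
  from der_trans_le[OF 1 this, of "length (q # qs)"] show ?case by (simp add: reduce_def)
qed

text \<open>The normal form has translation part 0, and the remaining letters vanish by three
  extractions with exponent 0 and a free reduction. Minimality of \<open>k\<close> gives
  \<open>2 ^ k \<le> 2 * n\<close>, hence the factor 4; the 7 is made up of 3 for the extractions, 3
  for the constant in \<open>sigma_zero\<close> and 1 for the reduction.\<close>

theorem quadratic_filling:
  assumes val: "list_all vlet w" and n: "length w \<le> n" "n \<ge> 1" and st: "st 0 w = 0"
    and ex: "\<And>j. j < 3 \<Longrightarrow> expo (v j) (qpart w) = 0"
    and red: "reduce (filter (\<lambda>q. fst q \<notin> v ` {..<3}) (qpart w)) = []"
  shows "dm ((4 * fillc + 6 * \<kappa> + 7) * n * n) w []"
proof -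
  define k where "k = (LEAST k. n \<le> 2 ^ k)"
  have exk: "\<exists>k. n \<le> 2 ^ k" using less_exp[of n] less_imp_le by blast
  have k1: "n \<le> 2 ^ k" unfolding k_def by (rule LeastI_ex[OF exk])
  have k2: "2 ^ k \<le> 2 * n"
  proof (cases k)
    case (Suc i)
    then have "\<not> n \<le> 2 ^ i" unfolding k_def by (metis lessI not_less_Least)
    then show ?thesis using Suc by simp
  qed (use n in simp)
  have 1: "dm (fillc * 4 ^ k) w (map Q (qpart w) @ sigma (\<kappa> * 2 ^ k) 0)"
    using normal_form[OF val, of k] n k1 st by simp
  have 2: "dm (3 * (\<kappa> * 2 ^ k) + 3) (map Q (qpart w) @ sigma (\<kappa> * 2 ^ k) 0) (map Q (qpart w))"
    using der_ctx[OF sigma_zero[of "\<kappa> * 2 ^ k"], of "map Q (qpart w)" "[]"] by simp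
  define q0 where "q0 = qpart w"
  define q1 where "q1 = filter (\<lambda>q. fst q \<noteq> v 0) q0"
  define q2 where "q2 = filter (\<lambda>q. fst q \<noteq> v 1) q1"
  define q3 where "q3 = filter (\<lambda>q. fst q \<noteq> v 2) q2"
  have Y: "fst ` set q0 \<subseteq> Y" "fst ` set q1 \<subseteq> Y" "fst ` set q2 \<subseteq> Y" "fst ` set q3 \<subseteq> Y"
    using qpart_Y[OF val] by (auto simp: q0_def q1_def q2_def q3_def)
  have len: "length q0 \<le> n" "length q1 \<le> n" "length q2 \<le> n" "length q3 \<le> n"
    using length_qpart[of w] n(1) length_filter_le unfolding q0_def q1_def q2_def q3_def
    by (meson le_trans)+
  have ne: "v 0 \<noteq> v 1" "v 0 \<noteq> v 2" "v 1 \<noteq> v 2" using v_inj[of 0 1] v_inj[of 0 2] v_inj[of 1 2] by auto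
  have "expo (v 1) q1 = expo (v 1) q0" "expo (v 2) q1 = expo (v 2) q0"
    unfolding q1_def by (intro expo_filter ne[symmetric])+
  moreover have "expo (v 2) q2 = expo (v 2) q1"
    unfolding q2_def by (intro expo_filter ne[symmetric])
  ultimately have e: "expo (v 0) q0 = 0" "expo (v 1) q1 = 0" "expo (v 2) q2 = 0"
    using ex[of 0] ex[of 1] ex[of 2] by (simp_all add: q0_def)
  have D: "dm (n * n) (map Q q0) (map Q q1)" "dm (n * n) (map Q q1) (map Q q2)" "dm (n * n) (map Q q2) (map Q q3)"
    using der_mono[OF extract_v[of 0 q0], of "n * n"] der_mono[OF extract_v[of 1 q1], of "n * n"]
      der_mono[OF extract_v[of 2 q2], of "n * n"] Y len e mult_le_mono[of _ n _ n]
    by (simp_all add: q1_def q2_def q3_def vpow_def)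
  have "{..<3} = {0, 1, 2 :: nat}" by auto
  then have "q3 = filter (\<lambda>q. fst q \<notin> v ` {..<3}) (qpart w)"
    unfolding q0_def q1_def q2_def q3_def filter_filter by (intro filter_cong) auto
  then have 4: "dm n (map Q q3) []" using der_mono[OF reduce_fill[OF Y(4)] len(4)] red by simp
  have "dm (fillc * 4 ^ k + (3 * (\<kappa> * 2 ^ k) + 3)) w (map Q q0)"
    using der_trans_le[OF 1 2 order_refl] by (simp add: q0_def)
  from der_trans_le[OF this D(1) order_refl]
  have "dm (fillc * 4 ^ k + (3 * (\<kappa> * 2 ^ k) + 3) + n * n) w (map Q q1)" .
  from der_trans_le[OF this D(2) order_refl]
  have "dm (fillc * 4 ^ k + (3 * (\<kappa> * 2 ^ k) + 3) + n * n + n * n) w (map Q q2)" .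
  from der_trans_le[OF this D(3) order_refl]
  have "dm (fillc * 4 ^ k + (3 * (\<kappa> * 2 ^ k) + 3) + n * n + n * n + n * n) w (map Q q3)" .
  from der_trans_le[OF this 4 order_refl]
  have "dm (fillc * 4 ^ k + (3 * (\<kappa> * 2 ^ k) + 3) + n * n + n * n + n * n + n) w []" .
  then show ?thesis
  proof (rule der_mono)
    have "(2::nat) ^ k * 2 ^ k \<le> (2 * n) * (2 * n)" by (rule mult_le_mono[OF k2 k2])
    then have "(4::nat) ^ k \<le> 4 * (n * n)" by (simp add: power_mult_distrib[symmetric])
    then have a: "fillc * 4 ^ k \<le> fillc * (4 * (n * n))" by simp
    have nn: "n \<le> n * n" "1 \<le> n * n" using n(2) by simp_all
    have "\<kappa> * 2 ^ k \<le> \<kappa> * (2 * n)" using k2 by simp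
    also have "\<dots> \<le> \<kappa> * (2 * (n * n))" using nn by simp
    finally have b: "3 * (\<kappa> * 2 ^ k) \<le> 6 * \<kappa> * (n * n)" by simp
    have "fillc * 4 ^ k + (3 * (\<kappa> * 2 ^ k) + 3) + n * n + n * n + n * n + n
       \<le> fillc * (4 * (n * n)) + 6 * \<kappa> * (n * n) + 3 * (n * n) + 3 * (n * n) + n * n"
      using a b nn by linarith
    also have "\<dots> = (4 * fillc + 6 * \<kappa> + 7) * n * n" by (simp add: algebra_simps)
    finally show "fillc * 4 ^ k + (3 * (\<kappa> * 2 ^ k) + 3) + n * n + n * n + n * n + n
       \<le> (4 * fillc + 6 * \<kappa> + 7) * n * n" .
  qed
qed

end

section \<open>Area\<close>

definition fillable :: "'a set \<Rightarrow> 'a word set \<Rightarrow> nat \<Rightarrow> 'a word \<Rightarrow> bool" where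
  "fillable X R n w \<longleftrightarrow> (\<exists>vs. length vs \<le> n \<and> set vs \<subseteq> relator_conjugates X R \<and>
     reduce w = foldr (monoid.mult (free_group X)) vs \<one>\<^bsub>free_group X\<^esub>)"

lemma free_group_simps:
  "carrier (free_group X) = {w \<in> words X. reduced w}"
  "u \<otimes>\<^bsub>free_group X\<^esub> w = reduce (u @ w)"
  "\<one>\<^bsub>free_group X\<^esub> = []"
  by (simp_all add: free_group_def)

lemma reduce_Nil [simp]: "reduce [] = []"
  by (simp add: reduce_def)

lemma reduce_reduce [simp]: "reduce (reduce w) = reduce w"
  by (rule reduce_reduced[OF reduced_reduce])

lemma inv_free_group:
  assumes "w \<in> words X" "reduced w"
  shows "inv\<^bsub>free_group X\<^esub> w = reduce (winv w)"
proof (rule group.inv_equality[OF group_free_group])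
  show "reduce (winv w) \<otimes>\<^bsub>free_group X\<^esub> w = \<one>\<^bsub>free_group X\<^esub>"
    by (simp add: free_group_simps reduce_append_left winv_def reduce_inverse)
qed (use assms in \<open>simp_all add: free_group_simps reduce_words reduced_reduce\<close>)

lemma reduce_winv: "reduce (winv (reduce w)) = reduce (winv w)"
proof -
  have "reduce (winv (reduce w)) = reduce (winv (reduce w) @ w @ winv w)"
    using reduce_cancel_words[of "winv (reduce w)" w "[]"] by simp
  also have "\<dots> = reduce (reduce (winv (reduce w) @ reduce w) @ winv w)"
    by (metis append.assoc reduce_append_left reduce_append_right)
  also have "reduce (winv (reduce w) @ reduce w) = []" by (simp add: winv_def reduce_inverse)
  finally show ?thesis by simp
qed

lemma inv_reduce: "w \<in> words X \<Longrightarrow> inv\<^bsub>free_group X\<^esub> (reduce w) = reduce (winv w)"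
  using inv_free_group[of "reduce w" X] by (simp add: reduce_words reduced_reduce reduce_winv)

lemma conj_reduce:
  assumes "u \<in> words X" "s \<in> words X"
  shows "reduce u \<otimes>\<^bsub>free_group X\<^esub> reduce s \<otimes>\<^bsub>free_group X\<^esub> inv\<^bsub>free_group X\<^esub> (reduce u) = reduce (u @ s @ winv u)"
  using assms
  by (simp add: free_group_simps inv_reduce) (metis append.assoc reduce_append_left reduce_append_right)

lemma relator_conjugatesI:
  assumes "u \<in> words X" "r \<in> R" "R \<subseteq> words X" "s = r \<or> s = winv r"
  shows "reduce (u @ s @ winv u) \<in> relator_conjugates X R"
proof -
  have r: "r \<in> words X" and s: "s \<in> words X" using assms by auto
  have "reduce s \<in> {reduce r, inv\<^bsub>free_group X\<^esub> (reduce r)}" using assms(4) r by (auto simp: inv_reduce)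
  moreover have "reduce u \<in> carrier (free_group X)" by (rule reduce_in_free_group[OF assms(1)])
  ultimately show ?thesis
    unfolding relator_conjugates_def conj_reduce[OF assms(1) s, symmetric] using assms(2) by blast
qed

lemma fillable_Nil: "fillable X R n []"
  unfolding fillable_def by (rule exI[of _ "[]"]) (simp add: free_group_simps)

lemma fillable_mono: "fillable X R n w \<Longrightarrow> n \<le> m \<Longrightarrow> fillable X R m w"
  unfolding fillable_def by (meson le_trans)

lemma fillable_step:
  assumes R: "R \<subseteq> words X" and w: "fillable X R n (p @ l @ q)"
    and pq: "p \<in> words X" "l \<in> words X" "r \<in> words X" and lr: "l @ winv r \<in> R \<or> r @ winv l \<in> R"
  shows "fillable X R (Suc n) (p @ r @ q)"
proof -
  obtain vs where vs: "length vs \<le> n" "set vs \<subseteq> relator_conjugates X R"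
     "reduce (p @ l @ q) = foldr (monoid.mult (free_group X)) vs \<one>\<^bsub>free_group X\<^esub>"
    using w unfolding fillable_def by blast
  \<comment> \<open>Replacing \<open>l\<close> by \<open>r\<close> behind the prefix
    \<open>p\<close> is left multiplication by the conjugate under \<open>p\<close> of
    \<open>r @ winv l\<close>.\<close>
  let ?c = "reduce (p @ (r @ winv l) @ winv p)"
  have "?c \<in> relator_conjugates X R"
    using lr relator_conjugatesI[OF pq(1) _ R, of "l @ winv r" "r @ winv l"]
      relator_conjugatesI[OF pq(1) _ R, of "r @ winv l" "r @ winv l"] by auto
  moreover have "reduce (p @ r @ q) = foldr (monoid.mult (free_group X)) (?c # vs) \<one>\<^bsub>free_group X\<^esub>"
  proof -
    have "foldr (monoid.mult (free_group X)) (?c # vs) \<one>\<^bsub>free_group X\<^esub> = reduce (?c @ reduce (p @ l @ q))"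
      by (simp add: vs(3)) (simp add: free_group_simps)
    also have "\<dots> = reduce ((p @ r @ winv l) @ winv p @ p @ l @ q)"
      by (simp only: reduce_append_left reduce_append_right append.assoc)
    also have "\<dots> = reduce ((p @ r) @ winv l @ l @ q)"
      using reduce_cancel_words[of "p @ r @ winv l" "winv p" "l @ q"] by simp
    also have "\<dots> = reduce (p @ r @ q)"
      using reduce_cancel_words[of "p @ r" "winv l" q] by simp
    finally show ?thesis by simp
  qed
  ultimately show ?thesis unfolding fillable_def using vs(1,2)
    by (intro exI[of _ "?c # vs"]) auto
qed

lemma area_le:
  assumes "fillable X R n w"
  shows "area X R w \<le> n"
proof -
  obtain vs where vs: "length vs \<le> n" "set vs \<subseteq> relator_conjugates X R"
     "reduce w = foldr (monoid.mult (free_group X)) vs \<one>\<^bsub>free_group X\<^esub>"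
    using assms unfolding fillable_def by blast
  have "area X R w \<le> length vs"
    unfolding area_def by (rule Least_le) (use vs in blast)
  then show ?thesis using vs(1) by simp
qed

lemma area_fillable:
  assumes "fillable X R n w"
  shows "fillable X R (area X R w) w"
proof -
  have "\<exists>m vs. length vs = m \<and> set vs \<subseteq> relator_conjugates X R \<and>
     reduce w = foldr (monoid.mult (free_group X)) vs \<one>\<^bsub>free_group X\<^esub>"
    using assms unfolding fillable_def by blast
  from LeastI_ex[OF this] obtain vs where "length vs = area X R w" "set vs \<subseteq> relator_conjugates X R"
     "reduce w = foldr (monoid.mult (free_group X)) vs \<one>\<^bsub>free_group X\<^esub>"
    unfolding area_def by blast
  then show ?thesis unfolding fillable_def using eq_refl by blast
qed

lemma relator_subgroup_normal: "R \<subseteq> words X \<Longrightarrow> relator_subgroup X R \<lhd> free_group X"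
  unfolding relator_subgroup_def
  by (rule group.normal_closure_normal[OF group_free_group]) (auto intro: reduce_in_free_group)

lemma relator_conjugates_subgroup:
  assumes R: "R \<subseteq> words X"
  shows "relator_conjugates X R \<subseteq> relator_subgroup X R"
proof
  interpret N: normal "relator_subgroup X R" "free_group X" by (rule relator_subgroup_normal[OF R])
  fix x assume "x \<in> relator_conjugates X R"
  then obtain u r s where x: "x = u \<otimes>\<^bsub>free_group X\<^esub> s \<otimes>\<^bsub>free_group X\<^esub> inv\<^bsub>free_group X\<^esub> u"
    "u \<in> carrier (free_group X)" "r \<in> R" "s = reduce r \<or> s = inv\<^bsub>free_group X\<^esub> (reduce r)"
    unfolding relator_conjugates_def by blast
  have rc: "reduce r \<in> carrier (free_group X)" using x(3) R by (auto intro: reduce_in_free_group)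
  have "\<one>\<^bsub>free_group X\<^esub> \<otimes>\<^bsub>free_group X\<^esub> reduce r \<otimes>\<^bsub>free_group X\<^esub> inv\<^bsub>free_group X\<^esub> \<one>\<^bsub>free_group X\<^esub>
      \<in> relator_subgroup X R"
    unfolding relator_subgroup_def normal_closure_def using x(3) by (intro generate.incl) blast
  then have r: "reduce r \<in> relator_subgroup X R" using rc by simp
  then have "s \<in> relator_subgroup X R" using x(4) N.m_inv_closed by blast
  then show "x \<in> relator_subgroup X R" unfolding x(1) by (rule N.inv_op_closed2[OF x(2)])
qed

lemma fillable_subgroup:
  assumes R: "R \<subseteq> words X" and "fillable X R n w"
  shows "reduce w \<in> relator_subgroup X R"
proof -
  interpret N: normal "relator_subgroup X R" "free_group X" by (rule relator_subgroup_normal[OF R])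
  have "foldr (monoid.mult (free_group X)) vs \<one>\<^bsub>free_group X\<^esub> \<in> relator_subgroup X R"
    if "set vs \<subseteq> relator_conjugates X R" for vs
    using that relator_conjugates_subgroup[OF R] by (induction vs) (auto intro: N.m_closed)
  then show ?thesis using assms(2) unfolding fillable_def by auto
qed

lemma relator_subgroup_induct:
  assumes R: "R \<subseteq> words X" and w: "w \<in> relator_subgroup X R"
    and rel: "\<And>r. r \<in> R \<Longrightarrow> P r"
    and red: "\<And>u v. reduce u = reduce v \<Longrightarrow> P u \<Longrightarrow> P v"
    and Nil: "P []"
    and app: "\<And>u v. P u \<Longrightarrow> P v \<Longrightarrow> P (u @ v)"
    and conj: "\<And>u v. u \<in> words X \<Longrightarrow> P v \<Longrightarrow> P (u @ v @ winv u)"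
    and inv: "\<And>u. P u \<Longrightarrow> P (winv u)"
  shows "P w"
proof -
  have c: "w \<in> words X \<and> P w" if w: "w \<in> {u \<otimes>\<^bsub>free_group X\<^esub> s \<otimes>\<^bsub>free_group X\<^esub> inv\<^bsub>free_group X\<^esub> u | u s.
      u \<in> carrier (free_group X) \<and> s \<in> reduce ` R}" for w
  proof -
    obtain u s' where "u \<in> carrier (free_group X)" "s' \<in> reduce ` R"
      "w = u \<otimes>\<^bsub>free_group X\<^esub> s' \<otimes>\<^bsub>free_group X\<^esub> inv\<^bsub>free_group X\<^esub> u" using w by blast
    then obtain r where u: "u \<in> carrier (free_group X)" "r \<in> R"
      "w = u \<otimes>\<^bsub>free_group X\<^esub> reduce r \<otimes>\<^bsub>free_group X\<^esub> inv\<^bsub>free_group X\<^esub> u" by blast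
    have uw: "u \<in> words X" "reduce u = u" and r: "r \<in> words X"
      using u R by (auto simp: free_group_simps reduce_reduced)
    have e: "w = reduce (u @ r @ winv u)" unfolding u(3) using conj_reduce[OF uw(1) r] uw(2) by simp
    have "P (u @ r @ winv u)" using conj uw rel u by blast
    then have "P w" using red[of "u @ r @ winv u" w] e by simp
    moreover have "w \<in> words X" unfolding e by (rule reduce_words) (use uw r in simp)
    ultimately show ?thesis by blast
  qed
  have "w \<in> words X \<and> P w"
    using w unfolding relator_subgroup_def normal_closure_def
  proof (induction rule: generate.induct)
    case one
    then show ?case using Nil by (simp add: free_group_simps)
  next
    case (incl h)
    then show ?case by (rule c)
  next
    case (inv h)
    then have h: "h \<in> words X" "P h" using c by blast+
    moreover have "h \<in> carrier (free_group X)"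
    proof -
      interpret group "free_group X" by (rule group_free_group)
      show ?thesis using inv R by (auto intro!: m_closed reduce_in_free_group)
    qed
    then have "inv\<^bsub>free_group X\<^esub> h = reduce (winv h)" using inv_free_group[of h X] by (simp add: free_group_simps)
    moreover have "P (reduce (winv h))" using red[of "winv h" "reduce (winv h)"] assms(8) h by simp
    ultimately show ?case by (simp add: reduce_words)
  next
    case (eng h1 h2)
    then show ?case using app[of h1 h2] red[of "h1 @ h2" "reduce (h1 @ h2)"]
      by (auto simp: free_group_simps intro!: reduce_words)
  qed
  then show ?thesis by blast
qed

lemma word_value_eq_iff:
  assumes R: "R \<subseteq> words X" and uv: "u \<in> words X" "v \<in> words X"
  shows "word_value X R u = word_value X R v \<longleftrightarrow> reduce (u @ winv v) \<in> relator_subgroup X R"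
proof -
  interpret N: normal "relator_subgroup X R" "free_group X" by (rule relator_subgroup_normal[OF R])
  have c: "reduce u \<in> carrier (free_group X)" "reduce v \<in> carrier (free_group X)"
    using uv by (auto intro: reduce_in_free_group)
  have e: "reduce u \<otimes>\<^bsub>free_group X\<^esub> inv\<^bsub>free_group X\<^esub> (reduce v) = reduce (u @ winv v)"
    using uv by (simp add: free_group_simps inv_reduce reduce_append_left reduce_append_right)
  show ?thesis unfolding word_value_def e[symmetric]
  proof
    assume "relator_subgroup X R #>\<^bsub>free_group X\<^esub> reduce u = relator_subgroup X R #>\<^bsub>free_group X\<^esub> reduce v"
    then have "reduce u \<in> relator_subgroup X R #>\<^bsub>free_group X\<^esub> reduce v"
      using N.rcos_self[OF c(1) N.subgroup_axioms] by simp
    then obtain h where h: "h \<in> relator_subgroup X R" "reduce u = h \<otimes>\<^bsub>free_group X\<^esub> reduce v"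
      unfolding r_coset_def by blast
    have "h \<in> carrier (free_group X)" using h(1) N.subset by blast
    then have "reduce u \<otimes>\<^bsub>free_group X\<^esub> inv\<^bsub>free_group X\<^esub> (reduce v) = h"
      unfolding h(2) using c by (simp add: N.m_assoc)
    then show "reduce u \<otimes>\<^bsub>free_group X\<^esub> inv\<^bsub>free_group X\<^esub> (reduce v) \<in> relator_subgroup X R" using h by simp
  next
    let ?h = "reduce u \<otimes>\<^bsub>free_group X\<^esub> inv\<^bsub>free_group X\<^esub> (reduce v)"
    assume h: "?h \<in> relator_subgroup X R"
    have "reduce u = ?h \<otimes>\<^bsub>free_group X\<^esub> reduce v" using c by (simp add: N.m_assoc)
    then have "reduce u \<in> relator_subgroup X R #>\<^bsub>free_group X\<^esub> reduce v"
      unfolding r_coset_def using h by blast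
    then show "relator_subgroup X R #>\<^bsub>free_group X\<^esub> reduce u = relator_subgroup X R #>\<^bsub>free_group X\<^esub> reduce v"
      using N.repr_independence[OF _ c(2) N.subgroup_axioms] by simp
  qed
qed

lemma word_value_one_iff:
  assumes R: "R \<subseteq> words X" and u: "u \<in> words X"
  shows "word_value X R u = \<one>\<^bsub>presented_group X R\<^esub> \<longleftrightarrow> reduce u \<in> relator_subgroup X R"
proof -
  interpret N: normal "relator_subgroup X R" "free_group X" by (rule relator_subgroup_normal[OF R])
  have "\<one>\<^bsub>presented_group X R\<^esub> = word_value X R []"
    unfolding presented_group_def word_value_def FactGroup_def
    using N.coset_mult_one[OF N.subset] by (simp add: free_group_simps)
  then show ?thesis using word_value_eq_iff[OF R u, of "[]"] by simp
qed

lemma conjugate_in_iff: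
  assumes R: "R \<subseteq> words X" and uv: "u \<in> words X" "v \<in> words X"
  shows "conjugate_in (presented_group X R) (word_value X R u) (word_value X R v) \<longleftrightarrow>
    (\<exists>g\<in>words X. reduce (v @ winv (g @ u @ winv g)) \<in> relator_subgroup X R)"
proof -
  interpret N: normal "relator_subgroup X R" "free_group X" by (rule relator_subgroup_normal[OF R])
  let ?P = "presented_group X R"
  have wv: "word_value X R g \<otimes>\<^bsub>?P\<^esub> word_value X R u \<otimes>\<^bsub>?P\<^esub> inv\<^bsub>?P\<^esub> (word_value X R g)
      = word_value X R (g @ u @ winv g)" if g: "g \<in> words X" for g
  proof -
    have c: "reduce g \<in> carrier (free_group X)" "reduce u \<in> carrier (free_group X)"
      using g uv by (auto intro: reduce_in_free_group)
    have gc: "word_value X R g \<in> carrier ?P"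
      unfolding word_value_def presented_group_def FactGroup_def RCOSETS_def using c by auto
    have i: "inv\<^bsub>?P\<^esub> (word_value X R g) = relator_subgroup X R #>\<^bsub>free_group X\<^esub> (inv\<^bsub>free_group X\<^esub> (reduce g))"
      using N.inv_FactGroup[of "word_value X R g"] gc N.rcos_inv[OF c(1)]
      unfolding presented_group_def word_value_def by simp
    show ?thesis
      unfolding i unfolding word_value_def conj_reduce[OF g uv(1), symmetric]
      using c by (simp add: presented_group_def FactGroup_def N.rcos_sum)
  qed
  have car: "carrier ?P = word_value X R ` words X"
  proof
    show "carrier ?P \<subseteq> word_value X R ` words X"
    proof
      fix c assume "c \<in> carrier ?P"
      then obtain a where a: "a \<in> carrier (free_group X)" "c = relator_subgroup X R #>\<^bsub>free_group X\<^esub> a"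
        unfolding presented_group_def FactGroup_def RCOSETS_def by auto
      then have "a \<in> words X" "c = word_value X R a"
        by (auto simp: word_value_def free_group_simps reduce_reduced)
      then show "c \<in> word_value X R ` words X" by blast
    qed
    show "word_value X R ` words X \<subseteq> carrier ?P"
      unfolding word_value_def presented_group_def FactGroup_def RCOSETS_def
      by (auto dest: reduce_in_free_group)
  qed
  have "conjugate_in ?P (word_value X R u) (word_value X R v) \<longleftrightarrow>
      (\<exists>g\<in>words X. word_value X R v = word_value X R (g @ u @ winv g))"
    unfolding conjugate_in_def car using wv by auto
  also have "\<dots> \<longleftrightarrow> (\<exists>g\<in>words X. reduce (v @ winv (g @ u @ winv g)) \<in> relator_subgroup X R)"
  proof -
    have "word_value X R v = word_value X R (g @ u @ winv g) \<longleftrightarrow>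
        reduce (v @ winv (g @ u @ winv g)) \<in> relator_subgroup X R" if g: "g \<in> words X" for g
    proof -
      have "g @ u @ winv g \<in> words X" using g uv(1) by simp
      then show ?thesis by (rule word_value_eq_iff[OF R uv(2)])
    qed
    then show ?thesis by blast
  qed
  finally show ?thesis .
qed

text \<open>The upper bound also shows that the minimum in \<open>dehn_function\<close> exists,
  which the lower bound relies on.\<close>

lemma quadratic_dehnI:
  assumes R: "R \<subseteq> words X"
    and upper: "\<And>n w. w \<in> words X \<Longrightarrow> length w \<le> n \<Longrightarrow> n \<ge> 1 \<Longrightarrow> reduce w \<in> relator_subgroup X R \<Longrightarrow>
        fillable X R (K * n * n) w"
    and lower: "\<And>n. \<exists>w\<in>words X. length w \<le> 4 * n \<and> reduce w \<in> relator_subgroup X R \<and> n * n \<le> L * area X R w"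
  shows "quadratic_dehn_function X R"
proof -
  let ?f = "dehn_function X R"
  have bd: "\<forall>w\<in>words X. length w \<le> n \<and> word_value X R w = \<one>\<^bsub>presented_group X R\<^esub> \<longrightarrow> area X R w \<le> K * n * n" for n
  proof (intro ballI impI, elim conjE)
    fix w assume w: "w \<in> words X" "length w \<le> n" "word_value X R w = \<one>\<^bsub>presented_group X R\<^esub>"
    show "area X R w \<le> K * n * n"
    proof (cases "n = 0")
      case True
      then show ?thesis using w area_le[OF fillable_Nil[of X R 0]] by simp
    next
      case False
      then show ?thesis using w word_value_one_iff[OF R w(1)] by (intro area_le upper) auto
    qed
  qed
  have up: "?f n \<le> K * n * n" for n
    unfolding dehn_function_def using bd by (rule Least_le)
  have lo: "n * n \<le> L * ?f (4 * n)" for n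
  proof -
    obtain w where w: "w \<in> words X" "length w \<le> 4 * n" "reduce w \<in> relator_subgroup X R" "n * n \<le> L * area X R w"
      using lower by blast
    have "\<forall>w\<in>words X. length w \<le> 4 * n \<and> word_value X R w = \<one>\<^bsub>presented_group X R\<^esub> \<longrightarrow> area X R w \<le> ?f (4 * n)"
      unfolding dehn_function_def by (rule LeastI[of _ "K * (4 * n) * (4 * n)"], rule bd)
    then have "area X R w \<le> ?f (4 * n)" using w word_value_one_iff[OF R w(1)] by blast
    then show ?thesis using w(4) by (meson le_trans mult_le_mono2)
  qed
  \<comment> \<open>The constant \<open>B = 4\<close> matches the length \<open>4 * n\<close> of the
    words in the lower bound; for the other inequality it suffices that \<open>n / 4\<close> rounded
    down is at most \<open>n\<close>.\<close>
  let ?A = "real (K + L + 1)"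
  show ?thesis
    unfolding quadratic_dehn_function_def equivalent_growth_def
  proof (intro exI conjI allI)
    show "?A \<ge> 1" "(4::real) \<ge> 1" "(1::real) \<ge> 1" "(1::real) \<ge> 1" by simp_all
    fix n
    let ?k = "nat \<lfloor>real n / 4\<rfloor>"
    have "?k \<le> n" by (simp add: nat_le_iff) linarith
    then have "?f ?k \<le> K * n * n" using up[of ?k] by (meson le_trans mult_le_mono mult_le_mono2)
    then have "real (?f ?k) \<le> real (K * n * n)" by (simp only: of_nat_le_iff)
    also have "\<dots> \<le> ?A * (real n)\<^sup>2" by (simp add: power2_eq_square mult.assoc mult_right_mono)
    finally have "1 / ?A * real (?f ?k) \<le> (real n)\<^sup>2" by (simp add: field_simps)
    then show "1 / ?A * real (?f ?k) - 1 * real n - 1 < (real n)\<^sup>2" by simp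
    have "nat \<lfloor>4 * real n\<rfloor> = 4 * n"
    proof -
      have "4 * real n = real_of_int (int (4 * n))" by simp
      then show ?thesis by (simp only: floor_of_int nat_int)
    qed
    moreover have "real (n * n) \<le> real (L * ?f (4 * n))" using lo by (simp only: of_nat_le_iff)
    then have "(real n)\<^sup>2 \<le> real L * real (?f (4 * n))" by (simp add: power2_eq_square)
    moreover have "real L * real (?f (4 * n)) \<le> ?A * real (?f (4 * n))" by (intro mult_right_mono) auto
    ultimately show "(real n)\<^sup>2 < ?A * real (?f (nat \<lfloor>4 * real n\<rfloor>)) + 1 * real n + 1" by simp
  qed
qed

text \<open>Multiplication of upper unitriangular integer \<open>3 \<times> 3\<close> matrices, with
  the corner entry written last.\<close>

definition heis_mul :: "int \<times> int \<times> int \<Rightarrow> int \<times> int \<times> int \<Rightarrow> int \<times> int \<times> int" where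
  "heis_mul = (\<lambda>(a, b, c) (a', b', c'). (a + a', b + b', c + c' + a * b'))"

lemma heis_mul_simp [simp]: "heis_mul (a, b, c) (a', b', c') = (a + a', b + b', c + c' + a * b')"
  by (simp add: heis_mul_def)

definition heis_letter :: "'a \<Rightarrow> 'a \<Rightarrow> 'a letter \<Rightarrow> int \<times> int \<times> int" where
  "heis_letter x y l = ((if fst l = x then (if snd l then 1 else -1) else 0),
     (if fst l = y then (if snd l then 1 else -1) else 0), 0)"

lemma heis_word_hom: "x \<noteq> y \<Longrightarrow> word_hom heis_mul (0, 0, 0) (heis_letter x y)"
  by unfold_locales (auto simp: heis_mul_def heis_letter_def inv_letter_def algebra_simps split: prod.splits)

text \<open>The central coordinate in the Heisenberg group measures the area enclosed by a word in
  two commuting generators; it is additive over conjugates of relators.\<close>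

lemma heis_area_bound:
  assumes xy: "x \<noteq> y" "x \<in> X" "y \<in> X" and R: "R \<subseteq> words X"
    and rel: "\<And>r. r \<in> R \<Longrightarrow> length r \<le> 8" "\<And>r. r \<in> R \<Longrightarrow> expo x r = 0" "\<And>r. r \<in> R \<Longrightarrow> expo y r = 0"
    and w: "w = replicate n (x, True) @ replicate n (y, True) @ replicate n (x, False) @ replicate n (y, False)"
    and fill: "fillable X R k w"
  shows "n * n \<le> 64 * area X R w"
proof -
  interpret word_hom heis_mul "(0, 0, 0)" "heis_letter x y" by (rule heis_word_hom[OF xy(1)])
  \<comment> \<open>The corner entry is at most the square of the length; for relators, of length at
    most 8, this gives the constant 64.\<close>
  have coords: "fst (ev u) = expo x u \<and> fst (snd (ev u)) = expo y u \<and>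
     \<bar>snd (snd (ev u))\<bar> \<le> int (length u) * int (length u)" for u
  proof (induction u)
    case (Cons l u)
    obtain a b c where e: "ev u = (a, b, c)" by (metis prod_cases3)
    have h: "a = expo x u" "b = expo y u" "\<bar>c\<bar> \<le> int (length u) * int (length u)" using Cons e by auto
    obtain p q where l: "heis_letter x y l = (p, q, 0)" "\<bar>p\<bar> \<le> 1"
      "expo x (l # u) = p + expo x u" "expo y (l # u) = q + expo y u"
      by (simp add: heis_letter_def)
    have "\<bar>b\<bar> \<le> int (length u)" using expo_bound[of y u] h by simp
    moreover have "p = 0 \<or> p = 1 \<or> p = -1" using l(2) by linarith
    ultimately have "\<bar>p * b\<bar> \<le> int (length u)" by auto
    then have "\<bar>c + p * b\<bar> \<le> int (length u) * int (length u) + 2 * int (length u) + 1"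
      using h(3) by linarith
    moreover have "int (length (l # u)) * int (length (l # u)) =
        int (length u) * int (length u) + 2 * int (length u) + 1" by (simp add: algebra_simps)
    moreover have "ev (l # u) = (p + a, q + b, c + p * b)"
      unfolding ev_Cons e l by (simp add: heis_mul_def)
    ultimately show ?case using l(3,4) h(1,2) by (simp only: fst_conv snd_conv)
  qed simp
  have central: "ev (u @ s @ winv u) = (0, 0, c)" if "ev s = (0, 0, c)" for u s c
  proof -
    obtain a b d where u: "ev u = (a, b, d)" by (metis prod_cases3)
    obtain a' b' d' where u': "ev (winv u) = (a', b', d')" by (metis prod_cases3)
    show ?thesis using ev_winv[of u] unfolding ev_append that u u' by (simp add: heis_mul_def)
  qed
  have rc: "\<exists>c. ev s = (0, 0, c) \<and> \<bar>c\<bar> \<le> 64" if "s \<in> relator_conjugates X R" for s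
  proof -
    obtain u r t where s: "s = u \<otimes>\<^bsub>free_group X\<^esub> t \<otimes>\<^bsub>free_group X\<^esub> inv\<^bsub>free_group X\<^esub> u"
      "u \<in> carrier (free_group X)" "r \<in> R" "t = reduce r \<or> t = inv\<^bsub>free_group X\<^esub> (reduce r)"
      using \<open>s \<in> relator_conjugates X R\<close> unfolding relator_conjugates_def by blast
    have r: "r \<in> words X" using s R by auto
    have u: "u \<in> words X" "reduce u = u" using s(2) by (auto simp: free_group_simps reduce_reduced)
    obtain r' where r': "r' = r \<or> r' = winv r" "t = reduce r'" using s(4) r by (auto simp: inv_reduce)
    have "r' \<in> words X" using r' r by auto
    then have "s = reduce (u @ r' @ winv u)" using conj_reduce[OF u(1), of r'] unfolding s(1) r'(2) u(2) by simp
    then have e: "ev s = ev (u @ r' @ winv u)" by (simp add: ev_reduce)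
    have "int (length r) * int (length r) \<le> 8 * 8" using rel(1)[OF s(3)] by (intro mult_mono) auto
    then obtain c where c: "ev r = (0, 0, c)" "\<bar>c\<bar> \<le> 64"
      using coords[of r] rel(2,3)[OF s(3)] by (cases "ev r") auto
    have "ev (winv r) = (0, 0, - c)"
      using ev_winv[of r] unfolding c(1) by (cases "ev (winv r)") (auto simp: heis_mul_def)
    then have "ev r' = (0, 0, c) \<or> ev r' = (0, 0, - c)" using r'(1) c(1) by blast
    then show ?thesis unfolding e using central c(2) by (metis abs_minus_cancel)
  qed
  have prod: "\<exists>c. ev (foldr (monoid.mult (free_group X)) vs \<one>\<^bsub>free_group X\<^esub>) = (0, 0, c) \<and> \<bar>c\<bar> \<le> 64 * int (length vs)"
    if "set vs \<subseteq> relator_conjugates X R" for vs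
    using that
  proof (induction vs)
    case Nil
    then show ?case by (simp add: free_group_simps)
  next
    case (Cons s vs)
    then obtain c c' where c: "ev (foldr (monoid.mult (free_group X)) vs \<one>\<^bsub>free_group X\<^esub>) = (0, 0, c)"
      "\<bar>c\<bar> \<le> 64 * int (length vs)" "ev s = (0, 0, c')" "\<bar>c'\<bar> \<le> 64"
      using rc[of s] by auto
    have "ev (foldr (monoid.mult (free_group X)) (s # vs) \<one>\<^bsub>free_group X\<^esub>) = (0, 0, c' + c)"
      by (simp add: free_group_simps(2) ev_reduce ev_append c)
    then show ?case using c by (intro exI[of _ "c' + c"]) auto
  qed
  obtain vs where vs: "length vs \<le> area X R w" "set vs \<subseteq> relator_conjugates X R"
     "reduce w = foldr (monoid.mult (free_group X)) vs \<one>\<^bsub>free_group X\<^esub>"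
    using area_fillable[OF fill] unfolding fillable_def by blast
  have rep: "ev (replicate n (x, b)) = ((if b then int n else - int n), 0, 0)"
    "ev (replicate n (y, b)) = (0, (if b then int n else - int n), 0)" for b
  proof -
    have hx: "heis_letter x y (x, b) = (if b then 1 else - 1, 0, 0)" "heis_letter x y (y, b) = (0, if b then 1 else - 1, 0)"
      using xy(1) by (auto simp: heis_letter_def)
    show "ev (replicate n (x, b)) = ((if b then int n else - int n), 0, 0)"
      by (induction n) (simp_all add: ev_Cons hx)
    show "ev (replicate n (y, b)) = (0, (if b then int n else - int n), 0)"
      by (induction n) (simp_all add: ev_Cons hx)
  qed
  have "ev w = (0, 0, int n * int n)"
    unfolding w ev_append rep by simp
  moreover have "ev w = ev (foldr (monoid.mult (free_group X)) vs \<one>\<^bsub>free_group X\<^esub>)"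
    using vs(3) ev_reduce[of w] by simp
  ultimately have "int n * int n \<le> 64 * int (length vs)" using prod[OF vs(2)] by auto
  then have "int (n * n) \<le> int (64 * length vs)" by simp
  then have "n * n \<le> 64 * length vs" by (simp only: of_nat_le_iff)
  then show ?thesis using vs(1) by simp
qed

section \<open>Presentations of extensions of lattices\<close>

lemma reduce_invariant:
  assumes "\<And>a w w'. F w = F w' \<Longrightarrow> F (a # w) = F (a # w')" "\<And>a w. F (a # inv_letter a # w) = F w"
  shows "F (reduce w) = F w"
proof (induction w)
  case (Cons a w)
  have "F (cons_red a u) = F (a # u)" for u
  proof (cases u)
    case (Cons b u')
    then show ?thesis using assms(2)[of a u'] by simp
  qed simp
  then show ?case using assms(1)[OF Cons.IH, of a] by (simp add: reduce_def)
qed simp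

text \<open>\<open>rho\<close> rounds to a lattice, the set of its fixed points. Words with arbitrary translations
  are turned into words over the finite set \<open>gens\<close> by rounding all intermediate positions;
  \<open>defect\<close> is the correction needed because \<open>rho\<close> does not commute with the action.\<close>

locale tame_lattice = tame +
  fixes rho :: "'b \<Rightarrow> 'b" and enc :: "'a + 'b \<Rightarrow> nat"
  assumes rho_add: "rho (a + b) = rho a + rho b"
    and rho_idem: "rho (rho a) = rho a"
    and rho_act: "rho a = a \<Longrightarrow> rho (act q a) = act q a"
    and rho_U: "a - rho a \<in> U 0"
    and U_minus: "a \<in> U c \<Longrightarrow> - a \<in> U c"
    and finite_Y: "finite Y"
    and finite_lattice: "finite {a \<in> U \<kappa>. rho a = a}"
    and inj_enc: "inj_on enc (Inl ` Y \<union> Inr ` {a \<in> U \<kappa>. rho a = a})"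
begin

definition lat :: "'b set" where "lat = {a \<in> U \<kappa>. rho a = a}"
definition gens :: "nat set" where "gens = enc ` (Inl ` Y \<union> Inr ` lat)"

lemma rho_minus: "rho (- a) = - rho a"
proof -
  have "rho 0 = 0" using rho_add[of 0 0] by simp
  then show ?thesis using rho_add[of a "- a"] by (simp add: eq_neg_iff_add_eq_0 add.commute)
qed

lemma lat_minus: "a \<in> lat \<Longrightarrow> - a \<in> lat"
  by (simp add: lat_def U_minus rho_minus)

lemma lat_0: "0 \<in> lat"
  using rho_add[of 0 0] by (simp add: lat_def U_0)

definition dec :: "nat \<Rightarrow> 'a + 'b" where
  "dec = inv_into (Inl ` Y \<union> Inr ` lat) enc"

lemma dec_enc: "x \<in> Inl ` Y \<union> Inr ` lat \<Longrightarrow> dec (enc x) = x"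
  unfolding dec_def using inj_enc by (intro inv_into_f_f) (simp_all add: lat_def)

lemma enc_Inl: "y \<in> Y \<Longrightarrow> dec (enc (Inl y)) = Inl y"
  and enc_Inr: "a \<in> lat \<Longrightarrow> dec (enc (Inr a)) = Inr a"
  by (simp_all add: dec_enc)

lemma gens_cases:
  assumes "n \<in> gens"
  obtains y where "y \<in> Y" "n = enc (Inl y)" | a where "a \<in> lat" "n = enc (Inr a)"
  using assms unfolding gens_def by blast

definition sl :: "nat letter \<Rightarrow> ('a, 'b) slet" where
  "sl l = (case dec (fst l) of Inl y \<Rightarrow> Q (y, snd l) | Inr a \<Rightarrow> T (if snd l then a else - a))"

definition sw :: "nat word \<Rightarrow> ('a, 'b) slet list" where "sw = map sl"

lemma sw_simps [simp]: "sw [] = []" "sw (l # w) = sl l # sw w" "sw (u @ w) = sw u @ sw w"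
  by (simp_all add: sw_def)

definition qfree :: "'a letter list \<Rightarrow> 'a letter list" where
  "qfree qs = filter (\<lambda>q. fst q \<notin> v ` {..<3}) qs"

lemma qfree_simps [simp]: "qfree [] = []" "qfree (u @ w) = qfree u @ qfree w"
  by (simp_all add: qfree_def)

text \<open>The good words are those representing \<open>1\<close> in the split extension of the lattice by the
  product of a free group and \<open>\<int>\<^sup>3\<close>, the latter generated by the \<open>v j\<close>.\<close>

definition good :: "('a, 'b) slet list \<Rightarrow> bool" where
  "good s \<longleftrightarrow> (\<forall>a. st a s = a) \<and> reduce (qfree (qpart s)) = [] \<and> (\<forall>j<3. expo (v j) (qpart s) = 0)"

lemma sl_inv: "sstep (sstep a (sl l)) (sl (inv_letter l)) = a"
proof (cases "dec (fst l)")
  case (Inl y)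
  have "act (inv_letter (y, \<not> snd l)) (act (inv_letter (inv_letter (y, \<not> snd l))) a) = a" by (rule act_inv)
  then show ?thesis using Inl by (simp add: sl_def inv_letter_def)
qed (simp add: sl_def inv_letter_def)

lemma qpart_cancel:
  obtains "qpart (sw (a # inv_letter a # w)) = qpart (sw w)" |
    q where "qpart (sw (a # inv_letter a # w)) = [q, inv_letter q] @ qpart (sw w)"
  by (cases "dec (fst a)") (auto simp: sl_def inv_letter_def)

lemma st_reduce: "st a (sw (reduce w)) = st a (sw w)"
proof -
  have "(\<lambda>a. st a (sw (reduce w))) = (\<lambda>a. st a (sw w))"
    by (rule reduce_invariant[of "\<lambda>w a. st a (sw w)"]) (simp_all add: fun_eq_iff sl_inv)
  then show ?thesis by meson
qed

lemma qpart_Cons: "qpart (x # s) = qpart [x] @ qpart s"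
  using qpart_append[of "[x]" s] by simp

lemma reduce_qfree_cancel: "reduce (qfree [q, inv_letter q] @ w) = reduce w"
  using reduce_cancel[of "[]" q w] by (simp add: qfree_def)

lemma qfree_reduce: "reduce (qfree (qpart (sw (reduce w)))) = reduce (qfree (qpart (sw w)))"
proof (rule reduce_invariant[of "\<lambda>w. reduce (qfree (qpart (sw w)))"])
  fix a :: "nat letter" and w w' :: "nat word"
  show "reduce (qfree (qpart (sw (a # w)))) = reduce (qfree (qpart (sw (a # w'))))"
    if "reduce (qfree (qpart (sw w))) = reduce (qfree (qpart (sw w')))"
    using that by (metis sw_simps(2) qpart_Cons qfree_simps(2) reduce_append_right)
  show "reduce (qfree (qpart (sw (a # inv_letter a # w)))) = reduce (qfree (qpart (sw w)))"
  proof (rule qpart_cancel[of a w])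
    fix q assume e: "qpart (sw (a # inv_letter a # w)) = [q, inv_letter q] @ qpart (sw w)"
    show ?thesis unfolding e qfree_simps(2) by (rule reduce_qfree_cancel)
  qed simp
qed

lemma expo_reduce: "expo y (qpart (sw (reduce w))) = expo y (qpart (sw w))"
proof (rule reduce_invariant[of "\<lambda>w. expo y (qpart (sw w))"])
  fix a :: "nat letter" and w w' :: "nat word"
  show "expo y (qpart (sw (a # w))) = expo y (qpart (sw (a # w')))"
    if "expo y (qpart (sw w)) = expo y (qpart (sw w'))"
    using that by (metis sw_simps(2) qpart_Cons expo_simps(3))
  show "expo y (qpart (sw (a # inv_letter a # w))) = expo y (qpart (sw w))"
  proof (rule qpart_cancel[of a w])
    fix q assume e: "qpart (sw (a # inv_letter a # w)) = [q, inv_letter q] @ qpart (sw w)"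
    show ?thesis unfolding e expo_simps(3) by (simp add: inv_letter_def)
  qed simp
qed

lemma good_reduce: "reduce u = reduce w \<Longrightarrow> good (sw u) \<longleftrightarrow> good (sw w)"
  unfolding good_def by (metis st_reduce qfree_reduce expo_reduce)

lemma good_Nil: "good []"
  by (simp add: good_def)

lemma good_append: "good s \<Longrightarrow> good t \<Longrightarrow> good (s @ t)"
  unfolding good_def by simp (metis append_Nil reduce_append_left)

lemma st_winv: "st (st a (sw u)) (sw (winv u)) = a"
  using st_reduce[of a "u @ winv u"] reduce_cancel_words[of "[]" u "[]"] by simp

lemma expo_winv: "expo y (qpart (sw u)) + expo y (qpart (sw (winv u))) = 0"
  using expo_reduce[of y "u @ winv u"] reduce_cancel_words[of "[]" u "[]"] by simp

lemma qfree_winv: "reduce (qfree (qpart (sw u)) @ qfree (qpart (sw (winv u)))) = []"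
  using qfree_reduce[of "u @ winv u"] reduce_cancel_words[of "[]" u "[]"] by simp

lemma good_conj: "good (sw w) \<Longrightarrow> good (sw (u @ w @ winv u))"
  unfolding good_def
proof (elim conjE, intro conjI allI impI)
  assume h: "\<forall>a. st a (sw w) = a" "reduce (qfree (qpart (sw w))) = []" "\<forall>j<3. expo (v j) (qpart (sw w)) = 0"
  show "st a (sw (u @ w @ winv u)) = a" for a using h(1) st_winv[of a u] by simp
  have "reduce (qfree (qpart (sw u)) @ qfree (qpart (sw w)) @ qfree (qpart (sw (winv u)))) =
      reduce (qfree (qpart (sw u)) @ qfree (qpart (sw (winv u))))"
    using h(2) by (metis append_Nil reduce_append_left reduce_append_right)
  then show "reduce (qfree (qpart (sw (u @ w @ winv u)))) = []" using qfree_winv[of u] by simp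
  show "expo (v j) (qpart (sw (u @ w @ winv u))) = 0" if "j < 3" for j
    using h(3) that expo_winv[of "v j" u] by simp
qed

lemma good_quotient:
  assumes "\<And>a. st a (sw u) = st a (sw w)" "reduce (qfree (qpart (sw u))) = reduce (qfree (qpart (sw w)))"
    "\<And>j. j < 3 \<Longrightarrow> expo (v j) (qpart (sw u)) = expo (v j) (qpart (sw w))"
  shows "good (sw (u @ winv w))"
  unfolding good_def
proof (intro conjI allI impI)
  show "st a (sw (u @ winv w)) = a" for a using assms(1) st_winv[of a w] by simp
  have "reduce (qfree (qpart (sw u)) @ qfree (qpart (sw (winv w)))) =
      reduce (qfree (qpart (sw w)) @ qfree (qpart (sw (winv w))))"
    using assms(2) by (metis reduce_append_left)
  then show "reduce (qfree (qpart (sw (u @ winv w)))) = []" using qfree_winv[of w] by simp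
  show "expo (v j) (qpart (sw (u @ winv w))) = 0" if "j < 3" for j
    using assms(3)[OF that] expo_winv[of "v j" w] by simp
qed

lemma good_winv: "good (sw w) \<Longrightarrow> good (sw (winv w))"
  using good_quotient[of "[]" w] by (simp add: good_def)

text \<open>The bound 8 is the total length of both sides of a move after rounding. It is attained
  by \<open>mV\<close>, where each of the two letters on either side is followed by a
  correction.\<close>

definition rels :: "nat word set" where
  "rels = {w \<in> words gens. length w \<le> 8 \<and> good (sw w)}"

lemma finite_gens: "finite gens"
  unfolding gens_def using finite_Y finite_lattice by (simp add: lat_def)

lemma finite_presentation_rels: "finite_presentation gens rels"
proof -
  have "rels \<subseteq> {w. set w \<subseteq> gens \<times> UNIV \<and> length w \<le> 8}"
    by (auto simp: rels_def words_def)
  moreover have "finite {w. set w \<subseteq> gens \<times> (UNIV :: bool set) \<and> length w \<le> 8}"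
    by (intro finite_lists_length_le finite_cartesian_product finite_gens) simp
  ultimately show ?thesis unfolding finite_presentation_def
    using finite_gens finite_subset by (auto simp: rels_def)
qed

lemma rels_words: "rels \<subseteq> words gens"
  by (auto simp: rels_def)

lemma relator_subgroup_good:
  assumes "reduce w \<in> relator_subgroup gens rels"
  shows "good (sw w)"
proof -
  have "good (sw (reduce w))"
  proof (rule relator_subgroup_induct[OF rels_words assms, of "\<lambda>w. good (sw w)"])
    show "good (sw r)" if "r \<in> rels" for r using that by (simp add: rels_def)
    show "good (sw w)" if "reduce u = reduce w" "good (sw u)" for u w using that good_reduce by blast
    show "good (sw [])" by (simp add: good_Nil)
    show "good (sw (u @ w))" if "good (sw u)" "good (sw w)" for u w
      unfolding sw_simps(3) by (rule good_append[OF that])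
    show "good (sw (u @ w @ winv u))" if "good (sw w)" for u w by (rule good_conj[OF that])
    show "good (sw (winv u))" if "good (sw u)" for u by (rule good_winv[OF that])
  qed
  then show ?thesis using good_reduce[of "reduce w" w] by simp
qed

section \<open>Rounding derivations to the lattice\<close>

definition ql :: "'a letter \<Rightarrow> nat letter" where "ql q = (enc (Inl (fst q)), snd q)"
definition tl :: "'b \<Rightarrow> nat letter" where "tl a = (enc (Inr a), True)"

lemma sl_ql: "fst q \<in> Y \<Longrightarrow> sl (ql q) = Q q"
  by (simp add: sl_def ql_def enc_Inl)

lemma sl_tl: "a \<in> lat \<Longrightarrow> sl (tl a) = T a"
  by (simp add: sl_def tl_def enc_Inr)

lemma gens_ql [simp]: "fst q \<in> Y \<Longrightarrow> fst (ql q) \<in> gens"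
  by (simp add: ql_def gens_def)

lemma gens_tl [simp]: "a \<in> lat \<Longrightarrow> fst (tl a) \<in> gens"
  by (simp add: tl_def gens_def)

definition defect :: "'a letter \<Rightarrow> 'b \<Rightarrow> 'b" where
  "defect q a = rho (act (inv_letter q) a) - act (inv_letter q) (rho a)"

fun proj :: "'b \<Rightarrow> ('a, 'b) slet list \<Rightarrow> nat word" where
  "proj a [] = []"
| "proj a (Q q # s) = ql q # tl (defect q a) # proj (act (inv_letter q) a) s"
| "proj a (T b # s) = tl (rho b) # proj (a + b) s"

lemma proj_append: "proj a (s @ t) = proj a s @ proj (st a s) t"
  by (induction s arbitrary: a rule: qpart.induct) simp_all

lemma act_minus: "act q (- a) = - act q a"
  using act_add[of q a "- a"] by (simp add: eq_neg_iff_add_eq_0 add.commute)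

lemma act_diff: "act q (a - b) = act q a - act q b"
  using act_add[of q a "- b"] by (simp add: act_minus)

lemma rho_diff: "rho (a - b) = rho a - rho b"
  using rho_add[of a "- b"] by (simp add: rho_minus)

lemma rho_lat:
  assumes "a \<in> U \<kappa>"
  shows "rho a \<in> lat"
proof -
  have "a - rho a \<in> U \<kappa>" using rho_U[of a] U_mono[of 0 \<kappa>] by auto
  then have "a + - (a - rho a) \<in> U \<kappa>" by (intro U_add U_minus assms)
  then show ?thesis by (simp add: lat_def rho_idem)
qed

text \<open>The difference between \<open>a\<close> and its rounding lies in \<open>U 0\<close>, and
  one letter enlarges it to size at most \<open>\<kappa>\<close>. The correction is therefore one of
  finitely many generators, however large \<open>a\<close> is.\<close>

lemma defect_lat:
  assumes "fst q \<in> Y"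
  shows "defect q a \<in> lat"
proof -
  have "defect q a = rho (act (inv_letter q) (a - rho a))"
    unfolding defect_def act_diff rho_diff using rho_act[OF rho_idem] by simp
  moreover have "act (inv_letter q) (a - rho a) \<in> U (0 + \<kappa>)"
    using rho_U assms by (intro act_U) auto
  ultimately show ?thesis using rho_lat by simp
qed

lemma proj_words: "list_all vlet s \<Longrightarrow> proj a s \<in> words gens"
  by (induction s arbitrary: a rule: qpart.induct) (auto simp: defect_lat rho_lat)

lemma qpart_proj: "list_all vlet s \<Longrightarrow> qpart (sw (proj a s)) = qpart s"
  by (induction s arbitrary: a rule: qpart.induct) (auto simp: sl_ql sl_tl defect_lat rho_lat)

lemma st_proj: "list_all vlet s \<Longrightarrow> st (rho a) (sw (proj a s)) = rho (st a s)"
proof (induction s arbitrary: a rule: qpart.induct)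
  case (2 q s)
  have "act (inv_letter q) (rho a) + defect q a = rho (act (inv_letter q) a)" by (simp add: defect_def)
  then show ?case using 2 by (simp add: sl_ql sl_tl defect_lat)
next
  case (3 b s)
  then show ?case by (simp add: sl_tl rho_lat rho_add[symmetric])
qed simp

lemma st_shift: "st (a + b) s = st a s + qact (qpart s) b"
  using st_qact[of "a + b" s] st_qact[of a s] by (simp add: qact_add algebra_simps)

text \<open>Affine maps with equal linear parts agree everywhere once they agree at one point. The
  rounded sides of a move are under control only at the point \<open>rho b\<close>.\<close>

lemma st_eq_everywhere:
  assumes "qact (qpart s) = qact (qpart t)" "st b s = st b t"
  shows "st a s = st a t"
  using st_shift[of b "a - b" s] st_shift[of b "a - b" t] assms by simp

lemma mv_invariants:
  assumes "mv l r"
  shows "st a l = st a r" "qact (qpart l) = qact (qpart r)"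
    "reduce (qfree (qpart l)) = reduce (qfree (qpart r))"
    "j < 3 \<Longrightarrow> expo (v j) (qpart l) = expo (v j) (qpart r)"
    "list_all vlet l" "list_all vlet r" "length (proj a l) + length (proj a r) \<le> 8"
proof -
  have vc: "act (inv_letter q) (act (inv_letter (v j, b)) x) = act (inv_letter (v j, b)) (act (inv_letter q) x)"
    if "j < 3" for j q b x
    using v_comm[OF that, of "\<not> b" "inv_letter q" x] by (simp add: inv_letter_def)
  have i: "act (inv_letter q) (act q x) = x" for q x
    using act_inv[of "inv_letter q" x] by simp
  show "st a l = st a r"
    using assms by cases (auto simp: add.assoc i act_inv act_add vc)
  show "qact (qpart l) = qact (qpart r)"
    using assms by cases (auto simp: i act_inv vc fun_eq_iff)
  show "reduce (qfree (qpart l)) = reduce (qfree (qpart r))"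
    using assms
  proof cases
    case (mI q)
    then show ?thesis using reduce_qfree_cancel[of q "[]"] by simp
  qed (auto simp: qfree_def)
  show "j < 3 \<Longrightarrow> expo (v j) (qpart l) = expo (v j) (qpart r)"
    using assms by cases (auto simp: inv_letter_def)
  show "list_all vlet l" "list_all vlet r" using assms by (cases; auto simp: U_add U_0 v_Y)+
  show "length (proj a l) + length (proj a r) \<le> 8" using assms by cases auto
qed

lemma length_winv [simp]: "length (winv w) = length w"
  by (simp add: winv_def)

lemma proj_rel:
  assumes inv: "st b l = st b r" "qact (qpart l) = qact (qpart r)"
    "reduce (qfree (qpart l)) = reduce (qfree (qpart r))"
    "\<And>j. j < 3 \<Longrightarrow> expo (v j) (qpart l) = expo (v j) (qpart r)"
    and val: "list_all vlet l" "list_all vlet r" and len: "length (proj b l) + length (proj b r) \<le> 8"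
  shows "proj b l @ winv (proj b r) \<in> rels"
proof -
  have "st a (sw (proj b l)) = st a (sw (proj b r))" for a
    by (rule st_eq_everywhere[of _ _ "rho b"]) (use inv val in \<open>simp_all add: qpart_proj st_proj\<close>)
  then have "good (sw (proj b l @ winv (proj b r)))"
    by (intro good_quotient) (use inv val in \<open>simp_all add: qpart_proj\<close>)
  then show ?thesis unfolding rels_def using val len by (simp add: proj_words)
qed

text \<open>Both sides of a move lead to the same position, so the rounding of the rest of the word
  is unchanged and one move becomes one relator.\<close>

lemma fillable_proj: "dm n [] s \<Longrightarrow> list_all vlet s \<and> fillable gens rels n (proj 0 s)"
proof (induction "[] :: ('a, 'b) slet list" s rule: der.induct)
  case (refl n)
  then show ?case by (simp add: fillable_Nil)
next
  case (step n p l q r)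
  note IH = step.hyps(2)
  have lr: "st a l = st a r" "qact (qpart l) = qact (qpart r)"
    "reduce (qfree (qpart l)) = reduce (qfree (qpart r))"
    "j < 3 \<Longrightarrow> expo (v j) (qpart l) = expo (v j) (qpart r)"
    "list_all vlet l" "list_all vlet r" "length (proj a l) + length (proj a r) \<le> 8" for a j
    using step.hyps(3) mv_invariants[of l r] mv_invariants[of r l] by (metis add.commute)+
  let ?b = "st 0 p"
  have val: "list_all vlet p" "list_all vlet q" using IH by simp_all
  have f: "fillable gens rels n (proj 0 p @ proj ?b l @ proj (st ?b r) q)"
    using IH lr(1)[of ?b] by (simp add: proj_append)
  have "fillable gens rels (Suc n) (proj 0 p @ proj ?b r @ proj (st ?b r) q)"
    by (rule fillable_step[OF rels_words f])
      (use val lr(5,6) in \<open>simp_all add: proj_words proj_rel[OF lr(1-7)]\<close>)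
  then show ?case using val lr(6) by (simp add: proj_append)
qed

text \<open>From a lattice point all defects along a lattice word vanish, so rounding only inserts
  letters \<open>tl 0\<close> and rewrites translation letters as positive ones; one relator per
  letter restores the word.\<close>

lemma proj_lattice_word:
  assumes "rho a = a" "p \<in> words gens" "w \<in> words gens" "fillable gens rels m (p @ proj a (sw w))"
  shows "fillable gens rels (m + length w) (p @ w)"
  using assms
proof (induction w arbitrary: a p m)
  case (Cons l w)
  have l: "fst l \<in> gens" and w: "w \<in> words gens" using Cons.prems(3) by simp_all
  from l show ?case
  proof (cases rule: gens_cases)
    case (1 y)
    then have lq: "l = ql (y, snd l)" by (cases l) (simp add: ql_def)
    have slq: "sl l = Q (y, snd l)" by (subst lq) (rule sl_ql, use 1 in simp)
    let ?q = "(y, snd l)"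
    have d: "defect ?q a = 0" using Cons.prems(1) rho_act by (simp add: defect_def)
    have P: "proj a (sw (l # w)) = [l, tl 0] @ proj (act (inv_letter ?q) a) (sw w)"
      using d lq by (simp add: slq)
    have "good (sw ([l] @ winv [l, tl 0]))"
      by (rule good_quotient) (simp_all add: sl_tl lat_0 slq)
    then have r: "[l] @ winv [l, tl 0] \<in> rels" unfolding rels_def using l by (simp add: lat_0)
    have "fillable gens rels (Suc m) (p @ [l] @ proj (act (inv_letter ?q) a) (sw w))"
      by (rule fillable_step[OF rels_words, of m p "[l, tl 0]"])
        (use Cons.prems P r l lat_0 in auto)
    then have "fillable gens rels (Suc m) ((p @ [l]) @ proj (act (inv_letter ?q) a) (sw w))" by simp
    from Cons.IH[OF _ _ w this] show ?thesis using Cons.prems rho_act l by simp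
  next
    case (2 b)
    define b' where "b' = (if snd l then b else - b)"
    have b': "b' \<in> lat" using 2 lat_minus by (simp add: b'_def)
    have slt: "sl l = T b'" using 2 by (cases l) (simp add: sl_def enc_Inr b'_def)
    have rb: "rho b' = b'" using b' by (simp add: lat_def)
    have P: "proj a (sw (l # w)) = [tl b'] @ proj (a + b') (sw w)" by (simp add: slt rb)
    have "good (sw ([l] @ winv [tl b']))"
      by (rule good_quotient) (simp_all add: sl_tl b' slt)
    then have r: "[l] @ winv [tl b'] \<in> rels" unfolding rels_def using l b' by simp
    have "fillable gens rels (Suc m) (p @ [l] @ proj (a + b') (sw w))"
      by (rule fillable_step[OF rels_words, of m p "[tl b']"])
        (use Cons.prems P r l b' in auto)
    then have "fillable gens rels (Suc m) ((p @ [l]) @ proj (a + b') (sw w))" by simp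
    from Cons.IH[OF _ _ w this] show ?thesis using Cons.prems rho_add rb l by simp
  qed
qed simp

lemma vlet_sw: "w \<in> words gens \<Longrightarrow> list_all vlet (sw w)"
proof (induction w)
  case (Cons l w)
  have "fst l \<in> gens" using Cons.prems by simp
  then have "vlet (sl l)"
  proof (cases rule: gens_cases)
    case (1 y)
    then show ?thesis by (cases l) (simp add: sl_def enc_Inl)
  next
    case (2 a)
    then show ?thesis using U_minus by (cases l) (auto simp: sl_def enc_Inr lat_def)
  qed
  then show ?case using Cons by simp
qed simp

text \<open>The constant of \<open>quadratic_filling\<close> increased by 1, for the relators that
  restore a word from its rounding.\<close>

definition dehnc :: nat where "dehnc = 4 * fillc + 6 * \<kappa> + 8"

theorem fillable_good:
  assumes w: "w \<in> words gens" "length w \<le> n" "n \<ge> 1" and good: "good (sw w)"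
  shows "fillable gens rels (dehnc * n * n) w"
proof -
  have "dm ((4 * fillc + 6 * \<kappa> + 7) * n * n) (sw w) []"
    by (rule quadratic_filling[OF vlet_sw[OF w(1)]])
      (use w good in \<open>auto simp: good_def sw_def qfree_def\<close>)
  then have "fillable gens rels ((4 * fillc + 6 * \<kappa> + 7) * n * n) (proj 0 (sw w))"
    using fillable_proj der_sym by blast
  then have "fillable gens rels ((4 * fillc + 6 * \<kappa> + 7) * n * n + length w) ([] @ w)"
    by (intro proj_lattice_word[of 0]) (use w lat_0 in \<open>simp_all add: lat_def\<close>)
  then have "fillable gens rels ((4 * fillc + 6 * \<kappa> + 7) * n * n + length w) w" by simp
  then show ?thesis
  proof (rule fillable_mono)
    have "length w \<le> n * n" using w by (meson le_trans le_square)
    then show "(4 * fillc + 6 * \<kappa> + 7) * n * n + length w \<le> dehnc * n * n"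
      by (simp add: dehnc_def algebra_simps)
  qed
qed

text \<open>This identifies the presented group with the split extension: every good word has been
  filled by the short good words.\<close>

lemma good_iff: "w \<in> words gens \<Longrightarrow> reduce w \<in> relator_subgroup gens rels \<longleftrightarrow> good (sw w)"
  using relator_subgroup_good fillable_subgroup[OF rels_words] fillable_good[of w "Suc (length w)"] by auto

lemma dm_st: "dm n s t \<Longrightarrow> st a s = st a t"
proof (induction rule: der.induct)
  case (step n u p l q r)
  then show ?case using mv_invariants(1)[of l r] mv_invariants(1)[of r l] by auto
qed simp

lemma expo_enc: "w \<in> words gens \<Longrightarrow> y \<in> Y \<Longrightarrow> expo (enc (Inl y)) w = expo y (qpart (sw w))"
proof (induction w)
  case (Cons l w)
  have "fst l \<in> gens" using Cons.prems by simp
  then show ?case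
  proof (cases rule: gens_cases)
    case (1 z)
    have "enc (Inl z) = enc (Inl y) \<longleftrightarrow> z = y" using 1 Cons.prems enc_Inl by (metis sum.inject(1))
    then show ?thesis using Cons 1 by (simp add: sl_def enc_Inl)
  next
    case (2 a)
    have "enc (Inr a) \<noteq> enc (Inl y)" using 2 Cons.prems enc_Inl enc_Inr by (metis sum.distinct(2))
    then show ?thesis using Cons 2 by (simp add: sl_def enc_Inr)
  qed
qed simp

lemma qpart_map_Q [simp]: "qpart (map Q qs) = qs"
  by (induction qs) auto

lemma commutator_good:
  "good (replicate n (Q (v 0, True)) @ replicate n (Q (v 1, True)) @ replicate n (Q (v 0, False)) @ replicate n (Q (v 1, False)))"
  (is "good ?s")
proof -
  let ?a = "\<lambda>b. replicate n (Q (v 0, b))" and ?b = "\<lambda>b. replicate n (Q (v 1, b))"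
  have Y: "v 0 \<in> Y" "v 1 \<in> Y" using v_Y by simp_all
  have 1: "dm (n * n) ([] @ (?a True @ ?b True) @ (?a False @ ?b False)) ([] @ (?b True @ ?a True) @ (?a False @ ?b False))"
    by (rule der_ctx[OF commute]) (use Y in auto)
  have 2: "dm n (?b True @ (?a True @ ?a False) @ ?b False) (?b True @ [] @ ?b False)"
    by (rule der_ctx) (use cancel[of "(v 0, True)" n] Y in \<open>simp add: inv_letter_def\<close>)
  have 3: "dm n (?b True @ ?b False) []"
    using cancel[of "(v 1, True)" n] Y by (simp add: inv_letter_def)
  have st: "st a ?s = a" for a using dm_st[OF 1, of a] dm_st[OF 2, of a] dm_st[OF 3, of a] by simp
  let ?q = "replicate n (v 0, True) @ replicate n (v 1, True) @ replicate n (v 0, False) @ replicate n (v 1, False)"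
  have s: "?s = map Q ?q" by simp
  have e: "expo y (replicate n (x, b)) = (if x = y then (if b then int n else - int n) else 0)" for x y :: 'a and b
    by (induction n) auto
  have "qfree ?q = []" unfolding qfree_def by (auto simp: filter_empty_conv)
  moreover have "expo (v j) ?q = 0" for j by (simp add: e)
  ultimately show ?thesis unfolding good_def using st unfolding s qpart_map_Q by simp
qed

theorem quadratic: "quadratic_dehn_function gens rels"
proof (rule quadratic_dehnI[OF rels_words])
  show "fillable gens rels (dehnc * n * n) w"
    if "w \<in> words gens" "length w \<le> n" "n \<ge> 1" "reduce w \<in> relator_subgroup gens rels" for n w
    using fillable_good[OF that(1-3)] relator_subgroup_good[OF that(4)] by blast
next
  fix n
  let ?x = "enc (Inl (v 0))" and ?y = "enc (Inl (v 1))"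
  let ?w = "replicate n (?x, True) @ replicate n (?y, True) @ replicate n (?x, False) @ replicate n (?y, False)"
  have Y: "v 0 \<in> Y" "v 1 \<in> Y" using v_Y by simp_all
  have xy: "?x \<in> gens" "?y \<in> gens" using Y by (simp_all add: gens_def)
  have ne: "?x \<noteq> ?y"
  proof
    assume "?x = ?y"
    then have "v 0 = v 1" using enc_Inl[OF Y(1)] enc_Inl[OF Y(2)] by simp
    then show False using v_inj[of 0 1] by simp
  qed
  have w: "?w \<in> words gens" using xy by simp
  have swr: "sw (replicate n (enc (Inl y), b)) = replicate n (Q (y, b))" if "y \<in> Y" for y b
    unfolding sw_def map_replicate using that by (simp add: sl_def enc_Inl)
  have g: "good (sw ?w)" using commutator_good[of n] by (simp only: sw_simps swr[OF Y(1)] swr[OF Y(2)])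
  \<comment> \<open>This filling only ensures that \<open>area\<close> is attained;
    \<open>Suc\<close> keeps the length bound positive.\<close>
  have f: "fillable gens rels (dehnc * Suc (4 * n) * Suc (4 * n)) ?w"
    by (rule fillable_good[OF w _ _ g]) simp_all
  have "n * n \<le> 64 * area gens rels ?w"
  proof (rule heis_area_bound[OF ne xy rels_words _ _ _ HOL.refl f])
    fix r assume r: "r \<in> rels"
    then show "length r \<le> 8" by (simp add: rels_def)
    have "r \<in> words gens" "good (sw r)" using r by (simp_all add: rels_def)
    then show "expo ?x r = 0" "expo ?y r = 0"
      using expo_enc Y by (simp_all add: good_def)
  qed
  moreover have "reduce ?w \<in> relator_subgroup gens rels" using good_iff[OF w] g by blast
  ultimately show "\<exists>w\<in>words gens. length w \<le> 4 * n \<and> reduce w \<in> relator_subgroup gens rels \<and> n * n \<le> 64 * area gens rels w"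
    using w by (intro bexI[of _ ?w]) simp_all
qed

text \<open>Translations commute with each other, so a conjugate of a translation depends only on
  the other letters of the conjugating word. Conjugacy of translations thus becomes an orbit
  problem.\<close>

theorem conjugate_translations:
  assumes e: "e1 \<in> lat" and w: "w \<in> words gens" "\<And>a. st a (sw w) = a + e2"
    "reduce (qfree (qpart (sw w))) = []" "\<And>j. j < 3 \<Longrightarrow> expo (v j) (qpart (sw w)) = 0"
  shows "conjugate_in (presented_group gens rels) (word_value gens rels [tl e1]) (word_value gens rels w) \<longleftrightarrow>
    (\<exists>qs. fst ` set qs \<subseteq> Y \<and> e2 = qact qs e1)"
proof -
  have t: "[tl e1] \<in> words gens" using e by simp
  have sg: "st a (sw (g @ [tl e1] @ winv g)) = a + qact (qpart (sw (winv g))) e1" for a g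
    using st_shift[of "st a (sw g)" e1 "sw (winv g)"] st_winv[of a g] sl_tl[OF e] by simp
  have iff: "reduce (w @ winv (g @ [tl e1] @ winv g)) \<in> relator_subgroup gens rels \<longleftrightarrow>
      e2 = qact (qpart (sw (winv g))) e1" if g: "g \<in> words gens" for g
  proof -
    let ?z = "g @ [tl e1] @ winv g"
    have z: "w @ winv ?z \<in> words gens" using g w t e by simp
    have q: "qpart (sw ?z) = qpart (sw g) @ qpart (sw (winv g))" using sl_tl[OF e] by simp
    show ?thesis unfolding good_iff[OF z]
    proof
      assume "good (sw (w @ winv ?z))"
      then have "st 0 (sw (w @ winv ?z)) = 0" by (simp add: good_def)
      then have "st (st 0 (sw (w @ winv ?z))) (sw ?z) = st 0 (sw ?z)" by simp
      moreover have "st (st b (sw (winv ?z))) (sw ?z) = b" for b using st_winv[of b "winv ?z"] by (simp only: winv_winv)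
      ultimately have "st 0 (sw w) = st 0 (sw ?z)" by (simp only: sw_simps(3) st_simps(3))
      then show "e2 = qact (qpart (sw (winv g))) e1" using w(2)[of 0] sg[of 0 g] by simp
    next
      assume "e2 = qact (qpart (sw (winv g))) e1"
      then show "good (sw (w @ winv ?z))"
        using w sg q qfree_winv[of g] expo_winv[of _ g] by (intro good_quotient) simp_all
    qed
  qed
  have "conjugate_in (presented_group gens rels) (word_value gens rels [tl e1]) (word_value gens rels w) \<longleftrightarrow>
      (\<exists>g\<in>words gens. e2 = qact (qpart (sw (winv g))) e1)"
    unfolding conjugate_in_iff[OF rels_words t w(1)] using iff by (intro bex_cong HOL.refl)
  also have "\<dots> \<longleftrightarrow> (\<exists>qs. fst ` set qs \<subseteq> Y \<and> e2 = qact qs e1)"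
  proof
    assume "\<exists>g\<in>words gens. e2 = qact (qpart (sw (winv g))) e1"
    then obtain g where g: "g \<in> words gens" "e2 = qact (qpart (sw (winv g))) e1" by blast
    then have "fst ` set (qpart (sw (winv g))) \<subseteq> Y" by (intro qpart_Y vlet_sw) simp
    then show "\<exists>qs. fst ` set qs \<subseteq> Y \<and> e2 = qact qs e1" using g by blast
  next
    assume "\<exists>qs. fst ` set qs \<subseteq> Y \<and> e2 = qact qs e1"
    then obtain qs where qs: "fst ` set qs \<subseteq> Y" "e2 = qact qs e1" by blast
    have "sw (map ql qs) = map Q qs" using qs(1) by (auto simp: sw_def sl_ql)
    moreover have "map ql qs \<in> words gens" using qs(1) by (induction qs) auto
    ultimately show "\<exists>g\<in>words gens. e2 = qact (qpart (sw (winv g))) e1"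
      using qs by (intro bexI[of _ "winv (map ql qs)"]) simp_all
  qed
  finally show ?thesis .
qed

end

section \<open>Laurent series at three places\<close>

type_synonym laurent = "bit fls"

lemma bit_double: "(x::bit) + x = 0"
  by (cases x) simp_all

lemma laurent_double [simp]: "(f::laurent) + f = 0"
  by (rule fls_eqI) (simp add: bit_double del: add_bit_eq_xor)

lemma laurent_uminus: "- (f::laurent) = f"
  using laurent_double[of f] by (simp add: minus_unique)

text \<open>Valuation at least \<open>n\<close>, stated by coefficients because
  \<open>fls_subdegree 0\<close> is 0, whereas the zero series has to count as arbitrarily
  regular.\<close>

definition reg :: "int \<Rightarrow> laurent \<Rightarrow> bool" where
  "reg n f \<longleftrightarrow> (\<forall>k<n. fls_nth f k = 0)"

lemma reg_iff: "reg n f \<longleftrightarrow> f = 0 \<or> n \<le> fls_subdegree f"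
  unfolding reg_def using fls_subdegree_geI[of f n] by auto

lemma reg_0 [simp]: "reg n 0"
  by (simp add: reg_def)

lemma reg_add: "reg n f \<Longrightarrow> reg n g \<Longrightarrow> reg n (f + g)"
  by (simp add: reg_def)

lemma reg_mono: "reg n f \<Longrightarrow> m \<le> n \<Longrightarrow> reg m f"
  by (auto simp: reg_def)

lemma reg_mult: "reg m f \<Longrightarrow> reg n g \<Longrightarrow> reg (m + n) (f * g)"
  unfolding reg_iff by (cases "f = 0 \<or> g = 0") auto

lemma reg_pow: "reg m f \<Longrightarrow> reg (int k * m) (f ^ k)"
proof (induction k)
  case 0
  show ?case by (simp add: reg_def)
next
  case (Suc k)
  then show ?case using reg_mult[of m f "int k * m" "f ^ k"] by (simp add: algebra_simps)
qed

datatype place = P0 | P1 | P2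

datatype k3 = K3 laurent laurent laurent

fun cmp :: "k3 \<Rightarrow> place \<Rightarrow> laurent" where
  "cmp (K3 a b c) P0 = a"
| "cmp (K3 a b c) P1 = b"
| "cmp (K3 a b c) P2 = c"

lemma k3_eqI: "(\<And>p. cmp a p = cmp b p) \<Longrightarrow> a = b"
  by (cases a; cases b) (metis cmp.simps)

instantiation k3 :: comm_ring_1
begin

definition "0 = K3 0 0 0"
definition "1 = K3 1 1 1"
definition "a + b = K3 (cmp a P0 + cmp b P0) (cmp a P1 + cmp b P1) (cmp a P2 + cmp b P2)"
definition "a - b = K3 (cmp a P0 - cmp b P0) (cmp a P1 - cmp b P1) (cmp a P2 - cmp b P2)"
definition "- a = K3 (- cmp a P0) (- cmp a P1) (- cmp a P2)"
definition "a * b = K3 (cmp a P0 * cmp b P0) (cmp a P1 * cmp b P1) (cmp a P2 * cmp b P2)"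

lemma cmp_simps [simp]: "cmp 0 p = 0" "cmp 1 p = 1" "cmp (a + b) p = cmp a p + cmp b p"
  "cmp (a - b) p = cmp a p - cmp b p" "cmp (- a) p = - cmp a p" "cmp (a * b) p = cmp a p * cmp b p"
  by (cases p; simp add: zero_k3_def one_k3_def plus_k3_def minus_k3_def uminus_k3_def times_k3_def)+

instance
proof
  have "cmp (0::k3) P0 \<noteq> cmp 1 P0" by simp
  then show "(0::k3) \<noteq> 1" by metis
qed (rule k3_eqI; simp add: algebra_simps)+

end

lemma k3_double [simp]: "(a::k3) + a = 0"
  by (rule k3_eqI) (simp only: cmp_simps laurent_double)

lemma k3_uminus: "- (a::k3) = a"
  using k3_double[of a] by (simp add: minus_unique)

lemma k3_minus: "(a::k3) - b = a + b"
  using k3_uminus[of b] by (metis diff_conv_add_uminus)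

lemma k3_power: "cmp (a ^ n) p = cmp a p ^ n"
  by (induction n) simp_all

text \<open>The vanishing order \<open>1\<close> required at infinity makes \<open>Uk 0\<close> a complement of \<open>R3\<close> below.\<close>

fun lo :: "place \<Rightarrow> int" where "lo P0 = 0" | "lo P1 = 0" | "lo P2 = 1"

definition Uk :: "nat \<Rightarrow> k3 set" where
  "Uk c = {a. \<forall>p. reg (lo p - int c) (cmp a p)}"

lemma Uk_add: "a \<in> Uk c \<Longrightarrow> b \<in> Uk c \<Longrightarrow> a + b \<in> Uk c"
  by (simp add: Uk_def reg_add)

lemma Uk_0: "0 \<in> Uk c"
  by (simp add: Uk_def)

lemma Uk_mono: "c \<le> c' \<Longrightarrow> Uk c \<subseteq> Uk c'"
  by (auto simp: Uk_def reg_def)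

lemma lo_ge: "lo p \<ge> 0"
  by (cases p) auto

lemma Uk_mult: "a \<in> Uk c \<Longrightarrow> b \<in> Uk d \<Longrightarrow> a * b \<in> Uk (c + d)"
  unfolding Uk_def
proof (intro CollectI allI)
  fix p assume "a \<in> {a. \<forall>p. reg (lo p - int c) (cmp a p)}" "b \<in> {a. \<forall>p. reg (lo p - int d) (cmp a p)}"
  then have "reg ((lo p - int c) + (lo p - int d)) (cmp a p * cmp b p)" by (intro reg_mult) auto
  then show "reg (lo p - int (c + d)) (cmp (a * b) p)"
    using lo_ge[of p] by (auto elim: reg_mono)
qed

lemma Uk_exists: "\<exists>c. a \<in> Uk c"
proof -
  let ?c = "Max ((\<lambda>p. nat (lo p - fls_subdegree (cmp a p))) ` {P0, P1, P2})"
  have "nat (lo p - fls_subdegree (cmp a p)) \<le> ?c" for p by (cases p) auto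
  then have "lo p - fls_subdegree (cmp a p) \<le> int ?c" for p by (simp only: nat_le_iff)
  then have "reg (lo p - int ?c) (cmp a p)" for p unfolding reg_iff by (simp add: algebra_simps)
  then show ?thesis unfolding Uk_def by blast
qed

text \<open>The expansions of \<open>x\<close> in local parameters at 0, 1 and infinity.\<close>

definition kx :: k3 where "kx = K3 fls_X (1 + fls_X) fls_X_inv"
definition ky :: k3 where "ky = 1 + kx"
definition kinv :: "k3 \<Rightarrow> k3" where
  "kinv a = K3 (inverse (cmp a P0)) (inverse (cmp a P1)) (inverse (cmp a P2))"
definition kxi :: k3 where "kxi = kinv kx"
definition kyi :: k3 where "kyi = kinv ky"

lemma cmp_kinv [simp]: "cmp (kinv a) p = inverse (cmp a p)"
  by (cases p) (simp_all add: kinv_def)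

lemma deg1X: "fls_subdegree (1 + fls_X :: laurent) = 0"
  by (rule fls_subdegree_eqI) simp_all

lemma deg1Xi: "fls_subdegree (1 + fls_X_inv :: laurent) = -1"
  by (rule fls_subdegree_eqI) simp_all

lemma ky_simps: "cmp ky P0 = 1 + fls_X" "cmp ky P1 = fls_X" "cmp ky P2 = 1 + fls_X_inv"
proof -
  have "1 + (1 + f) = f" for f :: laurent by (simp flip: add.assoc)
  then show "cmp ky P0 = 1 + fls_X" "cmp ky P1 = fls_X" "cmp ky P2 = 1 + fls_X_inv"
    by (simp_all add: ky_def kx_def  )
qed

lemma kx_simps: "cmp kx P0 = fls_X" "cmp kx P1 = 1 + fls_X" "cmp kx P2 = fls_X_inv"
  by (simp_all add: kx_def)

lemma nonzero1: "(1 + fls_X :: laurent) \<noteq> 0" "(1 + fls_X_inv :: laurent) \<noteq> 0"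
  by (rule fls_nonzeroI[of _ 0], simp)+

lemma kx_nonzero: "cmp kx p \<noteq> 0" and ky_nonzero: "cmp ky p \<noteq> 0"
  using nonzero1 by (cases p; simp add: kx_simps ky_simps)+

lemma k_inverse: "kx * kxi = 1" "ky * kyi = 1"
  by (rule k3_eqI, simp add: kxi_def kyi_def kx_nonzero ky_nonzero)+

lemma kx_deg: "fls_subdegree (cmp kx P0) = 1" "fls_subdegree (cmp kx P1) = 0" "fls_subdegree (cmp kx P2) = -1"
  by (simp_all add: kx_simps deg1X)

lemma ky_deg: "fls_subdegree (cmp ky P0) = 0" "fls_subdegree (cmp ky P1) = 1" "fls_subdegree (cmp ky P2) = -1"
  by (simp_all add: ky_simps deg1X deg1Xi)

lemma kxi_deg: "fls_subdegree (cmp kxi P0) = -1" "fls_subdegree (cmp kxi P1) = 0" "fls_subdegree (cmp kxi P2) = 1"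
  by (simp_all add: kxi_def kx_deg)

lemma kyi_deg: "fls_subdegree (cmp kyi P0) = 0" "fls_subdegree (cmp kyi P1) = -1" "fls_subdegree (cmp kyi P2) = 1"
  by (simp_all add: kyi_def ky_deg)

text \<open>\<open>R3\<close> is the ring \<open>F\<^sub>2[x, 1/x, 1/(1+x)]\<close>, spanned by its partial fractions and embedded
  in the product of its completions at \<open>0\<close>, \<open>1\<close> and infinity.\<close>

inductive_set R3 :: "k3 set" where
  zero: "0 \<in> R3"
| xi: "a \<in> R3 \<Longrightarrow> a + kxi ^ Suc n \<in> R3"
| yi: "a \<in> R3 \<Longrightarrow> a + kyi ^ Suc n \<in> R3"
| x: "a \<in> R3 \<Longrightarrow> a + kx ^ n \<in> R3"

lemma R3_add: "a \<in> R3 \<Longrightarrow> b \<in> R3 \<Longrightarrow> a + b \<in> R3"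
proof (induction rule: R3.induct)
  case (xi a n)
  then show ?case using R3.xi[of "a + b" n] by (simp add: ac_simps)
next
  case (yi a n)
  then show ?case using R3.yi[of "a + b" n] by (simp add: ac_simps)
next
  case (x a n)
  then show ?case using R3.x[of "a + b" n] by (simp add: ac_simps)
qed simp

lemma R3_basis: "kxi ^ Suc n \<in> R3" "kyi ^ Suc n \<in> R3" "kx ^ n \<in> R3"
  using R3.xi[OF R3.zero, of n] R3.yi[OF R3.zero, of n] R3.x[OF R3.zero, of n] by simp_all

lemma R3_1: "1 \<in> R3"
  using R3_basis(3)[of 0] by simp

lemma R3_small: "kx \<in> R3" "kxi \<in> R3" "kyi \<in> R3" "ky \<in> R3"
proof -
  show "kx \<in> R3" "kxi \<in> R3" "kyi \<in> R3"
    using R3_basis(3)[of 1] R3_basis(1)[of 0] R3_basis(2)[of 0] by simp_all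
  then show "ky \<in> R3" unfolding ky_def by (intro R3_add R3_1)
qed

text \<open>The partial fraction expansions of \<open>x/(1+x)\<close> and \<open>1/(x(1+x))\<close>
  in characteristic 2. Together with \<open>k_inverse\<close> they close \<open>R3\<close> under
  multiplication.\<close>

lemma k_relations: "kx * kyi = 1 + kyi" "kxi * kyi = kxi + kyi"
proof -
  have 1: "kyi + kx * kyi = 1" using k_inverse(2) by (simp add: ky_def distrib_right)
  then have "kyi + (kyi + kx * kyi) = kyi + 1" by simp
  then show x: "kx * kyi = 1 + kyi" by (simp flip: add.assoc)
  have "kxi * (kyi + kx * kyi) = kxi" using 1 by simp
  moreover have "kxi * (kx * kyi) = kyi" using k_inverse(1) by (simp flip: mult.assoc) (simp add: mult.commute)
  ultimately have "kxi * kyi + kyi = kxi" by (simp add: distrib_left)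
  then have "kxi * kyi + kyi + kyi = kxi + kyi" by simp
  then show "kxi * kyi = kxi + kyi" by (simp add: add.assoc)
qed

lemma R3_mult_gen:
  assumes "\<And>n. k * kxi ^ Suc n \<in> R3" "\<And>n. k * kyi ^ Suc n \<in> R3" "\<And>n. k * kx ^ n \<in> R3" "a \<in> R3"
  shows "k * a \<in> R3"
  using assms(4)
proof (induction rule: R3.induct)
  case zero
  show ?case by (simp add: R3.zero)
qed (use assms(1-3) R3_add in \<open>simp_all only: distrib_left\<close>)

lemma R3_mult_x: "a \<in> R3 \<Longrightarrow> kx * a \<in> R3"
proof (rule R3_mult_gen)
  fix n
  have "kx * kxi ^ Suc n = kxi ^ n" using k_inverse(1) by (simp flip: mult.assoc)
  then show "kx * kxi ^ Suc n \<in> R3" using R3_basis(1)[of "n - 1"] R3_1 by (cases n) simp_all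
  have "kx * kyi ^ Suc n = (kx * kyi) * kyi ^ n" by (simp add: mult.assoc)
  also have "\<dots> = kyi ^ n + kyi ^ Suc n" unfolding k_relations by (simp add: distrib_right)
  finally show "kx * kyi ^ Suc n \<in> R3" using R3_basis(2) R3_1 R3_small(3)
    by (cases n) (auto intro: R3_add simp del: power_Suc simp: power_Suc[of kyi 0])
  show "kx * kx ^ n \<in> R3" using R3_basis(3)[of "Suc n"] by simp
qed

lemma R3_xi_yi: "kxi * kyi ^ n \<in> R3" "kyi * kxi ^ n \<in> R3"
proof (induction n)
  case (Suc n)
  have "kxi * kyi ^ Suc n = kxi * kyi ^ n + kyi ^ Suc n"
    using k_relations(2) by (simp add: mult.assoc[symmetric] distrib_right)
  then show "kxi * kyi ^ Suc n \<in> R3" using Suc(1) R3_basis(2)[of n] R3_add by simp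
  have "kyi * kxi ^ Suc n = kxi ^ Suc n + kyi * kxi ^ n"
    using k_relations(2) by (simp add: mult.assoc[symmetric] distrib_right mult.commute[of kyi kxi])
  then show "kyi * kxi ^ Suc n \<in> R3" using Suc(2) R3_basis(1)[of n] R3_add by simp
qed (simp_all add: R3_small)

lemma R3_mult_xi: "a \<in> R3 \<Longrightarrow> kxi * a \<in> R3"
proof (rule R3_mult_gen)
  fix n
  show "kxi * kxi ^ Suc n \<in> R3" using R3_basis(1)[of "Suc n"] by simp
  show "kxi * kyi ^ Suc n \<in> R3" by (rule R3_xi_yi)
  have "kxi * kx ^ Suc n = kx ^ n" for n using k_inverse(1) by (simp add: mult.assoc[symmetric] mult.commute[of kxi])
  then show "kxi * kx ^ n \<in> R3" using R3_basis(3) R3_small by (cases n) (simp_all del: power_Suc)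
qed

lemma R3_yi_x: "kyi * kx ^ n \<in> R3"
proof (induction n)
  case (Suc n)
  have "kyi * kx ^ Suc n = kx ^ n + kyi * kx ^ n"
    using k_relations(1) by (simp add: mult.assoc[symmetric] distrib_right mult.commute[of kyi kx])
  then show ?case using Suc R3_basis(3)[of n] R3_add by simp
qed (simp add: R3_small)

lemma R3_mult_yi: "a \<in> R3 \<Longrightarrow> kyi * a \<in> R3"
proof (rule R3_mult_gen)
  fix n
  show "kyi * kyi ^ Suc n \<in> R3" using R3_basis(2)[of "Suc n"] by simp
  show "kyi * kxi ^ Suc n \<in> R3" by (rule R3_xi_yi)
  show "kyi * kx ^ n \<in> R3" by (rule R3_yi_x)
qed

lemma R3_mult: "a \<in> R3 \<Longrightarrow> b \<in> R3 \<Longrightarrow> a * b \<in> R3"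
proof (induction rule: R3.induct)
  case zero
  show ?case by (simp add: R3.zero)
next
  case (xi a n)
  have "kxi ^ k * b \<in> R3" for k
    by (induction k) (use xi.prems R3_mult_xi in \<open>simp_all add: mult.assoc\<close>)
  then show ?case using xi R3_add by (simp only: distrib_right)
next
  case (yi a n)
  have "kyi ^ k * b \<in> R3" for k
    by (induction k) (use yi.prems R3_mult_yi in \<open>simp_all add: mult.assoc\<close>)
  then show ?case using yi R3_add by (simp only: distrib_right)
next
  case (x a n)
  have "kx ^ k * b \<in> R3" for k
    by (induction k) (use x.prems R3_mult_x in \<open>simp_all add: mult.assoc\<close>)
  then show ?case using x R3_add by (simp only: distrib_right)
qed

section \<open>Principal parts and rounding to the ring\<close>

definition bk :: "bit \<Rightarrow> k3 \<Rightarrow> k3" where "bk c r = (if c = 0 then 0 else r)"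

lemma bk_add: "bk (c + d) r = bk c r + bk d r"
  by (cases c; cases d) (simp_all add: bk_def)

lemma bk_nth: "fls_nth (cmp (bk c r) p) n = (if c = 0 then 0 else fls_nth (cmp r p) n)"
  by (simp add: bk_def)

text \<open>The sum of the principal parts of \<open>a\<close> at the three places, truncated after
  \<open>N\<close> terms; at infinity the constant term is included.\<close>

definition recon :: "nat \<Rightarrow> k3 \<Rightarrow> k3" where
  "recon N a = (\<Sum>i<N. bk (fls_nth (cmp a P0) (- int (Suc i))) (kxi ^ Suc i)) +
    (\<Sum>i<N. bk (fls_nth (cmp a P1) (- int (Suc i))) (kyi ^ Suc i)) +
    (\<Sum>i<N. bk (fls_nth (cmp a P2) (- int i)) (kx ^ i))"

lemma recon_add: "recon N (a + b) = recon N a + recon N b"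
  unfolding recon_def by (simp add: bk_add sum.distrib ac_simps del: add_bit_eq_xor power_Suc of_nat_Suc)

lemma k_reg: "reg 0 (cmp kyi P0 ^ n)" "reg 0 (cmp kx P0 ^ n)" "reg 0 (cmp kxi P1 ^ n)" "reg 0 (cmp kx P1 ^ n)"
  "reg 1 (cmp kxi P2 ^ Suc n)" "reg 1 (cmp kyi P2 ^ Suc n)"
proof -
  have "reg 0 (cmp kyi P0)" "reg 0 (cmp kx P0)" "reg 0 (cmp kxi P1)" "reg 0 (cmp kx P1)" "reg 1 (cmp kxi P2)" "reg 1 (cmp kyi P2)"
    by (simp_all add: reg_iff kyi_deg kx_deg kxi_deg)
  from this(1-4)[THEN reg_pow[of _ _ n]] this(5,6)[THEN reg_pow[of _ _ "Suc n"]]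
  show "reg 0 (cmp kyi P0 ^ n)" "reg 0 (cmp kx P0 ^ n)" "reg 0 (cmp kxi P1 ^ n)" "reg 0 (cmp kx P1 ^ n)"
    "reg 1 (cmp kxi P2 ^ Suc n)" "reg 1 (cmp kyi P2 ^ Suc n)"
    by (auto elim: reg_mono)
qed

lemma k_nth: "fls_nth (cmp kxi P0 ^ n) k = (if k = - int n then 1 else 0)"
  "fls_nth (cmp kyi P1 ^ n) k = (if k = - int n then 1 else 0)"
  "fls_nth (cmp kx P2 ^ n) k = (if k = - int n then 1 else 0)"
proof -
  have "inverse (fls_X :: laurent) = fls_X_inv" by (metis fls_inverse_X_inv inverse_inverse_eq)
  then show "fls_nth (cmp kxi P0 ^ n) k = (if k = - int n then 1 else 0)"
    "fls_nth (cmp kyi P1 ^ n) k = (if k = - int n then 1 else 0)"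
    "fls_nth (cmp kx P2 ^ n) k = (if k = - int n then 1 else 0)"
    by (simp_all add: kxi_def kyi_def kx_simps ky_simps)
qed

text \<open>Each basis element has a principal part at one place only, and there it is a single
  monomial, so the three sums in \<open>recon\<close> do not interfere.\<close>

lemma polar_nth:
  "fls_nth (cmp (kxi ^ Suc n) P0) (- int (Suc i)) = (if i = n then 1 else 0)"
  "fls_nth (cmp (kxi ^ Suc n) P1) (- int (Suc i)) = 0"
  "fls_nth (cmp (kxi ^ Suc n) P2) (- int i) = 0"
  "fls_nth (cmp (kyi ^ Suc n) P0) (- int (Suc i)) = 0"
  "fls_nth (cmp (kyi ^ Suc n) P1) (- int (Suc i)) = (if i = n then 1 else 0)"
  "fls_nth (cmp (kyi ^ Suc n) P2) (- int i) = 0"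
  "fls_nth (cmp (kx ^ n) P0) (- int (Suc i)) = 0"
  "fls_nth (cmp (kx ^ n) P1) (- int (Suc i)) = 0"
  "fls_nth (cmp (kx ^ n) P2) (- int i) = (if i = n then 1 else 0)"
  using k_reg(1)[of "Suc n"] k_reg(2)[of n] k_reg(3)[of "Suc n"] k_reg(4)[of n] k_reg(5)[of n] k_reg(6)[of n]
  unfolding k3_power k_nth by (auto simp: reg_def simp del: power_Suc)

lemma bk_simps [simp]: "bk 0 r = 0" "bk 1 r = r"
  by (simp_all add: bk_def)

lemma recon_basis:
  "n < N \<Longrightarrow> recon N (kxi ^ Suc n) = kxi ^ Suc n"
  "n < N \<Longrightarrow> recon N (kyi ^ Suc n) = kyi ^ Suc n"
  "n < N \<Longrightarrow> recon N (kx ^ n) = kx ^ n"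
proof -
  have b: "bk (if P then 1 else 0) r = (if P then r else 0)" for P r by simp
  assume "n < N"
  then show "recon N (kxi ^ Suc n) = kxi ^ Suc n" "recon N (kyi ^ Suc n) = kyi ^ Suc n" "recon N (kx ^ n) = kx ^ n"
    unfolding recon_def polar_nth b by (simp_all del: power_Suc)
qed

lemma recon_R3: "r \<in> R3 \<Longrightarrow> \<exists>N0. \<forall>N\<ge>N0. recon N r = r"
proof (induction rule: R3.induct)
  case zero
  have "recon N 0 = 0" for N by (simp add: recon_def)
  then show ?case by simp
next
  case (xi a n)
  then obtain N0 where "\<forall>N\<ge>N0. recon N a = a" by blast
  then show ?case by (intro exI[of _ "max N0 (Suc n)"]) (auto simp: recon_add recon_basis simp del: power_Suc)
next
  case (yi a n)
  then obtain N0 where "\<forall>N\<ge>N0. recon N a = a" by blast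
  then show ?case by (intro exI[of _ "max N0 (Suc n)"]) (auto simp: recon_add recon_basis simp del: power_Suc)
next
  case (x a n)
  then obtain N0 where "\<forall>N\<ge>N0. recon N a = a" by blast
  then show ?case by (intro exI[of _ "max N0 (Suc n)"]) (auto simp: recon_add recon_basis)
qed

lemma recon_in_R3: "recon N a \<in> R3"
proof -
  have s: "(\<Sum>i<N. f i) \<in> R3" if "\<And>i. f i \<in> R3" for f :: "nat \<Rightarrow> k3"
    using that by (induction N) (auto intro: R3_add R3.zero)
  have b: "bk c r \<in> R3" if "r \<in> R3" for c r using that by (simp add: bk_def R3.zero)
  show ?thesis unfolding recon_def by (intro R3_add s b R3_basis)
qed

lemma Uk_nth:
  "a \<in> Uk c \<Longrightarrow> i \<ge> c \<Longrightarrow> fls_nth (cmp a P0) (- int (Suc i)) = 0"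
  "a \<in> Uk c \<Longrightarrow> i \<ge> c \<Longrightarrow> fls_nth (cmp a P1) (- int (Suc i)) = 0"
  "a \<in> Uk c \<Longrightarrow> i \<ge> c \<Longrightarrow> fls_nth (cmp a P2) (- int i) = 0"
proof -
  assume a: "a \<in> Uk c" and i: "i \<ge> c"
  have "reg (lo p - int c) (cmp a p)" for p using a by (simp add: Uk_def)
  from this[of P0] this[of P1] this[of P2]
  show "fls_nth (cmp a P0) (- int (Suc i)) = 0" "fls_nth (cmp a P1) (- int (Suc i)) = 0" "fls_nth (cmp a P2) (- int i) = 0"
    using i by (auto simp: reg_def)
qed

lemma recon_Uk: "a \<in> Uk c \<Longrightarrow> N \<ge> c \<Longrightarrow> recon N a = recon c a"
proof -
  assume a: "a \<in> Uk c" "N \<ge> c"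
  have s: "(\<Sum>i<N. bk (f i) (g i)) = (\<Sum>i<c. bk (f i) (g i))" if "\<And>i. i \<ge> c \<Longrightarrow> f i = 0" for f g
    using a(2) that by (intro sum.mono_neutral_right) auto
  show ?thesis unfolding recon_def
    using Uk_nth[OF a(1)] by (intro arg_cong2[of _ _ _ _ "(+)"] s) auto
qed

lemma R3_Uk: "r \<in> R3 \<Longrightarrow> r \<in> Uk c \<Longrightarrow> recon c r = r"
proof -
  assume r: "r \<in> R3" "r \<in> Uk c"
  obtain N0 where "\<forall>N\<ge>N0. recon N r = r" using recon_R3[OF r(1)] by blast
  then show ?thesis using recon_Uk[OF r(2), of "max N0 c"] by simp
qed

text \<open>A function regular at 0 and 1 and vanishing at infinity has no principal parts left and
  is 0. This makes the rounding unique.\<close>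

lemma R3_regular: "r \<in> R3 \<Longrightarrow> r \<in> Uk 0 \<Longrightarrow> r = 0"
  using R3_Uk[of r 0] by (simp add: recon_def)

lemma sum_nth: "fls_nth (cmp (\<Sum>i<N. f i) p) k = (\<Sum>i<N. fls_nth (cmp (f i) p) k)" for f :: "nat \<Rightarrow> k3"
  by (induction N) (simp_all del: add_bit_eq_xor)

lemma recon_nth:
  assumes "i < N"
  shows "fls_nth (cmp (recon N a) P0) (- int (Suc i)) = fls_nth (cmp a P0) (- int (Suc i))"
    "fls_nth (cmp (recon N a) P1) (- int (Suc i)) = fls_nth (cmp a P1) (- int (Suc i))"
    "fls_nth (cmp (recon N a) P2) (- int i) = fls_nth (cmp a P2) (- int i)"
proof -
  have b: "(if (c::bit) = 0 then 0 else if i = j then 1 else 0) = (if i = j then c else 0)" for c j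
    by (cases c) simp_all
  have s: "(\<Sum>j<N. if i = j then (f j :: bit) else 0) = f i" for f using assms by simp
  show "fls_nth (cmp (recon N a) P0) (- int (Suc i)) = fls_nth (cmp a P0) (- int (Suc i))"
    "fls_nth (cmp (recon N a) P1) (- int (Suc i)) = fls_nth (cmp a P1) (- int (Suc i))"
    "fls_nth (cmp (recon N a) P2) (- int i) = fls_nth (cmp a P2) (- int i)"
    by (simp_all only: recon_def cmp_simps fls_plus_nth sum_nth bk_nth polar_nth b s if_cancel
        sum.neutral_const add_0_left add_0_right)
qed

lemma recon_diff:
  assumes a: "a \<in> Uk c"
  shows "a + recon c a \<in> Uk 0"
proof -
  have d: "x = y \<Longrightarrow> x + y = 0" for x y :: bit using bit_double by blast
  have z: "fls_nth (cmp (recon c a) P0) (- int (Suc i)) = 0" "fls_nth (cmp (recon c a) P1) (- int (Suc i)) = 0"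
    "fls_nth (cmp (recon c a) P2) (- int i) = 0" if "i \<ge> c" for i
  proof -
    have b: "(if (c::bit) = 0 then 0 else if i = j then 1 else 0) = (if i = j then c else 0)" for c j
      by (cases c) simp_all
    have s: "(\<Sum>j<c. if i = j then (f j :: bit) else 0) = 0" for f using that by simp
    show "fls_nth (cmp (recon c a) P0) (- int (Suc i)) = 0" "fls_nth (cmp (recon c a) P1) (- int (Suc i)) = 0"
      "fls_nth (cmp (recon c a) P2) (- int i) = 0"
      by (simp_all only: recon_def cmp_simps fls_plus_nth sum_nth bk_nth polar_nth b s if_cancel
        sum.neutral_const add_0_left add_0_right)
  qed
  have n: "fls_nth (cmp (a + recon c a) P0) (- int (Suc i)) = 0" "fls_nth (cmp (a + recon c a) P1) (- int (Suc i)) = 0"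
    "fls_nth (cmp (a + recon c a) P2) (- int i) = 0" for i
    using z[of i] Uk_nth[OF a, of i] recon_nth[of i c a]
    unfolding cmp_simps fls_plus_nth by (cases "i < c"; intro d; simp)+
  have "reg (lo p) (cmp (a + recon c a) p)" for p
    unfolding reg_def
  proof (intro allI impI)
    fix k assume k: "k < lo p"
    show "fls_nth (cmp (a + recon c a) p) k = 0"
    proof (cases p)
      case P0
      then have "k = - int (Suc (nat (- k - 1)))" using k by simp
      then show ?thesis using n(1)[of "nat (- k - 1)"] P0 by simp
    next
      case P1
      then have "k = - int (Suc (nat (- k - 1)))" using k by simp
      then show ?thesis using n(2)[of "nat (- k - 1)"] P1 by simp
    next
      case P2
      then have "k = - int (nat (- k))" using k by simp
      then show ?thesis using n(3)[of "nat (- k)"] P2 by simp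
    qed
  qed
  then show ?thesis by (simp add: Uk_def)
qed

text \<open>The projection onto \<open>R3\<close> in the decomposition of the product of the
  completions as a direct sum of \<open>R3\<close> and \<open>Uk 0\<close>. It is defined by
  uniqueness because \<open>recon\<close> depends on a bound for the poles.\<close>

definition krho :: "k3 \<Rightarrow> k3" where
  "krho a = (THE r. r \<in> R3 \<and> a + r \<in> Uk 0)"

lemma krho_ex1: "\<exists>!r. r \<in> R3 \<and> a + r \<in> Uk 0"
proof -
  obtain c where "a \<in> Uk c" using Uk_exists by blast
  then have "recon c a \<in> R3 \<and> a + recon c a \<in> Uk 0" using recon_in_R3 recon_diff by blast
  moreover have "r = s" if "r \<in> R3 \<and> a + r \<in> Uk 0" "s \<in> R3 \<and> a + s \<in> Uk 0" for r s
  proof -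
    have "(a + r) + (a + s) \<in> Uk 0" using that Uk_add by blast
    moreover have "(a + r) + (a + s) = (a + a) + (r + s)" by (simp only: ac_simps)
    ultimately have "r + s = 0" using R3_regular R3_add that by simp
    then show ?thesis using k3_minus[of r s] by simp
  qed
  ultimately show ?thesis by blast
qed

lemma krho: "krho a \<in> R3" "a + krho a \<in> Uk 0"
  using theI'[OF krho_ex1[of a]] unfolding krho_def by blast+

lemma krho_eqI: "r \<in> R3 \<Longrightarrow> a + r \<in> Uk 0 \<Longrightarrow> krho a = r"
  using krho_ex1[of a] krho[of a] by blast

lemma krho_add: "krho (a + b) = krho a + krho b"
proof (rule krho_eqI)
  show "krho a + krho b \<in> R3" by (intro R3_add krho)
  have "(a + krho a) + (b + krho b) \<in> Uk 0" by (intro Uk_add krho)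
  then show "a + b + (krho a + krho b) \<in> Uk 0" by (simp only: ac_simps)
qed

lemma krho_R3: "r \<in> R3 \<Longrightarrow> krho r = r"
  by (rule krho_eqI) (simp_all add: Uk_0)

lemma krho_iff: "krho r = r \<longleftrightarrow> r \<in> R3"
  using krho(1)[of r] krho_R3 by metis

lemma finite_R3_Uk: "finite (R3 \<inter> Uk c)"
proof -
  let ?f = "\<lambda>(l1, l2, l3). (\<Sum>i<c. bk (l1 ! i) (kxi ^ Suc i)) + (\<Sum>i<c. bk (l2 ! i) (kyi ^ Suc i)) +
    (\<Sum>i<c. bk (l3 ! i) (kx ^ i))"
  let ?L = "{l. set l \<subseteq> (UNIV :: bit set) \<and> length l = c}"
  have "r \<in> ?f ` (?L \<times> ?L \<times> ?L)" if "r \<in> R3 \<inter> Uk c" for r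
  proof
    show "(map (\<lambda>i. fls_nth (cmp r P0) (- int (Suc i))) [0..<c], map (\<lambda>i. fls_nth (cmp r P1) (- int (Suc i))) [0..<c],
        map (\<lambda>i. fls_nth (cmp r P2) (- int i)) [0..<c]) \<in> ?L \<times> ?L \<times> ?L" by simp
    show "r = ?f (map (\<lambda>i. fls_nth (cmp r P0) (- int (Suc i))) [0..<c], map (\<lambda>i. fls_nth (cmp r P1) (- int (Suc i))) [0..<c],
        map (\<lambda>i. fls_nth (cmp r P2) (- int i)) [0..<c])"
      using R3_Uk[of r c] that unfolding recon_def by (simp del: power_Suc of_nat_Suc)
  qed
  moreover have "finite (UNIV :: bit set)"
  proof -
    have "(UNIV :: bit set) = {0, 1}" using bit.exhaust by blast
    then show ?thesis by (metis finite.simps)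
  qed
  then have "finite ?L" by (rule finite_lists_length_eq)
  then have "finite (?f ` (?L \<times> ?L \<times> ?L))" by (intro finite_imageI finite_cartesian_product)
  ultimately show ?thesis by (meson finite_subset subsetI)
qed

section \<open>Matrices\<close>

datatype 'a mat2 = M2 'a 'a 'a 'a

instantiation mat2 :: (comm_ring_1) ring_1
begin

definition "0 = M2 0 0 0 0"
definition "1 = M2 1 0 0 1"
fun plus_mat2 where "M2 a b c d + M2 a' b' c' d' = M2 (a + a') (b + b') (c + c') (d + d')"
fun minus_mat2 where "M2 a b c d - M2 a' b' c' d' = M2 (a - a') (b - b') (c - c') (d - d')"
fun uminus_mat2 where "- M2 a b c d = M2 (- a) (- b) (- c) (- d)"
fun times_mat2 where "M2 a b c d * M2 a' b' c' d' =
  M2 (a * a' + b * c') (a * b' + b * d') (c * a' + d * c') (c * b' + d * d')"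

instance
proof
  fix x y z :: "'a mat2"
  show "x + y + z = x + (y + z)" by (cases x; cases y; cases z) (simp add: ac_simps)
  show "x + y = y + x" by (cases x; cases y) (simp add: ac_simps)
  show "0 + x = x" by (cases x) (simp add: zero_mat2_def)
  show "- x + x = 0" by (cases x) (simp add: zero_mat2_def)
  show "x - y = x + - y" by (cases x; cases y) simp
  show "x * y * z = x * (y * z)" by (cases x; cases y; cases z) (simp add: algebra_simps)
  show "1 * x = x" "x * 1 = x" by (cases x; simp add: one_mat2_def)+
  show "(x + y) * z = x * z + y * z" "x * (y + z) = x * y + x * z"
    by (cases x; cases y; cases z; simp add: algebra_simps)+
  show "(0::'a mat2) \<noteq> 1" by (simp add: zero_mat2_def one_mat2_def)
qed

end

fun scal :: "'a::comm_ring_1 \<Rightarrow> 'a mat2 \<Rightarrow> 'a mat2" where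
  "scal k (M2 a b c d) = M2 (k * a) (k * b) (k * c) (k * d)"

fun det2 :: "'a::comm_ring_1 mat2 \<Rightarrow> 'a" where
  "det2 (M2 a b c d) = a * d - b * c"

lemma scal_simps:
  "scal k (x + y) = scal k x + scal k y" "scal k (x * y) = x * scal k y" "scal k x * y = scal k (x * y)"
  "scal k (scal l x) = scal (k * l) x" "scal 1 x = x" "scal k 0 = 0" "scal (k + l) x = scal k x + scal l x"
  "scal 0 x = 0"
  by (cases x; cases y; simp add: algebra_simps zero_mat2_def)+

lemma det2_mult: "det2 (x * y) = det2 x * det2 y"
  by (cases x; cases y) (simp add: algebra_simps)

lemma det2_scal: "det2 (scal k x) = k * k * det2 x"
  by (cases x) (simp add: algebra_simps)

lemma det2_1: "det2 1 = 1"
  by (simp add: one_mat2_def)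

type_synonym kmat = "k3 mat2"

lemma kmat_double [simp]: "(x::kmat) + x = 0"
  by (cases x) (simp add: zero_mat2_def)

lemma kmat_uminus: "- (x::kmat) = x"
  using kmat_double[of x] by (simp add: minus_unique)

section \<open>A free group of matrices of determinant 1\<close>

definition uu :: "k3 \<Rightarrow> kmat" where "uu f = M2 1 f 0 1"
definition ll :: "k3 \<Rightarrow> kmat" where "ll f = M2 1 0 f 1"

lemma uu_ll_sq [simp]: "uu f * uu f = 1" "ll f * ll f = 1"
  by (simp_all add: uu_def ll_def one_mat2_def)

text \<open>In characteristic 2 both factors are involutions, so the product in the opposite order
  is the inverse. Distinct positive powers of \<open>x\<close> are taken so that each parameter, and
  each sum of two different ones, has a pole at infinity.\<close>

definition phl :: "nat letter \<Rightarrow> kmat" where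
  "phl l = (let f = kx ^ Suc (fst l) in if snd l then uu f * ll f else ll f * uu f)"

lemma phl_inverse: "phl l * phl (inv_letter l) = 1"
proof -
  have "uu f * ll f * (ll f * uu f) = 1" "ll f * uu f * (uu f * ll f) = 1" for f
  proof -
    have "uu f * ll f * (ll f * uu f) = uu f * (ll f * ll f) * uu f" by (simp only: mult.assoc)
    then show "uu f * ll f * (ll f * uu f) = 1" by simp
    have "ll f * uu f * (uu f * ll f) = ll f * (uu f * uu f) * ll f" by (simp only: mult.assoc)
    then show "ll f * uu f * (uu f * ll f) = 1" by simp
  qed
  then show ?thesis by (simp add: phl_def inv_letter_def Let_def)
qed

interpretation ph: word_hom "(*)" "1::kmat" phl
  by unfold_locales (simp_all add: mult.assoc phl_inverse)

lemma det_phl: "det2 (phl l) = 1"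
  by (simp add: phl_def Let_def det2_mult uu_def ll_def)

lemma det_ph: "det2 (ph.ev w) = 1"
  by (induction w) (simp_all add: ph.ev_Cons det2_mult det_phl det2_1)

fun mvec :: "kmat \<Rightarrow> laurent \<times> laurent \<Rightarrow> laurent \<times> laurent" where
  "mvec (M2 a b c d) (p, q) = (cmp a P2 * p + cmp b P2 * q, cmp c P2 * p + cmp d P2 * q)"

lemma mvec_mult: "mvec (x * y) v = mvec x (mvec y v)"
  by (cases x; cases y; cases v) (simp add: algebra_simps)

lemma mvec_1: "mvec 1 v = v"
  by (cases v) (simp add: one_mat2_def)

definition fs :: "nat \<Rightarrow> laurent" where "fs s = fls_X_inv ^ Suc s"

lemma cmp_kx_P2: "cmp (kx ^ Suc s) P2 = fs s"
  by (simp only: k3_power kx_simps fs_def)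

lemma mvec_phl:
  "mvec (phl (s, True)) (p, q) = (p + fs s * (q + fs s * p), q + fs s * p)"
  "mvec (phl (s, False)) (p, q) = (p + fs s * q, q + fs s * (p + fs s * q))"
proof -
  have "mvec (uu (kx ^ Suc s)) (p, q) = (p + fs s * q, q)" "mvec (ll (kx ^ Suc s)) (p, q) = (p, q + fs s * p)" for p q
    unfolding uu_def ll_def mvec.simps cmp_kx_P2 by (simp_all add: add.commute)
  then show "mvec (phl (s, True)) (p, q) = (p + fs s * (q + fs s * p), q + fs s * p)"
    "mvec (phl (s, False)) (p, q) = (p + fs s * q, q + fs s * (p + fs s * q))"
    unfolding phl_def Let_def by (simp_all add: mvec_mult del: power_Suc)
qed

definition big :: "laurent \<Rightarrow> bool" where
  "big h \<longleftrightarrow> h \<noteq> 0 \<and> fls_subdegree h \<le> -1"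

lemma big_fs: "big (fs s)"
  by (simp add: big_def fs_def fls_subdegree_fls_X_inv_pow del: power_Suc)

lemma big_fs_add: "s \<noteq> t \<Longrightarrow> big (fs s + fs t)"
proof -
  assume "s \<noteq> t"
  then have "fls_nth (fs s + fs t) (- int (Suc s)) \<noteq> 0" by (simp add: fs_def del: power_Suc)
  then show ?thesis unfolding big_def using fls_subdegree_leI[of "fs s + fs t" "- int (Suc s)"] by fastforce
qed

text \<open>A comparison of degrees at infinity, the degree being \<open>- fls_subdegree\<close>.
  The second argument must be nonzero so that multiplying it by a \<open>big\<close> element
  strictly raises the degree.\<close>

definition dle :: "laurent \<Rightarrow> laurent \<Rightarrow> bool" where
  "dle f g \<longleftrightarrow> g \<noteq> 0 \<and> (f = 0 \<or> fls_subdegree g \<le> fls_subdegree f)"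

lemma dle_big:
  assumes "dle p q" "big h"
  shows "p + h * q \<noteq> 0" "fls_subdegree (p + h * q) < fls_subdegree q" "dle q (p + h * q)"
proof -
  have h: "h * q \<noteq> 0" "fls_subdegree (h * q) < fls_subdegree q" using assms by (auto simp: dle_def big_def)
  have "p + h * q \<noteq> 0 \<and> fls_subdegree (p + h * q) < fls_subdegree q"
  proof (cases "p = 0")
    case False
    then have lt: "fls_subdegree (h * q) < fls_subdegree p" using assms h by (auto simp: dle_def)
    have "p + h * q \<noteq> 0"
    proof
      assume "p + h * q = 0"
      then have "p = h * q" using laurent_uminus[of "h * q"] by (simp add: eq_neg_iff_add_eq_0[symmetric])
      then show False using lt by simp
    qed
    then show ?thesis using fls_subdegree_add_eq2[OF h(1) lt] h(2) by simp
  qed (use h in simp)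
  then show "p + h * q \<noteq> 0" "fls_subdegree (p + h * q) < fls_subdegree q" "dle q (p + h * q)"
    by (auto simp: dle_def)
qed

text \<open>Ping-pong on degrees at infinity: after the letter \<open>(s, True)\<close> the first coordinate
  dominates, after \<open>(s, False)\<close> the second.\<close>

definition dominated :: "nat letter \<Rightarrow> laurent \<times> laurent \<Rightarrow> bool" where
  "dominated l v \<longleftrightarrow> (if snd l then \<exists>p. fst v = p + fs (fst l) * snd v \<and> dle p (snd v)
     else \<exists>q. snd v = q + fs (fst l) * fst v \<and> dle q (fst v))"

text \<open>If \<open>k\<close> and \<open>l\<close> have the same sign, each of the two unipotent
  factors raises the degree again. If the signs differ, two factors of the same kind meet and merge
  with parameter \<open>fs (fst k) + fs s\<close>, which is \<open>big\<close> because
  \<open>k \<noteq> inv_letter l\<close> forces distinct indices.\<close>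

lemma dominated_phl:
  assumes "(dle (fst v) (snd v) \<and> dle (snd v) (fst v)) \<or> (\<exists>k. dominated k v \<and> k \<noteq> inv_letter l)"
  shows "dominated l (mvec (phl l) v)"
proof -
  obtain p q where v: "v = (p, q)" by fastforce
  obtain s b where l: "l = (s, b)" by fastforce
  show ?thesis
  proof (cases b)
    case True
    have "dle p (q + fs s * p)"
      using assms
    proof (elim disjE exE conjE)
      assume "dle (fst v) (snd v)" "dle (snd v) (fst v)"
      then show ?thesis using dle_big(3)[OF _ big_fs] v by simp
    next
      fix k assume k: "dominated k v" "k \<noteq> inv_letter l"
      show ?thesis
      proof (cases "snd k")
        case T: True
        then obtain p0 where "p = p0 + fs (fst k) * q" "dle p0 q" using k(1) v by (auto simp: dominated_def)
        then have "dle q p" using dle_big(3) big_fs by blast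
        then show ?thesis using dle_big(3)[OF _ big_fs] by blast
      next
        case F: False
        then obtain q0 where q0: "q = q0 + fs (fst k) * p" "dle q0 p" using k(1) v by (auto simp: dominated_def)
        have "fst k \<noteq> s" using k(2) F l True by (cases k) (auto simp: inv_letter_def)
        then have "dle p (q0 + (fs (fst k) + fs s) * p)" using dle_big(3)[OF q0(2)] big_fs_add by blast
        then show ?thesis unfolding q0(1) by (simp add: algebra_simps)
      qed
    qed
    then show ?thesis using True by (auto simp: dominated_def l v mvec_phl)
  next
    case False
    have "dle q (p + fs s * q)"
      using assms
    proof (elim disjE exE conjE)
      assume "dle (fst v) (snd v)" "dle (snd v) (fst v)"
      then show ?thesis using dle_big(3)[OF _ big_fs] v by simp
    next
      fix k assume k: "dominated k v" "k \<noteq> inv_letter l"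
      show ?thesis
      proof (cases "snd k")
        case F: False
        then obtain q0 where "q = q0 + fs (fst k) * p" "dle q0 p" using k(1) v by (auto simp: dominated_def)
        then have "dle p q" using dle_big(3) big_fs by blast
        then show ?thesis using dle_big(3)[OF _ big_fs] by blast
      next
        case T: True
        then obtain p0 where p0: "p = p0 + fs (fst k) * q" "dle p0 q" using k(1) v by (auto simp: dominated_def)
        have "fst k \<noteq> s" using k(2) T l False by (cases k) (auto simp: inv_letter_def)
        then have "dle q (p0 + (fs (fst k) + fs s) * q)" using dle_big(3)[OF p0(2)] big_fs_add by blast
        then show ?thesis unfolding p0(1) by (simp add: algebra_simps)
      qed
    qed
    then show ?thesis using False by (auto simp: dominated_def l v mvec_phl)
  qed
qed

lemma dominated_ph: "reduced (l # w) \<Longrightarrow> dominated l (mvec (ph.ev (l # w)) (1, 1))"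
proof (induction w arbitrary: l)
  case Nil
  have "dle (1::laurent) 1" by (simp add: dle_def)
  then show ?case using dominated_phl[of "(1, 1)" l] by (simp add: ph.ev_Cons)
next
  case (Cons k w)
  then have "dominated k (mvec (ph.ev (k # w)) (1, 1))" by simp
  moreover have "k \<noteq> inv_letter l" using Cons.prems by simp
  ultimately have "dominated l (mvec (phl l) (mvec (ph.ev (k # w)) (1, 1)))"
    by (intro dominated_phl) blast
  then show ?case by (simp only: ph.ev_Cons[of l] mvec_mult)
qed

lemma dominated_not_1: "\<not> dominated l (1, 1)"
proof
  assume "dominated l (1, 1)"
  then obtain p where p: "1 = p + fs (fst l) * 1" "dle p 1" by (auto simp: dominated_def split: if_splits)
  have "fls_subdegree (p + fs (fst l) * 1) < fls_subdegree (1::laurent)"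
    by (rule dle_big(2)[OF p(2) big_fs])
  then show False unfolding p(1)[symmetric] by simp
qed

theorem ph_faithful:
  assumes "ph.ev u = ph.ev w"
  shows "reduce u = reduce w"
proof -
  have "ph.ev (u @ winv w) = 1" using assms ph.ev_winv[of w] by (simp add: ph.ev_append)
  then have 1: "ph.ev (reduce (u @ winv w)) = 1" by (simp add: ph.ev_reduce)
  have "reduce (u @ winv w) = []"
  proof (cases "reduce (u @ winv w)")
    case (Cons l z)
    then have "dominated l (mvec (ph.ev (l # z)) (1, 1))"
      using dominated_ph reduced_reduce[of "u @ winv w"] by metis
    then show ?thesis using 1 dominated_not_1 unfolding Cons by (simp add: mvec_1)
  qed
  then have "reduce (reduce (u @ winv w) @ w) = reduce w" by simp
  moreover have "reduce (reduce (u @ winv w) @ w) = reduce u"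
    unfolding reduce_append_left using reduce_cancel_words[of u "winv w" "[]"] by simp
  ultimately show ?thesis by simp
qed

section \<open>Sizes and the lattice for matrices\<close>

definition MU :: "nat \<Rightarrow> kmat set" where
  "MU c = {x. case x of M2 a b d e \<Rightarrow> a \<in> Uk c \<and> b \<in> Uk c \<and> d \<in> Uk c \<and> e \<in> Uk c}"

lemma MU_simps [simp]: "M2 a b d e \<in> MU c \<longleftrightarrow> a \<in> Uk c \<and> b \<in> Uk c \<and> d \<in> Uk c \<and> e \<in> Uk c"
  by (simp add: MU_def)

lemma MU_add: "x \<in> MU c \<Longrightarrow> y \<in> MU c \<Longrightarrow> x + y \<in> MU c"
  by (cases x; cases y) (simp add: Uk_add)

lemma MU_0: "0 \<in> MU c"
  by (simp add: zero_mat2_def Uk_0)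

lemma MU_mono: "c \<le> c' \<Longrightarrow> MU c \<subseteq> MU c'"
  using Uk_mono[of c c'] by (auto simp: MU_def split: mat2.splits)

lemma MU_mult: "x \<in> MU c \<Longrightarrow> y \<in> MU d \<Longrightarrow> x * y \<in> MU (c + d)"
  by (cases x; cases y) (simp add: Uk_add Uk_mult)

lemma MU_scal: "k \<in> Uk c \<Longrightarrow> x \<in> MU d \<Longrightarrow> scal k x \<in> MU (c + d)"
  by (cases x) (simp add: Uk_mult)

lemma MU_exists: "\<exists>c. x \<in> MU c"
proof (cases x)
  case (M2 a b d e)
  obtain c1 c2 c3 c4 where c: "a \<in> Uk c1" "b \<in> Uk c2" "d \<in> Uk c3" "e \<in> Uk c4" using Uk_exists by metis
  let ?c = "c1 + c2 + c3 + c4"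
  have "x \<in> MU ?c" unfolding M2 using c Uk_mono[of c1 ?c] Uk_mono[of c2 ?c] Uk_mono[of c3 ?c] Uk_mono[of c4 ?c] by auto
  then show ?thesis ..
qed

definition MR :: "kmat set" where
  "MR = {x. case x of M2 a b d e \<Rightarrow> a \<in> R3 \<and> b \<in> R3 \<and> d \<in> R3 \<and> e \<in> R3}"

lemma MR_simps [simp]: "M2 a b d e \<in> MR \<longleftrightarrow> a \<in> R3 \<and> b \<in> R3 \<and> d \<in> R3 \<and> e \<in> R3"
  by (simp add: MR_def)

lemma MR_add: "x \<in> MR \<Longrightarrow> y \<in> MR \<Longrightarrow> x + y \<in> MR"
  by (cases x; cases y) (simp add: R3_add)

lemma MR_0: "0 \<in> MR" and MR_1: "1 \<in> MR"
  by (simp_all add: zero_mat2_def one_mat2_def R3.zero R3_1)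

lemma MR_mult: "x \<in> MR \<Longrightarrow> y \<in> MR \<Longrightarrow> x * y \<in> MR"
  by (cases x; cases y) (simp add: R3_add R3_mult)

lemma MR_scal: "k \<in> R3 \<Longrightarrow> x \<in> MR \<Longrightarrow> scal k x \<in> MR"
  by (cases x) (simp add: R3_mult)

lemma MR_phl: "phl l \<in> MR"
  by (simp add: phl_def Let_def uu_def ll_def R3_basis R3_1 R3.zero MR_mult del: power_Suc times_mat2.simps)

lemma MR_ph: "ph.ev w \<in> MR"
  by (induction w) (simp_all add: ph.ev_Cons MR_1 MR_mult MR_phl)

fun mrho :: "kmat \<Rightarrow> kmat" where
  "mrho (M2 a b c d) = M2 (krho a) (krho b) (krho c) (krho d)"

lemma mrho_add: "mrho (x + y) = mrho x + mrho y"
  by (cases x; cases y) (simp add: krho_add)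

lemma mrho_iff: "mrho x = x \<longleftrightarrow> x \<in> MR"
  by (cases x) (simp add: krho_iff)

lemma mrho_MR: "mrho x \<in> MR"
  by (cases x) (simp add: krho)

lemma mrho_MU: "x - mrho x \<in> MU 0"
  by (cases x) (simp add: k3_minus krho)

lemma finite_MR_MU: "finite (MR \<inter> MU c)"
proof -
  let ?F = "R3 \<inter> Uk c"
  have "MR \<inter> MU c \<subseteq> (\<lambda>(a, b, d, e). M2 a b d e) ` (?F \<times> ?F \<times> ?F \<times> ?F)"
  proof
    fix x assume "x \<in> MR \<inter> MU c"
    then show "x \<in> (\<lambda>(a, b, d, e). M2 a b d e) ` (?F \<times> ?F \<times> ?F \<times> ?F)"
      by (cases x) (auto intro!: image_eqI[of _ _ "(_, _, _, _)"])
  qed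
  then show ?thesis using finite_R3_Uk by (meson finite_SigmaI finite_imageI finite_subset)
qed

section \<open>The group\<close>

type_synonym amod = "kmat \<times> kmat"

datatype gen = C nat | D nat | E | V nat

text \<open>The units \<open>(1+x)/x^2\<close>, \<open>x/(1+x)^2\<close> and \<open>x(1+x)\<close>
  and their inverses. The valuations of the three at 0, 1 and infinity are (-2, 1, 1), (1, -2, 1)
  and (1, 1, -2).\<close>

definition vv :: "nat \<Rightarrow> bool \<Rightarrow> k3" where
  "vv j b = (if j = 0 then (if b then ky * kxi * kxi else kyi * kx * kx)
    else if j = 1 then (if b then kx * kyi * kyi else kxi * ky * ky)
    else (if b then kx * ky else kxi * kyi))"

lemma vv_inverse: "vv j b * vv j (\<not> b) = 1"
proof -
  have e: "ky * kxi * kxi * (kyi * kx * kx) = (ky * kyi) * (kx * kxi) * (kx * kxi)"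
    "kx * kyi * kyi * (kxi * ky * ky) = (kx * kxi) * (ky * kyi) * (ky * kyi)"
    "kx * ky * (kxi * kyi) = (kx * kxi) * (ky * kyi)"
    by (simp_all only: ac_simps)
  have "vv j True * vv j False = 1" for j
    unfolding vv_def by (simp add: e k_inverse)
  then show ?thesis by (cases b) (simp_all add: mult.commute)
qed

lemma vv_R3: "vv j b \<in> R3"
  by (simp add: vv_def R3_mult R3_small)

fun pl :: "nat \<Rightarrow> place" where
  "pl 0 = P0" | "pl (Suc 0) = P1" | "pl (Suc (Suc n)) = P2"

lemma vv_contract: "p \<noteq> pl j \<Longrightarrow> j < 3 \<Longrightarrow> fls_subdegree (cmp (vv j True) p) = 1"
proof -
  assume p: "p \<noteq> pl j" "j < 3"
  have n: "cmp kxi p \<noteq> 0" "cmp kyi p \<noteq> 0" using kx_nonzero ky_nonzero by (simp_all add: kxi_def kyi_def)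
  consider "j = 0" | "j = 1" | "j = 2" using p(2) by linarith
  then show ?thesis
    by cases (use p(1) n in \<open>cases p; simp add: vv_def numeral_2_eq_2 kx_nonzero ky_nonzero kx_deg ky_deg kxi_deg kyi_deg\<close>)+
qed

text \<open>The idempotents of the three factors; multiplication by them gives the component
  projections.\<close>

definition ee :: "nat \<Rightarrow> k3" where
  "ee i = K3 (if pl i = P0 then 1 else 0) (if pl i = P1 then 1 else 0) (if pl i = P2 then 1 else 0)"

lemma cmp_ee: "cmp (ee i) p = (if pl i = p then 1 else 0)"
  by (cases p) (simp_all add: ee_def)

lemma ee_sum: "ee 0 + ee 1 + ee 2 = 1"
  by (rule k3_eqI) (simp add: cmp_ee numeral_2_eq_2, metis place.exhaust)

lemma ee_mult: "i < 3 \<Longrightarrow> j < 3 \<Longrightarrow> i \<noteq> j \<Longrightarrow> ee i * ee j = 0"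
proof (rule k3_eqI)
  fix p assume "i < 3" "j < 3" "i \<noteq> j"
  then have "pl i \<noteq> pl j"
    by (auto simp: less_Suc_eq numeral_3_eq_3)
  then show "cmp (ee i * ee j) p = cmp 0 p" by (auto simp: cmp_ee)
qed

lemma Uk_ee: "a \<in> Uk c \<Longrightarrow> ee i * a \<in> Uk c"
  by (auto simp: Uk_def cmp_ee)

lemma Uk_contract:
  assumes "j < 3" "ee j * a = 0" "a \<in> Uk c"
  shows "vv j True * a \<in> Uk (c - 1)"
proof -
  have "reg (lo p - int (c - 1)) (cmp (vv j True * a) p)" for p
  proof (cases "p = pl j")
    case True
    have "cmp (ee j * a) p = 0" using assms(2) by simp
    then have "cmp a p = 0" using True by (simp add: cmp_ee)
    then show ?thesis by simp
  next
    case False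
    have "reg 1 (cmp (vv j True) p)" using vv_contract[OF False assms(1)] by (simp add: reg_iff)
    moreover have "reg (lo p - int c) (cmp a p)" using assms(3) by (simp add: Uk_def)
    ultimately have "reg (1 + (lo p - int c)) (cmp (vv j True * a) p)" using reg_mult by simp
    then show ?thesis by (rule reg_mono) simp
  qed
  then show ?thesis by (simp add: Uk_def)
qed

lemma MU_ee: "x \<in> MU c \<Longrightarrow> scal (ee i) x \<in> MU c"
  by (cases x) (simp add: Uk_ee)

lemma MU_contract: "j < 3 \<Longrightarrow> scal (ee j) x = 0 \<Longrightarrow> x \<in> MU c \<Longrightarrow> scal (vv j True) x \<in> MU (c - 1)"
  by (cases x) (auto simp: zero_mat2_def intro: Uk_contract[simplified])

text \<open>The letters \<open>C s\<close> conjugate the first matrix, \<open>D i\<close> multiply it by a relator matrix, and \<open>E\<close>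
  adds the second matrix to the first one. Conjugating the translation by \<open>(0, 1)\<close> by a word \<open>w\<close> in the
  \<open>C s\<close> gives the translation by \<open>(0, \<phi> w)\<close>, whose commutator with \<open>E\<close> is the translation by \<open>(\<phi> w, 0)\<close>.\<close>

definition gact :: "nat word list \<Rightarrow> gen letter \<Rightarrow> amod \<Rightarrow> amod" where
  "gact rl l z = (case fst l of
     C s \<Rightarrow> (phl (s, snd l) * fst z * phl (s, \<not> snd l), phl (s, snd l) * snd z)
   | D i \<Rightarrow> (fst z * ph.ev (if snd l then rl ! i else winv (rl ! i)), snd z)
   | E \<Rightarrow> (fst z + snd z, snd z)
   | V j \<Rightarrow> (scal (vv j (snd l)) (fst z), scal (vv j (snd l)) (snd z)))"

lemma gact_simps:
  "gact rl (C s, b) (x, y) = (phl (s, b) * x * phl (s, \<not> b), phl (s, b) * y)"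
  "gact rl (D i, b) (x, y) = (x * ph.ev (if b then rl ! i else winv (rl ! i)), y)"
  "gact rl (E, b) (x, y) = (x + y, y)"
  "gact rl (V j, b) (x, y) = (scal (vv j b) x, scal (vv j b) y)"
  by (simp_all add: gact_def)

lemma phl_inv: "phl (s, b) * phl (s, \<not> b) = 1" "phl (s, \<not> b) * phl (s, b) = 1"
  using phl_inverse[of "(s, b)"] phl_inverse[of "(s, \<not> b)"] by (simp_all add: inv_letter_def)

definition AU :: "nat \<Rightarrow> amod set" where "AU c = MU c \<times> MU c"

definition api :: "nat \<Rightarrow> amod \<Rightarrow> amod" where
  "api i z = (scal (ee i) (fst z), scal (ee i) (snd z))"

definition arho :: "amod \<Rightarrow> amod" where
  "arho z = (mrho (fst z), mrho (snd z))"

definition ggens :: "nat \<Rightarrow> nat word list \<Rightarrow> gen set" where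
  "ggens m rl = C ` {..<3 + m} \<union> D ` {..<length rl} \<union> {E} \<union> V ` {..<3}"

lemma gact_add: "gact rl q (z + w) = gact rl q z + gact rl q w"
  by (cases z; cases w; cases q; cases "fst q")
    (simp_all add: gact_simps scal_simps distrib_left distrib_right add.assoc add.left_commute)

lemma gact_inv: "gact rl q (gact rl (inv_letter q) z) = z"
proof -
  obtain x y where z: "z = (x, y)" by fastforce
  obtain g b where q: "q = (g, b)" by fastforce
  show ?thesis
  proof (cases g)
    case (C s)
    have "phl (s, b) * (phl (s, \<not> b) * x * phl (s, b)) * phl (s, \<not> b) =
        (phl (s, b) * phl (s, \<not> b)) * x * (phl (s, b) * phl (s, \<not> b))"
      by (simp only: mult.assoc)
    moreover have "phl (s, b) * (phl (s, \<not> b) * y) = (phl (s, b) * phl (s, \<not> b)) * y" by (simp only: mult.assoc)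
    ultimately show ?thesis by (simp add: z q C inv_letter_def gact_simps phl_inv)
  next
    case (D i)
    have "x * ph.ev w * ph.ev (winv w) = x" "x * ph.ev (winv w) * ph.ev w = x" for w
      by (simp_all add: mult.assoc ph.ev_winv ph.ev_winv')
    then show ?thesis by (simp add: z q D inv_letter_def gact_simps)
  next
    case E
    then show ?thesis by (simp add: z q inv_letter_def gact_simps add.assoc)
  next
    case (V j)
    then show ?thesis by (simp add: z q inv_letter_def gact_simps scal_simps vv_inverse)
  qed
qed

lemma gact_bound: "\<exists>c. \<forall>d z. z \<in> AU d \<longrightarrow> gact rl q z \<in> AU (d + c)"
proof -
  obtain g b where q: "q = (g, b)" by fastforce
  have m: "x \<in> MU i \<Longrightarrow> i \<le> j \<Longrightarrow> x \<in> MU j" for x i j using MU_mono by blast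
  show ?thesis
  proof (cases g)
    case (C s)
    obtain c1 c2 where c: "phl (s, b) \<in> MU c1" "phl (s, \<not> b) \<in> MU c2" using MU_exists by metis
    have "gact rl q z \<in> AU (d + (c1 + c2))" if zd: "z \<in> AU d" for d z
    proof -
      obtain x y where z: "z = (x, y)" "x \<in> MU d" "y \<in> MU d" using zd by (auto simp: AU_def)
      have "phl (s, b) * x * phl (s, \<not> b) \<in> MU (c1 + d + c2)" by (intro MU_mult c z)
      moreover have "phl (s, b) * y \<in> MU (c1 + d)" by (intro MU_mult c z)
      ultimately show ?thesis by (auto simp: z q C gact_simps AU_def elim: m)
    qed
    then show ?thesis by blast
  next
    case (D i)
    obtain c where c: "ph.ev (if b then rl ! i else winv (rl ! i)) \<in> MU c" using MU_exists by metis
    have "gact rl q z \<in> AU (d + c)" if zd: "z \<in> AU d" for d z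
    proof -
      obtain x y where z: "z = (x, y)" "x \<in> MU d" "y \<in> MU d" using zd by (auto simp: AU_def)
      have "x * ph.ev (if b then rl ! i else winv (rl ! i)) \<in> MU (d + c)" by (intro MU_mult c z)
      moreover have "y \<in> MU (d + c)" using z(3) by (rule m) simp
      ultimately show ?thesis unfolding q D z gact_simps AU_def by blast
    qed
    then show ?thesis by blast
  next
    case E
    have "gact rl q z \<in> AU (d + 0)" if "z \<in> AU d" for d z
      using that by (cases z) (simp add: q E gact_simps AU_def MU_add)
    then show ?thesis by blast
  next
    case (V j)
    obtain c where c: "vv j b \<in> Uk c" using Uk_exists by blast
    have "gact rl q z \<in> AU (d + c)" if zd: "z \<in> AU d" for d z
    proof -
      obtain x y where z: "z = (x, y)" "x \<in> MU d" "y \<in> MU d" using zd by (auto simp: AU_def)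
      show ?thesis unfolding z q V gact_simps AU_def add.commute[of d c]
        by (intro SigmaI MU_scal c z)
    qed
    then show ?thesis by blast
  qed
qed

lemma AU_mono: "c \<le> c' \<Longrightarrow> AU c \<subseteq> AU c'"
  using MU_mono by (auto simp: AU_def)

lemma finite_ggens: "finite (ggens m rl)"
  by (simp add: ggens_def)

text \<open>The condition \<open>\<kappa> \<ge> 1\<close> makes the translations by
  \<open>(1, 0)\<close> and \<open>(0, 1)\<close> available as generators: 1 does not vanish at
  infinity and so is not in \<open>Uk 0\<close>.\<close>

lemma kappa_exists:
  obtains \<kappa> where "\<kappa> \<ge> 1" "\<And>q d z. fst q \<in> ggens m rl \<Longrightarrow> z \<in> AU d \<Longrightarrow> gact rl q z \<in> AU (d + \<kappa>)"
proof -
  let ?A = "ggens m rl \<times> (UNIV :: bool set)"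
  obtain f where f: "\<And>q d z. z \<in> AU d \<Longrightarrow> gact rl q z \<in> AU (d + f q)"
    using gact_bound by metis
  define \<kappa> where "\<kappa> = Max (insert 1 (f ` ?A))"
  have fin: "finite (insert 1 (f ` ?A))" using finite_ggens by simp
  show thesis
  proof (rule that[of \<kappa>])
    show "\<kappa> \<ge> 1" unfolding \<kappa>_def using fin by (intro Max_ge) auto
    fix q :: "gen letter" and d z assume q: "fst q \<in> ggens m rl" and z: "z \<in> AU d"
    have "f q \<le> \<kappa>" unfolding \<kappa>_def using fin q by (intro Max_ge) (auto simp: mem_Times_iff)
    then have "AU (d + f q) \<subseteq> AU (d + \<kappa>)" by (intro AU_mono) simp
    moreover have "gact rl q z \<in> AU (d + f q)" using z by (rule f)
    ultimately show "gact rl q z \<in> AU (d + \<kappa>)" by blast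
  qed
qed

lemma gact_MR: "z \<in> MR \<times> MR \<Longrightarrow> gact rl q z \<in> MR \<times> MR"
  by (cases z; cases q; cases "fst q")
    (auto simp: gact_simps MR_mult MR_phl MR_ph MR_add MR_scal vv_R3)

lemma arho_iff: "arho z = z \<longleftrightarrow> z \<in> MR \<times> MR"
  by (cases z) (auto simp: arho_def mrho_iff)

text \<open>The conditions on units and projections hold because both are scalar multiplications,
  which commute with all letters.\<close>

lemma tame_lattice_gact:
  assumes \<kappa>: "\<And>q d z. fst q \<in> ggens m rl \<Longrightarrow> z \<in> AU d \<Longrightarrow> gact rl q z \<in> AU (d + \<kappa>)"
    and enc: "inj_on enc (Inl ` ggens m rl \<union> Inr ` {a \<in> AU \<kappa>. arho a = a})"
  shows "tame_lattice (gact rl) AU api (ggens m rl) V \<kappa> arho enc"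
proof
  fix a b z :: amod and q :: "gen letter" and c c' i j :: nat and s :: bool
  show "gact rl q (a + b) = gact rl q a + gact rl q b" by (rule gact_add)
  show "gact rl q (gact rl (inv_letter q) a) = a" by (rule gact_inv)
  show "a \<in> AU c \<Longrightarrow> b \<in> AU c \<Longrightarrow> a + b \<in> AU c" by (cases a; cases b) (simp add: AU_def MU_add)
  show "0 \<in> AU c" by (simp add: AU_def MU_0 zero_prod_def)
  show "c \<le> c' \<Longrightarrow> AU c \<subseteq> AU c'" by (rule AU_mono)
  show "fst q \<in> ggens m rl \<Longrightarrow> a \<in> AU c \<Longrightarrow> gact rl q a \<in> AU (c + \<kappa>)" by (rule \<kappa>)
  show "api i (a + b) = api i a + api i b" by (simp add: api_def scal_simps)
  show "a \<in> AU c \<Longrightarrow> api i a \<in> AU c" by (auto simp: api_def AU_def MU_ee)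
  have "scal (ee 0) x + scal (ee 1) x + scal (ee 2) x = x" for x
    using ee_sum by (metis scal_simps(5) scal_simps(7))
  then show "api 0 a + api 1 a + api 2 a = a" by (cases a) (simp only: api_def fst_conv snd_conv add_Pair)
  show "i < 3 \<Longrightarrow> j < 3 \<Longrightarrow> i \<noteq> j \<Longrightarrow> api i (api j a) = 0"
    by (simp add: api_def scal_simps ee_mult zero_prod_def)
  show "api i (gact rl q a) = gact rl q (api i a)"
    by (cases a; cases q; cases "fst q") (simp_all add: api_def gact_simps scal_simps mult.assoc mult.commute[of "ee i"])
  show "j < 3 \<Longrightarrow> V j \<in> ggens m rl" by (simp add: ggens_def)
  show "i < 3 \<Longrightarrow> j < 3 \<Longrightarrow> V i = V j \<Longrightarrow> i = j" by simp
  show "j < 3 \<Longrightarrow> gact rl (V j, s) (gact rl q a) = gact rl q (gact rl (V j, s) a)"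
    by (cases a; cases q; cases "fst q") (simp_all add: gact_simps scal_simps mult.assoc mult.commute[of "vv j s"])
  show "j < 3 \<Longrightarrow> api j a = 0 \<Longrightarrow> a \<in> AU c \<Longrightarrow> gact rl (V j, True) a \<in> AU (c - 1)"
    by (cases a) (simp add: api_def gact_simps AU_def MU_contract[simplified] zero_prod_def)
  show "arho (a + b) = arho a + arho b" by (simp add: arho_def mrho_add)
  have "arho a \<in> MR \<times> MR" by (simp add: arho_def mrho_MR)
  then show "arho (arho a) = arho a" by (simp only: arho_iff)
  show "arho a = a \<Longrightarrow> arho (gact rl q a) = gact rl q a" unfolding arho_iff by (rule gact_MR)
  show "a - arho a \<in> AU 0" by (cases a) (simp add: arho_def AU_def mrho_MU)
  show "a \<in> AU c \<Longrightarrow> - a \<in> AU c" by (cases a) (simp add: kmat_uminus)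
  show "finite (ggens m rl)" by (rule finite_ggens)
  have "{a \<in> AU \<kappa>. arho a = a} \<subseteq> (MR \<inter> MU \<kappa>) \<times> (MR \<inter> MU \<kappa>)" by (auto simp: arho_iff AU_def)
  then show "finite {a \<in> AU \<kappa>. arho a = a}" using finite_MR_MU by (meson finite_SigmaI finite_subset)
  show "inj_on enc (Inl ` ggens m rl \<union> Inr ` {a \<in> AU \<kappa>. arho a = a})" by (rule enc)
qed

text \<open>The orbit of \<open>(1, 0)\<close> is, up to the scalars, the set of matrices of null words
  (Mihailova's trick); the determinant excludes the scalars.\<close>

context
  fixes m :: nat and rl :: "nat word list" and \<kappa> :: nat and enc :: "gen + amod \<Rightarrow> nat"
  assumes lattice: "tame_lattice (gact rl) AU api (ggens m rl) V \<kappa> arho enc"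
begin

interpretation L: tame_lattice "gact rl" AU api "ggens m rl" V \<kappa> arho enc
  by (rule lattice)

lemma qact_append: "L.qact (ps @ qs) z = L.qact qs (L.qact ps z)"
  by (simp add: L.qact_def)

lemma null_word_orbit:
  assumes "null_word (affine_gens m) (set rl) w"
  shows "\<exists>qs. fst ` set qs \<subseteq> ggens m rl \<and> L.qact qs (1, 0) = (ph.ev w, 0)"
  using assms
proof induction
  case empty
  show ?case by (rule exI[of _ "[]"]) simp
next
  case (conj w a)
  then obtain qs where qs: "fst ` set qs \<subseteq> ggens m rl" "L.qact qs (1, 0) = (ph.ev w, 0)" by blast
  obtain s b where a: "a = (s, b)" by fastforce
  \<comment> \<open>\<open>qact\<close> applies inverse letters, hence the reversed sign.\<close>
  have "L.qact (qs @ [(C s, \<not> b)]) (1, 0) = (ph.ev (a # w @ [inv_letter a]), 0)"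
    by (simp add: qact_append qs(2) a inv_letter_def gact_simps ph.ev_Cons ph.ev_append mult.assoc)
  moreover have "C s \<in> ggens m rl" using conj.hyps(2) a by (auto simp: ggens_def affine_gens_def)
  ultimately show ?case using qs(1) by (intro exI[of _ "qs @ [(C s, \<not> b)]"]) auto
next
  case (rel w r)
  then obtain qs where qs: "fst ` set qs \<subseteq> ggens m rl" "L.qact qs (1, 0) = (ph.ev w, 0)" by blast
  obtain i where i: "i < length rl" "rl ! i = r" using rel.hyps(2) by (auto simp: in_set_conv_nth)
  have "L.qact (qs @ [(D i, False)]) (1, 0) = (ph.ev (w @ r), 0)"
    by (simp add: qact_append qs(2) inv_letter_def gact_simps ph.ev_append i)
  moreover have "D i \<in> ggens m rl" using i by (simp add: ggens_def)
  ultimately show ?case using qs(1) by (intro exI[of _ "qs @ [(D i, False)]"]) auto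
next
  case (rel_inv w r)
  then obtain qs where qs: "fst ` set qs \<subseteq> ggens m rl" "L.qact qs (1, 0) = (ph.ev w, 0)" by blast
  obtain i where i: "i < length rl" "rl ! i = r" using rel_inv.hyps(2) by (auto simp: in_set_conv_nth)
  have "L.qact (qs @ [(D i, True)]) (1, 0) = (ph.ev (w @ winv r), 0)"
    by (simp add: qact_append qs(2) inv_letter_def gact_simps ph.ev_append i)
  moreover have "D i \<in> ggens m rl" using i by (simp add: ggens_def)
  ultimately show ?case using qs(1) by (intro exI[of _ "qs @ [(D i, True)]"]) auto
next
  case (reduce w v)
  then show ?case using ph.ev_reduce by metis
qed

text \<open>With second matrix 0 the letter \<open>E\<close> does nothing, the letters
  \<open>C\<close> and \<open>D\<close> perform the generating operations of
  \<open>null_word\<close>, and the letters \<open>V\<close> only contribute a scalar.\<close>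

lemma orbit_null_word:
  assumes "fst ` set qs \<subseteq> ggens m rl"
  shows "\<exists>k w. null_word (affine_gens m) (set rl) w \<and> L.qact qs (1, 0) = (scal k (ph.ev w), 0)"
  using assms
proof (induction qs rule: rev_induct)
  case Nil
  then show ?case using null_word.empty by (intro exI[of _ 1] exI[of _ "[]"]) (simp add: scal_simps)
next
  case (snoc q qs)
  then obtain k w where w: "null_word (affine_gens m) (set rl) w" "L.qact qs (1, 0) = (scal k (ph.ev w), 0)"
    by auto
  obtain g b where q: "q = (g, b)" by fastforce
  have step: "L.qact (qs @ [q]) (1, 0) = gact rl (g, \<not> b) (scal k (ph.ev w), 0)"
    by (simp add: qact_append w(2) q inv_letter_def)
  have g: "g \<in> ggens m rl" using snoc.prems q by simp
  show ?case
  proof (cases g)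
    case (C s)
    then have "s \<in> affine_gens m" using g by (auto simp: ggens_def affine_gens_def)
    then have "null_word (affine_gens m) (set rl) ((s, \<not> b) # w @ [inv_letter (s, \<not> b)])"
      using w(1) by (intro null_word.conj) auto
    moreover have "L.qact (qs @ [q]) (1, 0) = (scal k (ph.ev ((s, \<not> b) # w @ [inv_letter (s, \<not> b)])), 0)"
      unfolding step C by (simp add: gact_simps scal_simps ph.ev_Cons ph.ev_append inv_letter_def mult.assoc)
    ultimately show ?thesis by blast
  next
    case (D i)
    then have i: "rl ! i \<in> set rl" using g by (auto simp: ggens_def)
    let ?w = "w @ (if \<not> b then rl ! i else winv (rl ! i))"
    have "null_word (affine_gens m) (set rl) ?w"
      using null_word.rel[OF w(1) i] null_word.rel_inv[OF w(1) i] by simp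
    moreover have "L.qact (qs @ [q]) (1, 0) = (scal k (ph.ev ?w), 0)"
      unfolding step D by (simp add: gact_simps scal_simps ph.ev_append)
    ultimately show ?thesis by blast
  next
    case E
    then have "L.qact (qs @ [q]) (1, 0) = (scal k (ph.ev w), 0)" unfolding step by (simp add: gact_simps)
    then show ?thesis using w(1) by blast
  next
    case (V j)
    then have "L.qact (qs @ [q]) (1, 0) = (scal (vv j (\<not> b) * k) (ph.ev w), 0)"
      unfolding step by (simp add: gact_simps scal_simps)
    then show ?thesis using w(1) by blast
  qed
qed

text \<open>In characteristic 2, \<open>k^2 + 1 = (k + 1)^2\<close>, and the components lie in a
  field. A scalar that preserves determinant 1 is therefore trivial.\<close>

lemma k3_sqrt_1: "(k::k3) * k = 1 \<Longrightarrow> k = 1"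
proof (rule k3_eqI)
  fix p assume "k * k = 1"
  then have 1: "cmp k p * cmp k p = 1" by (metis cmp_simps(2) cmp_simps(6))
  have "(cmp k p + 1) * (cmp k p + 1) = cmp k p * cmp k p + (cmp k p + cmp k p) + 1"
    by (simp only: algebra_simps) simp
  also have "\<dots> = 0" by (simp only: 1 laurent_double add_0_right)
  finally have "cmp k p + 1 = 0" by simp
  then have "cmp k p = - 1" by (simp add: eq_neg_iff_add_eq_0)
  then show "cmp k p = cmp 1 p" by (simp add: laurent_uminus)
qed

lemma orbit_iff:
  "(\<exists>qs. fst ` set qs \<subseteq> ggens m rl \<and> (ph.ev w, 0) = L.qact qs (1, 0)) \<longleftrightarrow>
    null_word (affine_gens m) (set rl) w"
proof
  assume "\<exists>qs. fst ` set qs \<subseteq> ggens m rl \<and> (ph.ev w, 0) = L.qact qs (1, 0)"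
  then obtain qs where qs: "fst ` set qs \<subseteq> ggens m rl" "(ph.ev w, 0) = L.qact qs (1, 0)" by blast
  obtain k u where u: "null_word (affine_gens m) (set rl) u" "ph.ev w = scal k (ph.ev u)"
    using orbit_null_word[OF qs(1)] unfolding qs(2)[symmetric] by auto
  have "k * k = 1" using arg_cong[OF u(2), of det2] by (simp add: det2_scal det_ph)
  then have "k = 1" by (rule k3_sqrt_1)
  then have "ph.ev u = ph.ev w" using u(2) by (simp add: scal_simps)
  then show "null_word (affine_gens m) (set rl) w" using ph_faithful u(1) null_word.reduce by blast
next
  assume "null_word (affine_gens m) (set rl) w"
  then show "\<exists>qs. fst ` set qs \<subseteq> ggens m rl \<and> (ph.ev w, 0) = L.qact qs (1, 0)"
    using null_word_orbit[of w] by (metis (no_types))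
qed

definition ql :: "bool \<Rightarrow> gen \<Rightarrow> nat letter" where "ql b g = (enc (Inl g), b)"

text \<open>The commutator of \<open>E\<close> with the conjugate of \<open>e\<close> by
  \<open>p\<close>: in characteristic 2 a translation is its own inverse, so the conjugate is simply
  repeated. The length is linear in that of \<open>w\<close>, however large the translation
  is.\<close>

definition test_word :: "nat word \<Rightarrow> nat word" where
  "test_word w = (let p = map (\<lambda>(s, b). ql b (C s)) w; e = (enc (Inr (0, 1)), True) in
     [ql True E] @ p @ [e] @ winv p @ [ql False E] @ p @ [e] @ winv p)"

lemma test_word:
  assumes \<kappa>: "\<kappa> \<ge> 1" and w: "w \<in> words (affine_gens m)"
  shows "conjugate_in (presented_group L.gens L.rels) (word_value L.gens L.rels [L.tl (1, 0)])
      (word_value L.gens L.rels (test_word w)) \<longleftrightarrow> null_word (affine_gens m) (set rl) w"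
    and "[L.tl (1, 0)] \<in> words L.gens" and "test_word w \<in> words L.gens"
proof -
  have 1: "(1::k3) \<in> Uk \<kappa>"
  proof -
    have "reg (lo p - int \<kappa>) 1" for p using \<kappa> by (cases p) (auto simp: reg_def)
    then show ?thesis by (simp add: Uk_def)
  qed
  then have lat: "(1, 0) \<in> L.lat" "(0, 1) \<in> L.lat"
    by (simp_all add: L.lat_def arho_iff AU_def MU_0 MR_0 MR_1) (simp_all add: one_mat2_def Uk_0)
  define p where "p = map (\<lambda>(s, b). (C s, b)) w"
  have ql: "ql b g = L.ql (g, b)" for b g by (simp add: ql_def L.ql_def)
  have p_eq: "map (\<lambda>(s, b). ql b (C s)) w = map L.ql p" by (auto simp: p_def ql)
  have pY: "fst ` set p \<subseteq> ggens m rl"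
    using w by (auto simp: p_def words_def ggens_def affine_gens_def image_iff)
  have EY: "E \<in> ggens m rl" by (simp add: ggens_def)
  have tw: "test_word w = [L.ql (E, True)] @ map L.ql p @ [L.tl (0, 1)] @ winv (map L.ql p) @
      [L.ql (E, False)] @ map L.ql p @ [L.tl (0, 1)] @ winv (map L.ql p)"
    unfolding test_word_def Let_def p_eq by (simp add: ql L.tl_def)
  have pw: "map L.ql p \<in> words L.gens" using pY by (induction p) auto
  show 2: "[L.tl (1, 0)] \<in> words L.gens" using lat by simp
  show 3: "test_word w \<in> words L.gens"
    unfolding tw using pw lat EY by simp
  have inv_ql: "inv_letter (L.ql q) = L.ql (inv_letter q)" for q by (simp add: L.ql_def inv_letter_def)
  have swp: "L.sw (map L.ql p) = map Q p" "L.sw (winv (map L.ql p)) = map Q (winv p)"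
  proof -
    show "L.sw (map L.ql p) = map Q p" using pY by (induction p) (auto simp: L.sl_ql)
    have "winv (map L.ql p) = map L.ql (winv p)" by (simp add: winv_def rev_map inv_ql)
    moreover have "fst ` set (winv p) \<subseteq> ggens m rl" using pY by (auto simp: winv_def)
    then have "L.sw (map L.ql (winv p)) = map Q (winv p)" by (induction "winv p" arbitrary: p) (auto simp: L.sw_def L.sl_ql)
    ultimately show "L.sw (winv (map L.ql p)) = map Q (winv p)" by simp
  qed
  let ?s = "[Q (E, True)] @ map Q p @ [T (0, 1)] @ map Q (winv p) @ [Q (E, False)] @ map Q p @ [T (0, 1)] @ map Q (winv p)"
  have sw: "L.sw (test_word w) = ?s"
    unfolding tw using lat EY by (simp add: swp L.sl_ql L.sl_tl)
  have st_p: "L.st a (map Q p @ [T (0, 1)] @ map Q (winv p)) = a + (0, ph.ev w)" for a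
  proof -
    have "L.st a (map Q p @ [T (0, y)] @ map Q (winv p)) = a + (0, ph.ev w * y)" for y
      unfolding p_def
    proof (induction w arbitrary: a y)
      case Nil
      then show ?case by simp
    next
      case (Cons l w)
      obtain s b where l: "l = (s, b)" by fastforce
      let ?p = "map (\<lambda>(s, b). (C s, b)) w"
      have "L.st a (map Q (map (\<lambda>(s, b). (C s, b)) (l # w)) @ [T (0, y)] @ map Q (winv (map (\<lambda>(s, b). (C s, b)) (l # w))))
        = gact rl (C s, b) (L.st (gact rl (inv_letter (C s, b)) a) (map Q ?p @ [T (0, y)] @ map Q (winv ?p)))"
        by (simp add: l winv_Cons)
      also have "\<dots> = gact rl (C s, b) (gact rl (inv_letter (C s, b)) a + (0, ph.ev w * y))"
        by (simp only: Cons.IH)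
      also have "\<dots> = a + (0, ph.ev (l # w) * y)"
        unfolding gact_add gact_inv by (simp add: gact_simps l ph.ev_Cons mult.assoc)
      finally show ?case .
    qed
    then show ?thesis by simp
  qed
  have E: "gact rl (E, b) (gact rl (E, c) z) = z" for b c z
    by (cases z) (simp add: gact_simps add.assoc)
  have st: "L.st a (L.sw (test_word w)) = a + (ph.ev w, 0)" for a
  proof -
    have "?s = [Q (E, True)] @ (map Q p @ [T (0, 1)] @ map Q (winv p)) @ [Q (E, False)] @ (map Q p @ [T (0, 1)] @ map Q (winv p))"
      by simp
    then have "L.st a ?s = L.st (L.st (L.st (L.st a [Q (E, True)]) (map Q p @ [T (0, 1)] @ map Q (winv p))) [Q (E, False)])
        (map Q p @ [T (0, 1)] @ map Q (winv p))"
      by (simp only: L.st_simps(3))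
    also have "\<dots> = gact rl (E, True) (gact rl (E, False) a + (0, ph.ev w)) + (0, ph.ev w)"
      unfolding st_p by (simp add: inv_letter_def)
    also have "\<dots> = a + (gact rl (E, True) (0, ph.ev w) + (0, ph.ev w))"
      unfolding gact_add E by (simp only: add.assoc)
    \<comment> \<open>The second coordinates cancel in characteristic 2, and the copy that
      \<open>E\<close> adds to the first coordinate remains.\<close>
    also have "\<dots> = a + (ph.ev w, 0)" by (simp add: gact_simps)
    finally show ?thesis unfolding sw .
  qed
  have q: "qpart ?s = [(E, True)] @ (p @ winv p) @ [(E, False)] @ (p @ winv p)" by simp
  have Vp: "q \<in> set (p @ winv p) \<Longrightarrow> fst q \<notin> range V" for q by (auto simp: p_def winv_def)
  have qf: "L.qfree (qpart ?s) = [(E, True)] @ (p @ winv p) @ [(E, False)] @ (p @ winv p)"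
    unfolding L.qfree_def q by (rule filter_True) (use Vp in fastforce)
  have red: "reduce (L.qfree (qpart ?s)) = []"
  proof -
    have "reduce ([(E, True)] @ (p @ winv p) @ [(E, False)] @ (p @ winv p)) = reduce (([(E, True)] @ p @ winv p @ [(E, False)]) @ p @ winv p @ [])"
      by simp
    also have "\<dots> = reduce ([(E, True)] @ p @ winv p @ [(E, False)])" by (subst reduce_cancel_words) simp
    also have "\<dots> = reduce ([] @ [(E, True), inv_letter (E, True)] @ [])" by (subst reduce_cancel_words) (simp add: inv_letter_def)
    also have "\<dots> = []" by (subst reduce_cancel) simp
    finally show ?thesis by (rule trans[OF arg_cong[OF qf, of reduce]])
  qed
  have ex0: "expo (V j) us = 0" if "\<And>q. q \<in> set us \<Longrightarrow> fst q \<notin> range V" for us j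
    using that by (induction us) auto
  have ex: "expo (V j) (qpart ?s) = 0" for j
    unfolding q by (rule ex0) (use Vp in fastforce)
  show "conjugate_in (presented_group L.gens L.rels) (word_value L.gens L.rels [L.tl (1, 0)])
      (word_value L.gens L.rels (test_word w)) \<longleftrightarrow> null_word (affine_gens m) (set rl) w"
    unfolding orbit_iff[symmetric]
    by (rule L.conjugate_translations[OF lat(1) 3 st]) (simp_all only: sw red ex)
qed

end

section \<open>Computability of the test words and the reduction\<close>

lemma list_encode_replicate:
  "list_encode (replicate n c @ l) = ((\<lambda>y. Suc (prod_encode (c, y))) ^^ n) (list_encode l)"
  by (induction n) simp_all

text \<open>The code is prepended to an arbitrary computable list, as with difference lists, so
  concatenating words requires no recursive function for appending.\<close>

definition codeable :: "(nat \<Rightarrow> nat word) \<Rightarrow> bool" where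
  "codeable W \<longleftrightarrow> (\<forall>L. rc 1 (\<lambda>xs. list_encode (L xs)) \<longrightarrow>
     rc 1 (\<lambda>xs. list_encode (map (\<lambda>(x, b). prod_encode (x, of_bool b)) (W (xs ! 0)) @ L xs)))"

lemma codeable_append: "codeable W1 \<Longrightarrow> codeable W2 \<Longrightarrow> codeable (\<lambda>x. W1 x @ W2 x)"
  unfolding codeable_def by simp

lemma codeable_Nil: "codeable (\<lambda>x. [])"
  by (simp add: codeable_def)

lemma codeable_replicate: "codeable (\<lambda>x. replicate x l)"
  unfolding codeable_def
proof (intro allI impI)
  fix L :: "nat list \<Rightarrow> nat list" assume L: "rc 1 (\<lambda>xs. list_encode (L xs))"
  obtain s b where l: "l = (s, b)" by fastforce
  have "rc 1 (\<lambda>xs. ((\<lambda>y. Suc (prod_encode (prod_encode (s, of_bool b), (y # xs) ! 0))) ^^ (xs ! 0)) (list_encode (L xs)))"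
    by (intro rc_funpow rc_nth L rc_Suc rc_prod_encode rc_const) simp_all
  then show "rc 1 (\<lambda>xs. list_encode (map (\<lambda>(x, b). prod_encode (x, of_bool b)) (replicate (xs ! 0) l) @ L xs))"
    by (simp add: l list_encode_replicate)
qed

lemma codeable_Cons: "codeable W \<Longrightarrow> codeable (\<lambda>x. l # W x)"
  unfolding codeable_def
proof (intro allI impI)
  fix L :: "nat list \<Rightarrow> nat list"
  assume W: "\<forall>L. rc 1 (\<lambda>xs. list_encode (L xs)) \<longrightarrow>
     rc 1 (\<lambda>xs. list_encode (map (\<lambda>(x, b). prod_encode (x, of_bool b)) (W (xs ! 0)) @ L xs))"
    and L: "rc 1 (\<lambda>xs. list_encode (L xs))"
  obtain s b where l: "l = (s, b)" by fastforce
  show "rc 1 (\<lambda>xs. list_encode (map (\<lambda>(x, b). prod_encode (x, of_bool b)) (l # W (xs ! 0)) @ L xs))"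
    using rc_Suc[OF rc_prod_encode[OF rc_const[of 1 "prod_encode (s, of_bool b)"] W[rule_format, OF L]]]
    by (simp add: l)
qed

lemma codeable_word_code:
  assumes "codeable W"
  shows "rc 1 (\<lambda>xs. word_code (W (xs ! 0)))"
proof -
  have "rc 1 (\<lambda>xs. list_encode (map (\<lambda>(x, b). prod_encode (x, of_bool b)) (W (xs ! 0)) @ []))"
    by (rule assms[unfolded codeable_def, rule_format, of "\<lambda>_. []"]) (rule rc_const)
  then show ?thesis by (simp add: word_code_def)
qed

theorem theorem1p2:
  shows "\<exists>(X :: nat set) (R :: nat word set).
    finite_presentation X R \<and>
    \<not> decidable_conjugacy_problem X R \<and>
    quadratic_dehn_function X R"
proof -
  obtain m c d h where sys: "affine_system m c d" "c (h mod m) = 0"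
    and und: "\<not> (\<exists>g. \<forall>x. rec_eval g [x] (of_bool ((affine_step m c d)\<^sup>*\<^sup>* x h)))"
    by (rule undecidable_affine_system) (rule that; assumption)
  obtain rl where rl: "set rl = affine_rels m c d h" using finite_list[OF finite_affine_rels] by blast
  obtain \<kappa> where \<kappa>: "\<kappa> \<ge> 1" "\<And>q d z. fst q \<in> ggens m rl \<Longrightarrow> z \<in> AU d \<Longrightarrow> gact rl q z \<in> AU (d + \<kappa>)"
    using kappa_exists[of m rl] by blast
  let ?A = "Inl ` ggens m rl \<union> Inr ` {a \<in> AU \<kappa>. arho a = a} :: (gen + amod) set"
  have "{a \<in> AU \<kappa>. arho a = a} \<subseteq> (MR \<inter> MU \<kappa>) \<times> (MR \<inter> MU \<kappa>)" by (auto simp: arho_iff AU_def)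
  then have "finite {a \<in> AU \<kappa>. arho a = a}" using finite_MR_MU by (meson finite_SigmaI finite_subset)
  then have "finite ?A" using finite_ggens by simp
  from finite_imp_inj_to_nat_seg[OF this] obtain enc :: "gen + amod \<Rightarrow> nat" where enc: "inj_on enc ?A"
    by blast
  have lattice: "tame_lattice (gact rl) AU api (ggens m rl) V \<kappa> arho enc"
    by (rule tame_lattice_gact[OF \<kappa>(2) enc])
  interpret L: tame_lattice "gact rl" AU api "ggens m rl" V \<kappa> arho enc by (rule lattice)
  note tw = test_word[OF lattice \<kappa>(1)]
  let ?W = "\<lambda>x. test_word enc (kw x)"
  \<comment> \<open>Unfolded, the test word of \<open>kw x\<close> consists of fixed letters and
    blocks of \<open>x\<close> equal letters.\<close>
  have cod: "codeable ?W"
    unfolding test_word_def[OF lattice] Let_def kw_def tw_def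
    by (simp add: winv_Cons inv_letter_def ql_def[OF lattice] winv_def)
      (intro codeable_append codeable_Cons codeable_Nil codeable_replicate)
  have "\<not> decidable_conjugacy_problem L.gens L.rels"
  proof
    assume "decidable_conjugacy_problem L.gens L.rels"
    then obtain f where f: "\<And>u v. u \<in> words L.gens \<Longrightarrow> v \<in> words L.gens \<Longrightarrow> rec_eval f [word_code u, word_code v]
        (of_bool (conjugate_in (presented_group L.gens L.rels) (word_value L.gens L.rels u) (word_value L.gens L.rels v)))"
      unfolding decidable_conjugacy_problem_def decidable_on_words_def by blast
    let ?u = "[L.tl (1, 0)]"
    obtain g1 where g1: "\<And>xs. length xs = 1 \<Longrightarrow> rec_eval g1 xs (word_code ?u)"
      using rc_const[of 1 "word_code ?u"] unfolding rc_def by blast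
    obtain g2 where g2: "\<And>xs. length xs = 1 \<Longrightarrow> rec_eval g2 xs (word_code (?W (xs ! 0)))"
      using codeable_word_code[OF cod] unfolding rc_def by blast
    \<comment> \<open>Composed with the computable map from \<open>x\<close> to its test word, the
      assumed procedure would decide reachability of \<open>h\<close>.\<close>
    have "rec_eval (Comp f [g1, g2]) [x] (of_bool ((affine_step m c d)\<^sup>*\<^sup>* x h))" for x
    proof (rule rec_eval.comp[where ys = "[word_code ?u, word_code (?W x)]"])
      show "\<forall>i<length [g1, g2]. rec_eval ([g1, g2] ! i) [x] ([word_code ?u, word_code (?W x)] ! i)"
        using g1[of "[x]"] g2[of "[x]"] by (auto simp: less_Suc_eq)
      have "conjugate_in (presented_group L.gens L.rels) (word_value L.gens L.rels ?u) (word_value L.gens L.rels (?W x))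
          \<longleftrightarrow> (affine_step m c d)\<^sup>*\<^sup>* x h"
        unfolding tw(1)[OF kw_words] rl by (rule null_word_kw_iff[OF sys])
      then show "rec_eval f [word_code ?u, word_code (?W x)] (of_bool ((affine_step m c d)\<^sup>*\<^sup>* x h))"
        using f[OF tw(2) tw(3), OF kw_words kw_words, of x] by simp
    qed simp
    then show False using und by blast
  qed
  then show ?thesis using L.finite_presentation_rels L.quadratic by blast
qed

end
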